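(* Let $w=i_n\cdots i_1$ be a reverse lattice word and $\sigma=\mathrm{std}(w)\in\mathfrak{S}_n$. Then $$\mu_{i_n}\cdots\mu_{i_1}(\varnothing)=\rho^{-1}(Q(\sigma)),$$ where the slides are computed with the convention that the vacated lower-left corner is filled with $\max(\cdot)+1$.
   Context: A word $w=i_n\cdots i_1$ of positive integers is reverse lattice if in every suffix $i_k\cdots i_1$ the number of occurrences of $j$ is at least the number of occurrences of $j+1$, for all $j\geq1$. The standardization $\mathrm{std}(w)$ is the permutation (in one-line notation, read left to right in the same order as $w$) obtained by replacing the letters of $w$ by $1,\ldots,n$, smaller letters receiving smaller values and equal letters receiving increasing values from left to right. SSRT/SRT (French convention, rows bottom to top): fillings of a partition weakly decreasing along rows left to right and strictly decreasing up columns; standard if the entries are $1,\ldots,n$. Variant Robinson–Schensted: for $\sigma=\sigma(1)\cdots\sigma(n)$ start with empty $P_0,Q_0$; for $k=1,\ldots,n$ insert $y=\sigma(k)$ into the first (bottom) row: while $y$ exceeds some entry of the current row, let $x$ be the greatest entry of that row smaller than $y$, replace $x$ by $y$, set $y:=x$ and pass to the next row up; otherwise place $y$ at the end of the row. If it was placed at $(a,b)$, $Q_k$ is $Q_{k-1}$ with $n-k+1$ placed at $(a,b)$. $Q(\sigma)=Q_n$ (the recording tableau). SSRCTs: compositions as reverse composition diagrams (row $r$ from the top has $\alpha_r$ left-justified boxes); an SSRCT of shape $\alpha$ has rows weakly decreasing, first column strictly increasing top to bottom, and for rows $r<s$, column $c$ with $(s,c+1)\in\alpha$: if $(r,c)\in\alpha$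 and $\tau(r,c)\geq\tau(s,c+1)$ then $(r,c+1)\in\alpha$ and $\tau(r,c+1)>\tau(s,c+1)$. $\rho$ sorts each column decreasingly from bottom to top, bottom-justified; it is a known bijection SSRCT $\to$ SSRT of straight shape. $\phi_{t+1}$ ($t\geq1$) on an SSRCT $\tau$ with a part equal to $t$ ($\tau=0$ outside the shape): $r_1$ the largest row index of a part equal to $t$; for $m\geq2$, $r_m$ the largest $r<r_{m-1}$ with $\tau(r,t)>\tau(r_{m-1},t)\geq\tau(r,t+1)$, ending at $r_k$; place, for $m=k,\ldots,2$, the original $\tau(r_{m-1},t)$ into $(r_m,t)$, delete box $(r_1,t)$ (and its row if empty); $\tau(r_k,t)$ exits. $\mu_i(\tau)$ (with the present convention): $\tau'=\tau$, $H=\varnothing$ if $i=1$; otherwise $\tau'=\phi_2(\cdots\phi_i(\tau)\cdots)$, $H$ the $i-1$ exiting entries; if $\tau'$ has shape $(\gamma_1,\ldots,\gamma_s)$, $\mu_i(\tau)$ has shape $(\gamma_1,\ldots,\gamma_s,i)$, first $s$ rows $\tau'$, and last row consisting of $\max(\tau)+1$ in its first box followed by $H$ in decreasing order, where $\max(\tau)$ is the largest entry of $\tau$ ($0$ for the empty tableau $\varnothing$). *)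

theory Defs
  imports Main
begin

text \<open>A word w = i_n ... i_1 is the list [i_n, ..., i_1] (read left to right).
  Its suffixes i_k ... i_1 are the lists drop j w.\<close>

definition reverse_lattice :: "nat list \<Rightarrow> bool" where
  "reverse_lattice w \<longleftrightarrow> (\<forall>i\<in>set w. 1 \<le> i) \<and>
     (\<forall>j m. 1 \<le> m \<longrightarrow> count_list (drop j w) (Suc m) \<le> count_list (drop j w) m)"

definition std :: "nat list \<Rightarrow> nat list" where
  "std w = map (\<lambda>p. Suc (card {q. q < length w \<and>
              (w ! q < w ! p \<or> (w ! q = w ! p \<and> q < p))})) [0..<length w]"

text \<open>A tableau of straight shape is a list of rows, bottom row first; each row
  is listed left to right.\<close>

type_synonym tab = "nat list list"

text \<open>Insert y into the tableau: in a weakly decreasing row the greatest entry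
  smaller than y is the leftmost entry smaller than y. Returns the new tableau
  and the (0-based) index of the row in which a box was added (at the end).\<close>
fun rs_ins :: "tab \<Rightarrow> nat \<Rightarrow> tab \<times> nat" where
  "rs_ins [] y = ([[y]], 0)"
| "rs_ins (row # rows) y =
     (let idx = length (takeWhile (\<lambda>x. \<not> x < y) row) in
      if idx < length row then
        (let (rows', a) = rs_ins rows (row ! idx) in (row[idx := y] # rows', Suc a))
      else ((row @ [y]) # rows, 0))"

definition add_at :: "tab \<Rightarrow> nat \<Rightarrow> nat \<Rightarrow> tab" where
  "add_at Q a v = (if a < length Q then Q[a := Q ! a @ [v]] else Q @ [[v]])"

text \<open>Processing sigma(k), ..., sigma(n); m = n - k + 1 is the recorded value.\<close>
fun rs_loop :: "nat list \<Rightarrow> nat \<Rightarrow> tab \<Rightarrow> tab \<Rightarrow> tab" where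
  "rs_loop [] m P Q = Q"
| "rs_loop (y # ys) m P Q =
     (let (P', a) = rs_ins P y in rs_loop ys (m - 1) P' (add_at Q a m))"

definition rs_Q :: "nat list \<Rightarrow> tab" where
  "rs_Q \<sigma> = rs_loop \<sigma> (length \<sigma>) [] []"

text \<open>A composition tableau is a list of rows, top row first (row r has
  alpha_r boxes, left justified). Rows and columns are 1-based below;
  ent gives 0 outside the shape.\<close>

definition ent :: "tab \<Rightarrow> nat \<Rightarrow> nat \<Rightarrow> nat" where
  "ent \<tau> r c = (if 1 \<le> r \<and> r \<le> length \<tau> \<and> 1 \<le> c \<and> c \<le> length (\<tau> ! (r - 1))
                 then \<tau> ! (r - 1) ! (c - 1) else 0)"

definition inshape :: "tab \<Rightarrow> nat \<Rightarrow> nat \<Rightarrow> bool" where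
  "inshape \<tau> r c \<longleftrightarrow> 1 \<le> r \<and> r \<le> length \<tau> \<and> 1 \<le> c \<and> c \<le> length (\<tau> ! (r - 1))"

definition SSRCT :: "tab \<Rightarrow> bool" where
  "SSRCT \<tau> \<longleftrightarrow>
     (\<forall>row\<in>set \<tau>. row \<noteq> [] \<and> (\<forall>x\<in>set row. 1 \<le> x) \<and> sorted_wrt (\<ge>) row) \<and>
     (\<forall>r s. 1 \<le> r \<longrightarrow> r < s \<longrightarrow> s \<le> length \<tau> \<longrightarrow> ent \<tau> r 1 < ent \<tau> s 1) \<and>
     (\<forall>r s c. 1 \<le> r \<longrightarrow> r < s \<longrightarrow> 1 \<le> c \<longrightarrow> inshape \<tau> s (Suc c) \<longrightarrow>
        inshape \<tau> r c \<longrightarrow> ent \<tau> s (Suc c) \<le> ent \<tau> r c \<longrightarrow>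
        inshape \<tau> r (Suc c) \<and> ent \<tau> s (Suc c) < ent \<tau> r (Suc c))"

text \<open>rho: sort each column decreasingly from bottom to top, bottom justified;
  the result is a list of rows, bottom row first.\<close>

definition col :: "tab \<Rightarrow> nat \<Rightarrow> nat list" where
  "col \<tau> c = [\<tau> ! r ! (c - 1). r \<leftarrow> [0..<length \<tau>], c \<le> length (\<tau> ! r)]"

definition ncols :: "tab \<Rightarrow> nat" where
  "ncols \<tau> = foldr max (map length \<tau>) 0"

definition rho :: "tab \<Rightarrow> tab" where
  "rho \<tau> = map (\<lambda>j. map (\<lambda>c. rev (sort (col \<tau> c)) ! j)
                       (filter (\<lambda>c. j < length (col \<tau> c)) [1..<Suc (ncols \<tau>)]))
              [0..<length (col \<tau> 1)]"

fun find_prev :: "(nat \<Rightarrow> bool) \<Rightarrow> nat \<Rightarrow> nat option" where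
  "find_prev P 0 = None"
| "find_prev P (Suc k) = (if 1 \<le> k \<and> P k then Some k else find_prev P k)"

lemma find_prev_less: "find_prev P r = Some r' \<Longrightarrow> r' < r"
  by (induction P r rule: find_prev.induct) (auto split: if_splits)

definition upd :: "tab \<Rightarrow> nat \<Rightarrow> nat \<Rightarrow> nat \<Rightarrow> tab" where
  "upd \<tau> r c v = \<tau>[r - 1 := (\<tau> ! (r - 1))[c - 1 := v]]"

text \<open>slide tau t r: r is r_{m-1}; finds r_m, moves the original entry
  tau(r_{m-1},t) into (r_m,t), recursively; returns the modified tableau and
  the exiting entry tau(r_k,t). All reads are from the original tau.\<close>
function slide :: "tab \<Rightarrow> nat \<Rightarrow> nat \<Rightarrow> tab \<times> nat" where
  "slide \<tau> t r =
     (let v = ent \<tau> r t in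
      case find_prev (\<lambda>r'. v < ent \<tau> r' t \<and> ent \<tau> r' (Suc t) \<le> v) r of
        None \<Rightarrow> (\<tau>, v)
      | Some r' \<Rightarrow> (let (\<tau>', e) = slide \<tau> t r' in (upd \<tau>' r' t v, e)))"
  by pat_completeness auto
termination
  by (relation "measure (\<lambda>(\<tau>, t, r). r)") (auto dest: find_prev_less)

definition del_box :: "tab \<Rightarrow> nat \<Rightarrow> tab" where
  "del_box \<tau> r = (if butlast (\<tau> ! (r - 1)) = [] then take (r - 1) \<tau> @ drop r \<tau>
                   else \<tau>[r - 1 := butlast (\<tau> ! (r - 1))])"

text \<open>phi_succ t tau is phi_{t+1}(tau) together with the exiting entry
  (meaningful when tau has a part equal to t).\<close>
definition phi_succ :: "nat \<Rightarrow> tab \<Rightarrow> tab \<times> nat" where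
  "phi_succ t \<tau> =
     (let r1 = Max {r. 1 \<le> r \<and> r \<le> length \<tau> \<and> length (\<tau> ! (r - 1)) = t};
          (\<tau>', e) = slide \<tau> t r1
      in (del_box \<tau>' r1, e))"

fun phis :: "nat \<Rightarrow> tab \<Rightarrow> tab \<times> nat list" where
  "phis 0 \<tau> = (\<tau>, [])"
| "phis (Suc 0) \<tau> = (\<tau>, [])"
| "phis (Suc (Suc j)) \<tau> =
     (let (\<tau>1, e) = phi_succ (Suc j) \<tau>; (\<tau>2, H) = phis (Suc j) \<tau>1 in (\<tau>2, e # H))"

definition tmax :: "tab \<Rightarrow> nat" where
  "tmax \<tau> = foldr max (concat \<tau>) 0"

definition mu :: "nat \<Rightarrow> tab \<Rightarrow> tab" where
  "mu i \<tau> = (let (\<tau>', H) = phis i \<tau> in \<tau>' @ [Suc (tmax \<tau>) # rev (sort H)])"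

end

theory Submission
  imports Defs
begin

text \<open>
  Both sides are built letter by letter from the right end of the word, and both are determined by
  their column sets. Write $C_c$ and $C'_c$ for the set of entries in column $c$ before and after the
  letter $i$ is prepended. One shows on both sides that $C'_c = (C_c \setminus \{e_c\}) \cup
  \{e_{c-1}\}$ for $c \le i$ (with $e_0$ the new maximum and nothing removed from $C_i$), where, for
  $c = i-1, \dots, 1$, $e_c$ is the smallest $v \in C_c$ such that $C_c$ and $C_{c+1} \setminus
  \{e_{c+1}\}$ have equally many entries above $v$. This determines $e_{i-1}, \dots, e_1$.

  On the composition side $e_c$ is the exiting entry of $\phi_{c+1}$: an entry $v$ of column $c$ has
  this balance iff every row with an entry above $v$ in column $c$ has one above $v$ in column $c+1$.

  On the insertion side one runs the algorithm on $\sigma = y\sigma'$ and on $\sigma'$ in parallel.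
  The two insertion tableaux always differ by a left (column) insertion of $y$, so their shapes differ
  by a single cell. While the remaining letters are inserted this cell moves one column to the right,
  or one row up within its column; $e_c$ is the label of the step at which it leaves column $c$. It
  ends in column $i$ because the insertion tableau of a reverse lattice word has in its $j$-th row
  exactly the occurrences of letters with $j-1$ equal letters to their right.
\<close>

section \<open>Insertion into tableaux differing by a left insertion\<close>

text \<open>Labels are recorded in decreasing order, so the entries of a recording column above v
  are exactly the boxes already present when v is written. Equal counts above v thus mean equal
  heights at an earlier moment, and the times at which the extra cell changes column can be
  recovered from the final column sets alone. This makes the insertion side comparable with the
  slides, which see no history. Words are built from the right end because the k-th of n letters
  receives the label n - k + 1: prepending a letter leaves the labels of all other letters
  unchanged. The obstacle on the insertion side is that the bump paths of one letter in the two
  tableaux may differ. The count condition carried along with the left insertion confines this: the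
  values entering the two tableaux never differ in two consecutive rows of their common course.
  Insertion tableaux are handled as families of row sets, so no positions inside rows have to be
  followed.\<close>

definition card_above :: "nat set \<Rightarrow> nat \<Rightarrow> nat" where
  "card_above R d = card {r\<in>R. d < r}"

definition card_from :: "nat set \<Rightarrow> nat \<Rightarrow> nat" where
  "card_from R d = card {r\<in>R. d \<le> r}"

lemma card_above_insert: "finite R \<Longrightarrow> x \<notin> R \<Longrightarrow> card_above (insert x R) d = card_above R d + (if d < x then 1 else 0)"
proof -
  assume a: "finite R" "x \<notin> R"
  have "{r\<in>insert x R. d < r} = (if d < x then insert x {r\<in>R. d < r} else {r\<in>R. d < r})" by auto
  then show ?thesis using a by (auto simp: card_above_def)
qed

lemma card_from_insert: "finite R \<Longrightarrow> x \<notin> R \<Longrightarrow> card_from (insert x R) d = card_from R d + (if d \<le> x then 1 else 0)"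
proof -
  assume a: "finite R" "x \<notin> R"
  have "{r\<in>insert x R. d \<le> r} = (if d \<le> x then insert x {r\<in>R. d \<le> r} else {r\<in>R. d \<le> r})" by auto
  then show ?thesis using a by (auto simp: card_from_def)
qed

lemma card_above_remove: "finite R \<Longrightarrow> b \<in> R \<Longrightarrow> card_above (R - {b}) d + (if d < b then 1 else 0) = card_above R d"
  using card_above_insert[of "R - {b}" b d] by (simp add: insert_absorb)

lemma card_from_remove: "finite R \<Longrightarrow> b \<in> R \<Longrightarrow> card_from (R - {b}) d + (if d \<le> b then 1 else 0) = card_from R d"
  using card_from_insert[of "R - {b}" b d] by (simp add: insert_absorb)

lemma card_above_swap: "finite R \<Longrightarrow> b \<in> R \<Longrightarrow> x \<notin> R \<Longrightarrow>
    card_above (insert x (R - {b})) d + (if d < b then 1 else 0) = card_above R d + (if d < x then 1 else 0)"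
  using card_above_insert[of "R - {b}" x d] card_above_remove[of R b d] by simp

lemma card_from_swap: "finite R \<Longrightarrow> b \<in> R \<Longrightarrow> x \<notin> R \<Longrightarrow>
    card_from (insert x (R - {b})) d + (if d \<le> b then 1 else 0) = card_from R d + (if d \<le> x then 1 else 0)"
  using card_from_insert[of "R - {b}" x d] card_from_remove[of R b d] by simp

lemma card_above_mono: "finite R \<Longrightarrow> d \<le> d' \<Longrightarrow> card_above R d' \<le> card_above R d"
  unfolding card_above_def by (rule card_mono) auto

lemma card_from_mono: "finite R \<Longrightarrow> d \<le> d' \<Longrightarrow> card_from R d' \<le> card_from R d"
  unfolding card_from_def by (rule card_mono) auto

lemma card_above_less: "finite R \<Longrightarrow> b \<in> R \<Longrightarrow> d < b \<Longrightarrow> card_above R b < card_above R d"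
  using card_above_remove[of R b d] card_above_remove[of R b b] card_above_mono[of "R - {b}" d b] by simp

lemma card_from_less: "finite R \<Longrightarrow> b \<in> R \<Longrightarrow> b < d \<Longrightarrow> card_from R d < card_from R b"
  using card_from_remove[of R b d] card_from_remove[of R b b] card_from_mono[of "R - {b}" b d] by simp

lemma card_above_eqI: "d \<le> d' \<Longrightarrow> (\<And>r. r \<in> R \<Longrightarrow> d < r \<Longrightarrow> d' < r) \<Longrightarrow> card_above R d = card_above R d'"
  unfolding card_above_def by (rule arg_cong[where f=card]) force

lemma card_from_eqI: "d \<le> d' \<Longrightarrow> (\<And>r. r \<in> R \<Longrightarrow> d \<le> r \<Longrightarrow> d' \<le> r) \<Longrightarrow> card_from R d = card_from R d'"
  unfolding card_from_def by (rule arg_cong[where f=card]) force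

text \<open>$B\,j$ is the value entering row $j$ (rows counted from $0$, bottom row first), and a box is
  added in row $a$. Values of $B$ beyond $a$ are irrelevant.\<close>

definition bump_path :: "(nat \<Rightarrow> nat set) \<Rightarrow> (nat \<Rightarrow> nat) \<Rightarrow> nat \<Rightarrow> (nat \<Rightarrow> nat set) \<Rightarrow> bool" where
  "bump_path R B a R2 \<longleftrightarrow>
     (\<forall>j<a. B (Suc j) \<in> R j \<and> B (Suc j) < B j \<and> (\<forall>r\<in>R j. r < B j \<longrightarrow> r \<le> B (Suc j))) \<and>
     (\<forall>r\<in>R a. B a < r) \<and>
     (\<forall>j. R2 j = (if j < a then insert (B j) (R j - {B (Suc j)})
                  else if j = a then insert (B a) (R a) else R j))"

text \<open>Column strictness without columns: when rows are listed decreasingly, the k-th entry of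
  row j + 1 is below the k-th entry of row j for every k exactly when, for every threshold d, row j
  + 1 has at most as many entries from d on as row j has beyond d. The threshold 0 gives weakly
  decreasing row lengths.\<close>

definition std_rows :: "(nat \<Rightarrow> nat set) \<Rightarrow> bool" where
  "std_rows R \<longleftrightarrow> (\<forall>j. finite (R j)) \<and> (\<forall>i j. i \<noteq> j \<longrightarrow> R i \<inter> R j = {}) \<and>
     (\<forall>j d. card_from (R (Suc j)) d \<le> card_above (R j) d)"

section \<open>Row insertion on families of row sets\<close>

lemma bump_path_fresh:
  assumes "std_rows R" "bump_path R B a R2" "\<forall>j. B 0 \<notin> R j" "j \<le> a"
  shows "B j \<notin> R j"
proof (cases j)
  case 0
  then show ?thesis using assms by simp
next
  case (Suc i)
  then have "B j \<in> R i" using assms(2,4) by (auto simp: bump_path_def)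
  moreover have "R j \<inter> R i = {}" using assms(1) Suc by (simp add: std_rows_def)
  ultimately show ?thesis by blast
qed

lemma bump_path_sub:
  assumes "bump_path R B a R2" "v \<in> R2 j"
  shows "v = B j \<and> j \<le> a \<or> v \<in> R j \<and> \<not> (j < a \<and> v = B (Suc j))"
  using assms by (auto simp: bump_path_def split: if_splits)

text \<open>The delicate rows are those with j < a. Row j trades b = \<open>B (Suc j)\<close> for
  the larger \<open>B j\<close>, so its counts do not drop; row j + 1 gains b, which matters only
  for thresholds d \<le> b.\<close>

lemma bump_path_std_rows:
  assumes st: "std_rows R" and i: "bump_path R B a R2" and f: "\<forall>j. B 0 \<notin> R j"
  shows "std_rows R2"
proof -
  note st' = st[unfolded std_rows_def]
  have R2: "R2 j = (if j < a then insert (B j) (R j - {B (Suc j)})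
                  else if j = a then insert (B a) (R a) else R j)" for j
    using i by (auto simp: bump_path_def)
  have bump_mem: "j < a \<Longrightarrow> B (Suc j) \<in> R j \<and> B (Suc j) < B j" for j using i by (auto simp: bump_path_def)
  have bump_max: "j < a \<Longrightarrow> r \<in> R j \<Longrightarrow> r < B j \<Longrightarrow> r \<le> B (Suc j)" for j r using i by (auto simp: bump_path_def)
  have bump_max': "r \<in> R a \<Longrightarrow> B a < r" for r using i by (auto simp: bump_path_def)
  have bump_fresh: "j \<le> a \<Longrightarrow> B j \<notin> R j" for j using bump_path_fresh[OF st i f] .
  have fin: "finite (R2 j)" for j using st' by (auto simp: R2)
  have dj: "v \<in> R k \<Longrightarrow> v \<in> R l \<Longrightarrow> k = l" for v k l using st' by blast
  have Bw: "j = Suc l" if "j \<le> a" "B j \<in> R l" for j l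
  proof (cases j)
    case 0
    then show ?thesis using f that by simp
  next
    case (Suc i)
    then show ?thesis using bump_mem[of i] dj[of "B j" i l] that by simp
  qed
  have Bdec: "j < k \<Longrightarrow> k \<le> a \<Longrightarrow> B k < B j" for j k
  proof (induction k)
    case (Suc k)
    then show ?case using bump_mem[of k] by (cases "j = k") auto
  qed simp
  have disj: "R2 k \<inter> R2 l = {}" if "k \<noteq> l" for k l
  proof (rule ccontr)
    assume "R2 k \<inter> R2 l \<noteq> {}"
    then obtain v where v: "v \<in> R2 k" "v \<in> R2 l" by auto
    from bump_path_sub[OF i v(1)] bump_path_sub[OF i v(2)] that
    show False using Bw Bdec dj by (metis Suc_le_eq less_irrefl linorder_neqE_nat)
  qed
  have "card_from (R2 (Suc j)) d \<le> card_above (R2 j) d" for j d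
  proof -
    have old: "card_from (R (Suc j)) d' \<le> card_above (R j) d'" for d' using st' by auto
    have fj: "finite (R k)" for k using st' by auto
    consider "j < a" | "j = a" | "j > a" by linarith
    then show ?thesis
    proof cases
      case 1
      let ?b = "B (Suc j)"
      have g: "card_above (R2 j) d + (if d < ?b then 1 else 0) = card_above (R j) d + (if d < B j then 1 else 0)"
        using card_above_swap[OF fj, of ?b j "B j" d] bump_mem[OF 1] bump_fresh[of j] 1 by (simp add: R2)
      have bb: "?b < B j" "?b \<in> R j" using bump_mem[OF 1] by auto
      have fb: "?b \<notin> R (Suc j)" using bump_fresh[of "Suc j"] 1 by simp
      have up: "card_from (R2 (Suc j)) d \<le> card_from (R (Suc j)) d + (if d \<le> ?b then 1 else 0)"
      proof (cases "Suc j < a")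
        case True
        then show ?thesis
          using card_from_swap[OF fj, of "B (Suc (Suc j))" "Suc j" ?b d] bump_mem[OF True] fb by (simp add: R2)
      next
        case False
        then have "Suc j = a" using 1 by simp
        then show ?thesis using card_from_insert[OF fj, of ?b "Suc j" d] fb by (simp add: R2)
      qed
      \<comment> \<open>For d < b the gain has to be absorbed. Either row j + 1 ejects an entry that
        is also at least d, or it has no entry in the interval from d up to b. In the latter case
        the old condition at b leaves room, since b itself is counted in row j beyond d but not
        beyond b.\<close>
      consider "d > ?b" | "d = ?b" | "d < ?b" "Suc j < a" "d \<le> B (Suc (Suc j))"
        | "d < ?b" "\<forall>r\<in>R (Suc j). r < ?b \<longrightarrow> r < d"
        using bump_max'[of] bump_max[of "Suc j"] 1 by (metis Suc_lessI leI le_less_trans less_asym linorder_neqE_nat)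
      then show ?thesis
      proof cases
        case 1
        then show ?thesis using up old[of d] g by auto
      next
        case 2
        then show ?thesis using up old[of d] g bb by auto
      next
        case 3
        then show ?thesis
          using card_from_swap[OF fj, of "B (Suc (Suc j))" "Suc j" ?b d] bump_mem[of "Suc j"] fb old[of d] g bb
          by (simp add: R2)
      next
        case 4
        have "card_from (R (Suc j)) d = card_from (R (Suc j)) ?b"
          by (rule card_from_eqI) (use 4 leD leI in \<open>blast intro: less_imp_le\<close>)+
        also have "\<dots> \<le> card_above (R j) ?b" by (rule old)
        also have "\<dots> < card_above (R j) d" using card_above_less[OF fj bb(2) 4(1)] .
        finally show ?thesis using up g bb 4(1) by auto
      qed
    next
      case 2
      then show ?thesis
        using old[of d] card_above_insert[OF fj, of "B a" a d] bump_fresh[of a] by (simp add: R2)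
    next
      case 3
      then show ?thesis using old[of d] by (simp add: R2)
    qed
  qed
  then show ?thesis using fin disj by (auto simp: std_rows_def)
qed

text \<open>$R'$ arises from $R$ by a left insertion read from the top down: the path finally settles in row
  $p$, and $z_j$ is the value it brings into row $j$. A row skipped by the path has $z_{j+1} = z_j$;
  above the path $z$ is constantly the inserted value. The cardinality condition says that $z_j$, which
  comes from the column of row $j+1$ containing it, enters row $j$ in the next column.\<close>

definition left_inserted :: "(nat \<Rightarrow> nat set) \<Rightarrow> (nat \<Rightarrow> nat set) \<Rightarrow> nat \<Rightarrow> (nat \<Rightarrow> nat) \<Rightarrow> bool" where
  "left_inserted R R' p z \<longleftrightarrow> (\<forall>j<p. R' j = R j) \<and> R' p = insert (z p) (R p) \<and>
     (\<forall>j\<ge>p. z j \<notin> R j \<and> R' (Suc j) = insert (z (Suc j)) (R (Suc j)) - {z j} \<and>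
       (z j \<in> R (Suc j) \<and> z j < z (Suc j) \<or> z (Suc j) = z j \<and> z j \<notin> R (Suc j)) \<and>
       card_above (R j) (z j) = card_from (R (Suc j)) (z j))"

text \<open>One letter is inserted into the tableaux without (R) and with (R') the prepended letter.
  What is proved in this setting is Schensted's commutation of row and column insertion, together
  with a record of how the shapes change.\<close>

locale insert_both =
  fixes R R' :: "nat \<Rightarrow> nat set" and p :: nat and z B B' :: "nat \<Rightarrow> nat" and a a' :: nat
    and R2 R2' :: "nat \<Rightarrow> nat set"
  assumes st: "std_rows R" and st': "std_rows R'" and left_inserted: "left_inserted R R' p z"
    and i: "bump_path R B a R2" and i': "bump_path R' B' a' R2'"
    and B0: "B' 0 = B 0" and fresh: "\<And>j. B 0 \<notin> R j" and fresh': "\<And>j. B 0 \<notin> R' j"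
begin

lemma fin: "finite (R j)" using st by (auto simp: std_rows_def)
lemma dj: "v \<in> R k \<Longrightarrow> v \<in> R l \<Longrightarrow> k = l" using st by (auto simp: std_rows_def)
lemma dj': "v \<in> R' k \<Longrightarrow> v \<in> R' l \<Longrightarrow> k = l" using st' by (auto simp: std_rows_def)
lemma cs: "card_from (R (Suc j)) d \<le> card_above (R j) d" using st by (auto simp: std_rows_def)
lemma cs': "card_from (R' (Suc j)) d \<le> card_above (R' j) d" using st' by (auto simp: std_rows_def)

lemma bump_mem: "j < a \<Longrightarrow> B (Suc j) \<in> R j \<and> B (Suc j) < B j" using i by (auto simp: bump_path_def)
lemma bump_max: "j < a \<Longrightarrow> r \<in> R j \<Longrightarrow> r < B j \<Longrightarrow> r \<le> B (Suc j)" using i by (auto simp: bump_path_def)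
lemma stop_max: "r \<in> R a \<Longrightarrow> B a < r" using i by (auto simp: bump_path_def)
lemma R2: "R2 j = (if j < a then insert (B j) (R j - {B (Suc j)})
                  else if j = a then insert (B a) (R a) else R j)"
  using i by (auto simp: bump_path_def)
lemma bump_mem': "j < a' \<Longrightarrow> B' (Suc j) \<in> R' j \<and> B' (Suc j) < B' j" using i' by (auto simp: bump_path_def)
lemma bump_max': "j < a' \<Longrightarrow> r \<in> R' j \<Longrightarrow> r < B' j \<Longrightarrow> r \<le> B' (Suc j)" using i' by (auto simp: bump_path_def)
lemma stop_max': "r \<in> R' a' \<Longrightarrow> B' a' < r" using i' by (auto simp: bump_path_def)
lemma R2': "R2' j = (if j < a' then insert (B' j) (R' j - {B' (Suc j)})
                  else if j = a' then insert (B' a') (R' a') else R' j)"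
  using i' by (auto simp: bump_path_def)
lemma bump_fresh: "j \<le> a \<Longrightarrow> B j \<notin> R j" using bump_path_fresh[OF st i] fresh by auto
lemma bump_fresh': "j \<le> a' \<Longrightarrow> B' j \<notin> R' j" using bump_path_fresh[OF st' i'] fresh' B0 by auto

lemma bump_eqI: "j \<le> a' \<Longrightarrow> b \<in> R' j \<Longrightarrow> b < B' j \<Longrightarrow> (\<And>r. r \<in> R' j \<Longrightarrow> r < B' j \<Longrightarrow> r \<le> b)
    \<Longrightarrow> j < a' \<and> B' (Suc j) = b"
  using bump_mem' bump_max' stop_max' by (metis le_antisym le_neq_implies_less less_asym)

lemma stopI: "j \<le> a' \<Longrightarrow> (\<And>r. r \<in> R' j \<Longrightarrow> B' j < r) \<Longrightarrow> a' = j"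
  using bump_mem' by (metis le_neq_implies_less less_asym)

lemma row_below: "j < p \<Longrightarrow> R' j = R j" using left_inserted by (auto simp: left_inserted_def)
lemma row_p: "R' p = insert (z p) (R p)" using left_inserted by (auto simp: left_inserted_def)
lemma z_notin: "p \<le> j \<Longrightarrow> z j \<notin> R j" using left_inserted by (auto simp: left_inserted_def)
lemma row_Suc: "p \<le> j \<Longrightarrow> R' (Suc j) = insert (z (Suc j)) (R (Suc j)) - {z j}"
  using left_inserted by (auto simp: left_inserted_def)
lemma z_cases: "p \<le> j \<Longrightarrow> z j \<in> R (Suc j) \<and> z j < z (Suc j) \<or> z (Suc j) = z j \<and> z j \<notin> R (Suc j)"
  using left_inserted by (auto simp: left_inserted_def)
lemma tight: "p \<le> j \<Longrightarrow> card_above (R j) (z j) = card_from (R (Suc j)) (z j)" using left_inserted by (auto simp: left_inserted_def)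

lemma row_subset: "R' j \<subseteq> insert (z j) (R j)" if "p \<le> j"
proof (cases "j = p")
  case True
  then show ?thesis using row_p by simp
next
  case False
  then have j: "j = Suc (j - 1)" "p \<le> j - 1" using that by auto
  show ?thesis using row_Suc[OF j(2)] unfolding j(1)[symmetric] by blast
qed

lemma z_mono: "p \<le> j \<Longrightarrow> z j \<le> z (Suc j)" using z_cases[of j] by auto

lemma bump_below: "j \<le> p \<Longrightarrow> j \<le> a \<Longrightarrow> j \<le> a' \<and> B' j = B j"
proof (induction j)
  case 0
  then show ?case using B0 by simp
next
  case (Suc j)
  then have IH: "j \<le> a'" "B' j = B j" by auto
  have e: "R' j = R j" using row_below Suc by simp
  show ?case using bump_eqI[OF IH(1), of "B (Suc j)"] bump_mem[of j] bump_max[of j] Suc.prems e IH by auto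
qed

lemma low_case: "a < p \<Longrightarrow> a' = a \<and> left_inserted R2 R2' p z"
proof -
  assume ap: "a < p"
  have *: "a \<le> a'" "B' a = B a" using bump_below[of a] ap by auto
  have aa: "a' = a" using stopI[OF *(1)] * stop_max row_below[OF ap] by auto
  have B: "j \<le> a \<Longrightarrow> B' j = B j" for j using bump_below[of j] ap by auto
  have l: "R2' j = R2 j" if "j < p" for j using B row_below[OF that] by (auto simp: R2 R2' aa)
  have h: "p \<le> j \<Longrightarrow> R2' j = R' j \<and> R2 j = R j" for j using ap by (auto simp: R2 R2' aa)
  show ?thesis using aa l h left_inserted by (auto simp: left_inserted_def)
qed

text \<open>The path in R ends in row p. Row p of R' either also takes the new value at its end or
  gives up \<open>z p\<close>. In the second case all of R p lies above \<open>z p\<close>, so the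
  balance at p forces rows p and p + 1 of R to have equal size and all entries of row p + 1 to be at
  least \<open>z p\<close>. Hence \<open>z p\<close> settles at the end of row p + 1 and the extra
  cell rises by one row.\<close>

lemma top_case: "a = p \<Longrightarrow> (a' = a \<and> left_inserted R2 R2' p z) \<or>
   (a' = Suc p \<and> left_inserted R2 R2' (Suc p) z \<and> card (R p) = card (R (Suc p)))"
proof -
  assume ap: "a = p"
  have *: "p \<le> a'" "B' p = B p" using bump_below[of p] ap by auto
  have B: "j \<le> p \<Longrightarrow> B' j = B j" for j using bump_below[of j] ap by auto
  have ne: "B p \<noteq> z p" using bump_fresh'[of p] * row_p by auto
  show ?thesis
  proof (cases "B p < z p")
    case True
    have aa: "a' = a" using stopI[OF *(1)] * stop_max ap row_p True by auto
    have l: "R2' j = R2 j" if "j < p" for j using B row_below[OF that] that by (auto simp: R2 R2' aa ap)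
    have h: "p < j \<Longrightarrow> R2' j = R' j \<and> R2 j = R j" for j using ap by (auto simp: R2 R2' aa)
    have q: "R2 p = insert (B p) (R p)" "R2' p = insert (B p) (R' p)"
      using ap * by (auto simp: R2 R2' aa)
    have g: "card_above (R2 p) (z p) = card_above (R p) (z p)"
      using card_above_insert[OF fin bump_fresh[of p], of "z p"] True ap q by simp
    have "left_inserted R2 R2' p z" unfolding left_inserted_def
    proof (intro conjI allI impI)
      fix j assume "j < p" then show "R2' j = R2 j" by (rule l)
    next
      show "R2' p = insert (z p) (R2 p)" using q row_p by auto
    next
      fix j assume j: "p \<le> j"
      show "z j \<notin> R2 j" using z_notin[OF j] h[of j] q ne j by (cases "j = p") auto
      show "R2' (Suc j) = insert (z (Suc j)) (R2 (Suc j)) - {z j}" using row_Suc[OF j] h[of "Suc j"] j by auto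
      show "z j \<in> R2 (Suc j) \<and> z j < z (Suc j) \<or> z (Suc j) = z j \<and> z j \<notin> R2 (Suc j)"
        using z_cases[OF j] h[of "Suc j"] j by auto
      show "card_above (R2 j) (z j) = card_from (R2 (Suc j)) (z j)"
        using tight[OF j] h[of "Suc j"] h[of j] g j by (cases "j = p") auto
    qed
    then show ?thesis using aa by simp
  next
    case False
    then have lt: "z p < B p" using ne by simp
    have b: "p < a'" "B' (Suc p) = z p"
      using bump_eqI[OF *(1), of "z p"] row_p lt * stop_max ap by force+
    have "card_above (R p) (z p) = card (R p)"
      unfolding card_above_def using stop_max ap lt by (intro arg_cong[where f=card]) force
    moreover have "card_from (R (Suc p)) (z p) \<le> card (R (Suc p))"
      unfolding card_from_def using fin by (intro card_mono) auto
    moreover have c2: "card (R (Suc p)) \<le> card (R p)"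
    proof -
      have "card (R (Suc p)) = card_from (R (Suc p)) 0" by (simp add: card_from_def)
      also have "\<dots> \<le> card_above (R p) 0" by (rule cs)
      also have "\<dots> \<le> card (R p)" unfolding card_above_def using fin by (intro card_mono) auto
      finally show ?thesis .
    qed
    ultimately have eq: "card (R p) = card (R (Suc p))" "card_from (R (Suc p)) (z p) = card (R (Suc p))"
      using tight[of p] by auto
    have "{r \<in> R (Suc p). z p \<le> r} = R (Suc p)"
      using eq(2) fin by (intro card_subset_eq) (auto simp: card_from_def)
    then have all: "r \<in> R (Suc p) \<Longrightarrow> z p \<le> r" for r by auto
    have aa: "a' = Suc p"
    proof (rule stopI)
      show "Suc p \<le> a'" using b by simp
      fix r assume r: "r \<in> R' (Suc p)"
      then show "B' (Suc p) < r" using row_Suc[of p] all[of r] z_mono[of p] b by force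
    qed
    have l: "R2' j = R2 j" if "j < p" for j using B row_below[OF that] that by (auto simp: R2 R2' aa ap)
    have h: "Suc p < j \<Longrightarrow> R2' j = R' j" "p < j \<Longrightarrow> R2 j = R j" for j using ap by (auto simp: R2 R2' aa)
    have q: "R2 p = insert (B p) (R p)" "R2' p = insert (B p) (R' p - {z p})"
      using ap * b by (auto simp: R2 R2' aa)
    have qS: "R2' (Suc p) = insert (z p) (R' (Suc p))" using b by (auto simp: R2' aa)
    have "left_inserted R2 R2' (Suc p) z" unfolding left_inserted_def
    proof (intro conjI allI impI)
      fix j assume "j < Suc p" then show "R2' j = R2 j"
        using l[of j] q row_p z_notin[of p] by (cases "j = p") auto
    next
      show "R2' (Suc p) = insert (z (Suc p)) (R2 (Suc p))" using qS row_Suc[of p] z_cases[of p] h(2)[of "Suc p"] by auto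
    next
      fix j assume j: "Suc p \<le> j"
      show "z j \<notin> R2 j" using z_notin[of j] h[of j] j by auto
      show "R2' (Suc j) = insert (z (Suc j)) (R2 (Suc j)) - {z j}" using row_Suc[of j] h[of "Suc j"] j by auto
      show "z j \<in> R2 (Suc j) \<and> z j < z (Suc j) \<or> z (Suc j) = z j \<and> z j \<notin> R2 (Suc j)"
        using z_cases[of j] h[of "Suc j"] j by auto
      show "card_above (R2 j) (z j) = card_from (R2 (Suc j)) (z j)"
        using tight[of j] h[of "Suc j"] h[of j] j by auto
    qed
    then show ?thesis using aa eq by simp
  qed
qed

section \<open>The two bump paths from the row of the extra cell upwards\<close>

definition bump_same :: "nat \<Rightarrow> bool" where
  "bump_same j \<longleftrightarrow> B' (Suc j) = B (Suc j) \<and> (z j < B (Suc j) \<or> B j < z j)"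

text \<open>The only way in which the paths part: the excess value \<open>z j\<close> lies between
  the entering value and the entry that R gives up, and R' gives up \<open>z j\<close> instead. The
  second clause of \<open>bump_same\<close> says that \<open>z j\<close> lies outside this
  interval.\<close>

definition bump_swap :: "nat \<Rightarrow> bool" where
  "bump_swap j \<longleftrightarrow> B' (Suc j) = z j \<and> B (Suc j) < z j \<and> z j < B j \<and> B' j = B j"

text \<open>Here and in the next lemma the balance condition on $z_j$ excludes, by column strictness, the
  configurations in which the two insertions would diverge.\<close>

lemma no_entry_below_swap:
  assumes "p \<le> j" "j < a" "B (Suc j) < z j" "z j < B j" "d \<in> R (Suc j)" "d < z j"
  shows "d < B (Suc j)"
proof (rule ccontr)
  assume "\<not> d < B (Suc j)"
  moreover have "d \<noteq> B (Suc j)" using bump_fresh[of "Suc j"] assms by auto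
  ultimately have d: "B (Suc j) < d" by simp
  have "card_above (R j) d = card_above (R j) (z j)"
  proof (rule card_above_eqI)
    fix r assume "r \<in> R j" "d < r"
    then show "z j < r" using bump_max[OF assms(2), of r] assms(4) d by (cases "r < B j") auto
  qed (use assms in simp)
  moreover have "card_from (R (Suc j)) (z j) < card_from (R (Suc j)) d" using card_from_less[OF fin assms(5,6)] .
  ultimately show False using cs[of j d] tight[OF assms(1)] by simp
qed

lemma entry_below_bump:
  assumes "p \<le> j" "j < a" "z j < B (Suc j)" "z (Suc j) \<noteq> B (Suc j)"
  shows "(\<exists>r\<in>R (Suc j). z j < r \<and> r < B (Suc j)) \<or> z j < z (Suc j) \<and> z (Suc j) < B (Suc j) \<and> z j \<in> R (Suc j)"
proof (rule ccontr)
  assume n: "\<not> ?thesis"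
  let ?x = "B (Suc j)"
  have no: "r \<in> R (Suc j) \<Longrightarrow> z j < r \<Longrightarrow> ?x \<le> r" for r using n by force
  have g: "card_above (R j) ?x < card_above (R j) (z j)" using card_above_less[OF fin, of ?x j "z j"] bump_mem[OF assms(2)] assms by auto
  from z_cases[OF assms(1)] show False
  proof
    assume s: "z (Suc j) = z j \<and> z j \<notin> R (Suc j)"
    have "card_from (R (Suc j)) (z j) = card_from (R (Suc j)) ?x"
      by (rule card_from_eqI) (use assms no s in \<open>auto simp: le_less\<close>)
    then show False using cs[of j ?x] g tight[OF assms(1)] by simp
  next
    assume s: "z j \<in> R (Suc j) \<and> z j < z (Suc j)"
    then have zx: "?x < z (Suc j)" using n assms by auto
    have "card_from (R (Suc j) - {z j}) (z j) = card_from (R (Suc j) - {z j}) ?x"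
    proof (rule card_from_eqI)
      fix r assume "r \<in> R (Suc j) - {z j}" "z j \<le> r"
      then show "?x \<le> r" using no[of r] by simp
    qed (use assms in simp)
    then have e: "card_from (R (Suc j)) (z j) = card_from (R (Suc j) - {z j}) ?x + 1"
      using card_from_remove[OF fin, of "z j" "Suc j" "z j"] s by simp
    have "R' (Suc j) = insert (z (Suc j)) (R (Suc j) - {z j})"
      using s by (simp add: row_Suc[OF assms(1)] insert_Diff_if)
    then have e2: "card_from (R' (Suc j)) ?x = card_from (R (Suc j) - {z j}) ?x + 1"
      using card_from_insert[of "R (Suc j) - {z j}" "z (Suc j)" ?x] fin z_notin[of "Suc j"] assms(1) zx by simp
    have "card_above (R' j) ?x \<le> card_above (R j) ?x"
    proof -
      have "R' j \<subseteq> insert (z j) (R j)" using row_subset[OF assms(1)] .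
      then show ?thesis unfolding card_above_def using fin assms(3) by (intro card_mono) auto
    qed
    then show False using cs'[of j ?x] e e2 g tight[OF assms(1)] by simp
  qed
qed

text \<open>Equality would put this value into rows j and j + 1 of R' at once.\<close>

lemma z_neq_bump:
  assumes "p \<le> j" "j < a" "j < a'" "B' (Suc j) = B (Suc j)" "z j < B (Suc j)"
  shows "z (Suc j) \<noteq> B (Suc j)"
proof
  assume e: "z (Suc j) = B (Suc j)"
  then have "z (Suc j) \<in> R' (Suc j)" using assms(5) by (simp add: row_Suc[OF assms(1)])
  moreover have "z (Suc j) \<in> R' j" using bump_mem'[OF assms(3)] assms(4) e by simp
  ultimately show False using dj' by force
qed

lemma bump_first: "p < a \<Longrightarrow> p < a' \<and> (bump_same p \<or> bump_swap p)"
proof -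
  assume pa: "p < a"
  have *: "p \<le> a'" "B' p = B p" using bump_below[of p] pa by auto
  note b = bump_mem[OF pa]
  have ne: "B p \<noteq> z p" using bump_fresh'[of p] * row_p by auto
  have ne2: "B (Suc p) \<noteq> z p" using z_notin[of p] b by auto
  show ?thesis
  proof (cases "B (Suc p) < z p \<and> z p < B p")
    case True
    have "r \<le> z p" if "r \<in> R' p" "r < B' p" for r
      using that bump_max[OF pa, of r] True unfolding row_p * by auto
    then have "p < a' \<and> B' (Suc p) = z p" using bump_eqI[OF *(1), of "z p"] True * row_p by auto
    then show ?thesis using True * by (simp add: bump_swap_def)
  next
    case False
    have "r \<le> B (Suc p)" if "r \<in> R' p" "r < B' p" for r
      using that bump_max[OF pa, of r] False unfolding row_p * by auto
    then have "p < a' \<and> B' (Suc p) = B (Suc p)" using bump_eqI[OF *(1), of "B (Suc p)"] b * row_p by auto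
    then show ?thesis using False ne ne2 by (auto simp: bump_same_def)
  qed
qed

text \<open>Both paths bring x = \<open>B (Suc j)\<close> into row j + 1. If x < \<open>z j\<close>,
  then neither \<open>z j\<close> nor the larger or equal \<open>z (Suc j)\<close> is a candidate
  for bumping, and the rows behave alike. Otherwise \<open>entry_below_bump\<close> ensures that R',
  which lacks \<open>z j\<close>, still has something to bump. The clauses comparing with
  \<open>z j\<close> are needed later for the count at \<open>z j\<close> in row j + 1.\<close>

lemma bump_after_same:
  assumes "p \<le> j" "Suc j < a" "j < a'" "bump_same j"
  shows "Suc j < a' \<and> (bump_same (Suc j) \<and> (B (Suc (Suc j)) < z j \<longrightarrow> B (Suc j) < z j) \<and> B (Suc (Suc j)) \<noteq> z j
      \<or> bump_swap (Suc j) \<and> z j < z (Suc j) \<and> z j \<le> B (Suc (Suc j)))"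
proof -
  let ?x = "B (Suc j)" let ?c = "B (Suc (Suc j))"
  have e: "B' (Suc j) = ?x" using assms(4) by (simp add: bump_same_def)
  have c: "?c \<in> R (Suc j)" "?c < ?x" using bump_mem[OF assms(2)] by auto
  have m: "r \<in> R (Suc j) \<Longrightarrow> r < ?x \<Longrightarrow> r \<le> ?c" for r using bump_max[OF assms(2)] .
  note R' = row_Suc[OF assms(1)]
  have S: "Suc j \<le> a'" using assms by simp
  have xz: "?x \<noteq> z j" using assms(4) bump_mem[of j] assms(2) by (auto simp: bump_same_def)
  have zic: "z (Suc j) \<noteq> ?c" using z_notin[of "Suc j"] c assms(1) by auto
  show ?thesis
  proof (cases "?x < z j")
    case True
    have "r \<le> ?c" if "r \<in> R' (Suc j)" "r < ?x" for r
      using that m[of r] z_mono[OF assms(1)] True unfolding R' by auto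
    then have "Suc j < a' \<and> B' (Suc (Suc j)) = ?c"
      using bump_eqI[OF S, of ?c] c e True unfolding R' by auto
    then show ?thesis using True z_mono[OF assms(1)] c by (auto simp: bump_same_def)
  next
    case False
    then have lt: "z j < ?x" using xz by simp
    have zix: "z (Suc j) \<noteq> ?x" using z_neq_bump[OF assms(1) _ assms(3) e lt] assms(2) by simp
    consider r where "r \<in> R (Suc j)" "z j < r" "r < ?x"
      | "\<forall>r\<in>R (Suc j). \<not> (z j < r \<and> r < ?x)" "z j < z (Suc j)" "z (Suc j) < ?x" "z j \<in> R (Suc j)"
      using entry_below_bump[OF assms(1) _ lt zix] assms(2) by auto
    then show ?thesis
    proof cases
      case 1
      then have cz: "z j < ?c" using m[of r] by simp
      show ?thesis
      proof (cases "?c < z (Suc j) \<and> z (Suc j) < ?x")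
        case True
        have "r \<le> z (Suc j)" if "r \<in> R' (Suc j)" "r < ?x" for r
          using that m[of r] True unfolding R' by auto
        then have "Suc j < a' \<and> B' (Suc (Suc j)) = z (Suc j)"
          using bump_eqI[OF S, of "z (Suc j)"] e cz True unfolding R' by auto
        then show ?thesis using True cz e by (auto simp: bump_swap_def)
      next
        case False
        have "r \<le> ?c" if "r \<in> R' (Suc j)" "r < ?x" for r
          using that m[of r] False unfolding R' by auto
        then have "Suc j < a' \<and> B' (Suc (Suc j)) = ?c"
          using bump_eqI[OF S, of ?c] c e cz unfolding R' by auto
        then show ?thesis using False cz zix zic by (auto simp: bump_same_def)
      qed
    next
      case 2
      \<comment> \<open>R bumps \<open>z j\<close> itself; R' has lost it to row j and bumps
        \<open>z (Suc j)\<close> in its place.\<close>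
      have ceq: "?c = z j" using m[of "z j"] 2 c lt by (meson le_antisym not_le)
      have "r \<le> z (Suc j)" if "r \<in> R' (Suc j)" "r < ?x" for r
        using that m[of r] 2 ceq unfolding R' by auto
      then have "Suc j < a' \<and> B' (Suc (Suc j)) = z (Suc j)"
        using bump_eqI[OF S, of "z (Suc j)"] e 2 unfolding R' by auto
      then show ?thesis using 2 ceq e by (auto simp: bump_swap_def)
    qed
  qed
qed

text \<open>If \<open>z j\<close> were below the last value of the path,
  \<open>entry_below_bump\<close> would yield an entry of R in row a below that value, and the path
  could not end there.\<close>

lemma stop_after_same:
  assumes "p \<le> j" "Suc j = a" "j < a'" "bump_same j"
  shows "a' = a \<and> B a < z j"
proof -
  let ?x = "B (Suc j)"
  have e: "B' (Suc j) = ?x" using assms(4) by (simp add: bump_same_def)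
  have m: "r \<in> R (Suc j) \<Longrightarrow> ?x < r" for r using stop_max assms(2) by auto
  have xz: "?x \<noteq> z j" using assms(4) bump_mem[of j] assms(2) by (auto simp: bump_same_def)
  have lt: "?x < z j"
  proof (rule ccontr)
    assume "\<not> ?x < z j"
    then have lt: "z j < ?x" using xz by simp
    have zix: "z (Suc j) \<noteq> ?x" using z_neq_bump[OF assms(1) _ assms(3) e lt] assms(2) by simp
    show False using entry_below_bump[OF assms(1) _ lt zix] assms(2) m lt by force
  qed
  have "a' = Suc j"
  proof (rule stopI)
    show "Suc j \<le> a'" using assms by simp
    fix r assume "r \<in> R' (Suc j)"
    then show "B' (Suc j) < r" using m[of r] lt z_mono[OF assms(1)] e unfolding row_Suc[OF assms(1)] by auto
  qed
  then show ?thesis using lt assms(2) by simp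
qed

lemma no_entry_below_swap':
  assumes "p \<le> j" "j < a" "bump_swap j" "r \<in> R (Suc j)" "r < z j"
  shows "r < B (Suc j)"
  using no_entry_below_swap[OF assms(1,2)] assms(3-5) by (auto simp: bump_swap_def)

text \<open>The values entering row j + 1 are now \<open>B (Suc j)\<close> and the larger
  \<open>z j\<close>, but this row has no entry between them, so both paths bump the same entry
  again.\<close>

lemma bump_after_swap:
  assumes "p \<le> j" "Suc j < a" "j < a'" "bump_swap j"
  shows "Suc j < a' \<and> bump_same (Suc j) \<and> B (Suc j) < z (Suc j)"
proof -
  let ?x = "B (Suc j)" let ?c = "B (Suc (Suc j))"
  have e: "B' (Suc j) = z j" "?x < z j" using assms(4) by (simp_all add: bump_swap_def)
  have c: "?c \<in> R (Suc j)" "?c < ?x" using bump_mem[OF assms(2)] by auto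
  have m: "r \<in> R (Suc j) \<Longrightarrow> r < ?x \<Longrightarrow> r \<le> ?c" for r using bump_max[OF assms(2)] .
  note R' = row_Suc[OF assms(1)]
  have "r \<le> ?c" if "r \<in> R' (Suc j)" "r < z j" for r
    using that m[of r] no_entry_below_swap'[OF assms(1) _ assms(4), of r] assms(2) z_mono[OF assms(1)] unfolding R' by auto
  then have "Suc j < a' \<and> B' (Suc (Suc j)) = ?c"
    using bump_eqI[of "Suc j" ?c] c e assms unfolding R' by auto
  then show ?thesis using e z_mono[OF assms(1)] by (auto simp: bump_same_def)
qed

lemma stop_after_swap:
  assumes "p \<le> j" "Suc j = a" "j < a'" "bump_swap j"
  shows "a' = a"
proof -
  have e: "B' (Suc j) = z j" "B (Suc j) < z j" using assms(4) by (simp_all add: bump_swap_def)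
  have "a' = Suc j"
  proof (rule stopI)
    show "Suc j \<le> a'" using assms by simp
    fix r assume "r \<in> R' (Suc j)"
    then have r: "r = z (Suc j) \<or> r \<in> R (Suc j)" "r \<noteq> z j" unfolding row_Suc[OF assms(1)] by auto
    have "\<not> r < z j"
    proof
      assume l: "r < z j"
      then have "r \<in> R (Suc j)" using r z_mono[OF assms(1)] by auto
      then show False using no_entry_below_swap'[OF assms(1) _ assms(4) _ l] stop_max[of r] assms(2) by auto
    qed
    then show "B' (Suc j) < r" using r e by simp
  qed
  then show ?thesis using assms(2) by simp
qed

lemma bump_cases: "p \<le> j \<Longrightarrow> j < a \<Longrightarrow> j < a' \<and> (bump_same j \<or> bump_swap j)"
proof (induction j rule: dec_induct)
  case base
  then show ?case using bump_first by simp
next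
  case (step n)
  then show ?case using bump_after_same[of n] bump_after_swap[of n] by auto
qed

text \<open>At a swap R2' keeps \<open>B (Suc j)\<close> in row j, where R2 has lost it; so the
  excess value of that row becomes \<open>B (Suc j)\<close> in place of \<open>z j\<close>. In all
  other rows, in particular from row a on, the excess values stay as they were, and the value
  inserted from the top is not forgotten.\<close>

lemma high_case:
  assumes pa: "p < a"
  shows "\<exists>z'. a' = a \<and> left_inserted R2 R2' p z' \<and> (\<forall>j\<ge>a. z' j = z j)"
proof -
  have ch: "p \<le> j \<Longrightarrow> j < a \<Longrightarrow> j < a' \<and> (bump_same j \<or> bump_swap j)" for j by (rule bump_cases)
  obtain k where k: "a = Suc k" "p \<le> k" using pa by (cases a) auto
  have aa: "a' = a" using ch[of k] k stop_after_same[of k] stop_after_swap[of k] by auto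
  have za: "B a < z a"
    using ch[of k] k stop_after_same[of k] z_mono[of k] by (auto simp: bump_swap_def)
  define z' where "z' j = (if j < a \<and> bump_swap j then B (Suc j) else z j)" for j
  have Beq: "j \<le> p \<Longrightarrow> B' j = B j" for j using bump_below[of j] pa by auto
  have r2: "j < a \<Longrightarrow> R2 j = insert (B j) (R j - {B (Suc j)})"
    "j < a \<Longrightarrow> R2' j = insert (B' j) (R' j - {B' (Suc j)})" for j by (simp_all add: R2 R2' aa)
  have r2a: "R2 a = insert (B a) (R a)" "R2' a = insert (B' a) (R' a)" by (simp_all add: R2 R2' aa)
  have r2h: "a < j \<Longrightarrow> R2 j = R j" "a < j \<Longrightarrow> R2' j = R' j" for j by (simp_all add: R2 R2' aa)
  have nssw: "bump_same j \<Longrightarrow> bump_swap j \<Longrightarrow> False" for j by (auto simp: bump_same_def bump_swap_def)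
  have B1: "B (Suc j) \<in> R j" "B (Suc j) < B j" if "j < a" for j using bump_mem[OF that] by auto
  have notin: "z' j \<notin> R2 j" if j: "p \<le> j" for j
  proof -
    consider "j < a" "bump_same j" | "j < a" "bump_swap j" | "j = a" | "a < j" using ch[OF j] by linarith
    then show ?thesis
    proof cases
      case 1
      then show ?thesis using nssw z_notin[OF j] B1[of j] by (auto simp: r2 z'_def bump_same_def)
    next
      case 2
      then show ?thesis using B1[of j] by (auto simp: r2 z'_def)
    next
      case 3
      then show ?thesis using z_notin[OF j] za by (auto simp: r2a z'_def)
    next
      case 4
      then show ?thesis using z_notin[OF j] by (simp add: r2h z'_def)
    qed
  qed
  have row: "R2' (Suc j) = insert (z' (Suc j)) (R2 (Suc j)) - {z' j} \<and>
       (z' j \<in> R2 (Suc j) \<and> z' j < z' (Suc j) \<or> z' (Suc j) = z' j \<and> z' j \<notin> R2 (Suc j))"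
    if j: "p \<le> j" for j
  proof -
    note R' = row_Suc[OF j] and z_cases = z_cases[OF j]
    have zi: "z (Suc j) \<notin> R (Suc j)" using z_notin[of "Suc j"] j by simp
    consider "Suc j < a" "bump_same j" | "Suc j < a" "bump_swap j" | "Suc j = a" "bump_same j" | "Suc j = a" "bump_swap j"
      | "j = a" | "a < j" using ch[OF j] by linarith
    then show ?thesis
    proof cases
      case 1
      then have t: "B' (Suc j) = B (Suc j)" "z' j = z j" "B (Suc j) \<noteq> z j" "j < a'"
        using nssw B1[of j] ch[OF j] by (auto simp: z'_def bump_same_def)
      note b = B1[OF 1(1)]
      from bump_after_same[OF j 1(1) t(4) 1(2)] show ?thesis
      proof (elim conjE disjE)
        assume n: "bump_same (Suc j)" "B (Suc (Suc j)) \<noteq> z j"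
        then have z2: "z' (Suc j) = z (Suc j)" "B' (Suc (Suc j)) = B (Suc (Suc j))"
          "z (Suc j) \<noteq> B (Suc j)" "z (Suc j) \<noteq> B (Suc (Suc j))"
          using nssw b by (auto simp: z'_def bump_same_def)
        show ?thesis unfolding r2[OF 1(1)] R' z2 t using t(3) z2(3,4) n(2) z_cases by auto
      next
        assume n: "bump_swap (Suc j)" "z j < z (Suc j)" "z j \<le> B (Suc (Suc j))"
        then have z2: "z' (Suc j) = B (Suc (Suc j))" "B' (Suc (Suc j)) = z (Suc j)"
          "B (Suc (Suc j)) < z (Suc j)"
          using 1 by (auto simp: z'_def bump_swap_def)
        have zA: "z j \<in> R (Suc j)" using z_cases n(2) by auto
        have e1: "insert (z (Suc j)) (R (Suc j)) - {z j} - {z (Suc j)} = R (Suc j) - {z j}" using zi by auto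
        have e2: "insert (B (Suc (Suc j))) (insert (B (Suc j)) (R (Suc j) - {B (Suc (Suc j))}))
            = insert (B (Suc j)) (R (Suc j))" using b by auto
        show ?thesis unfolding r2[OF 1(1)] R' z2 t e1 e2
        proof
          show "insert (B (Suc j)) (R (Suc j) - {z j}) = insert (B (Suc j)) (R (Suc j)) - {z j}"
            using t(3) by auto
          show "z j \<in> insert (B (Suc j)) (R (Suc j) - {B (Suc (Suc j))}) \<and> z j < B (Suc (Suc j)) \<or>
              B (Suc (Suc j)) = z j \<and> z j \<notin> insert (B (Suc j)) (R (Suc j) - {B (Suc (Suc j))})"
            using t(3) zA n(3) by (cases "B (Suc (Suc j)) = z j") simp_all
        qed
      qed
    next
      case 2
      then have t: "B' (Suc j) = z j" "z' j = B (Suc j)" "B (Suc j) < z j" "j < a'"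
        using ch[OF j] by (auto simp: z'_def bump_swap_def)
      note b = B1[OF 2(1)]
      have fb: "B (Suc j) \<notin> R (Suc j)" using bump_fresh[of "Suc j"] 2 by simp
      have n: "bump_same (Suc j)" using bump_after_swap[OF j 2(1) t(4) 2(2)] by simp
      then have z2: "z' (Suc j) = z (Suc j)" "B' (Suc (Suc j)) = B (Suc (Suc j))"
        "z (Suc j) \<noteq> B (Suc (Suc j))"
        using nssw b by (auto simp: z'_def bump_same_def)
      show ?thesis unfolding r2[OF 2(1)] R' z2 t using t(3) z2(3) z_cases zi b fb by auto
    next
      case 3
      have "j < a'" using ch[OF j] 3 by simp
      then have "B (Suc j) < z j" using stop_after_same[OF j 3(1) _ 3(2)] 3(1) by simp
      then have t: "B' (Suc j) = B (Suc j)" "z' j = z j" "B (Suc j) < z j"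
        using nssw[OF 3(2)] 3(2) by (auto simp: z'_def bump_same_def)
      have z2: "z' (Suc j) = z (Suc j)" using 3 by (simp add: z'_def)
      show ?thesis unfolding r2a[folded 3(1)] R' z2 t using t(3) z_cases by auto
    next
      case 4
      then have t: "B' (Suc j) = z j" "z' j = B (Suc j)" "B (Suc j) < z j"
        using ch[OF j] by (auto simp: z'_def bump_swap_def)
      have fb: "B (Suc j) \<notin> R (Suc j)" using bump_fresh[of "Suc j"] 4 by simp
      have z2: "z' (Suc j) = z (Suc j)" using 4 by (simp add: z'_def)
      show ?thesis unfolding r2a[folded 4(1)] R' z2 t using t(3) z_cases zi fb by auto
    next
      case 5
      then show ?thesis using z_cases R' by (simp add: r2h z'_def)
    next
      case 6
      then show ?thesis using z_cases R' by (simp add: r2h z'_def)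
    qed
  qed
  \<comment> \<open>In a \<open>bump_same\<close> row neither side of the balance changes. At a swap
    both sides grow by one, through the arrival of \<open>B j\<close> in row j and of
    \<open>B (Suc j)\<close> in row j + 1; no old entry is passed when the threshold drops from
    \<open>z j\<close> to \<open>B (Suc j)\<close>.\<close>
  have tg: "card_above (R2 j) (z' j) = card_from (R2 (Suc j)) (z' j)" if j: "p \<le> j" for j
  proof -
    note tight = tight[OF j]
    consider "j < a" "bump_same j" | "j < a" "bump_swap j" | "j = a" | "a < j" using ch[OF j] by linarith
    then show ?thesis
    proof cases
      case 1
      then have t: "z' j = z j" "j < a'" using nssw ch[OF j] by (auto simp: z'_def)
      have g: "card_above (R2 j) (z j) = card_above (R j) (z j)"
        using card_above_swap[OF fin B1(1)[OF 1(1)] bump_fresh, of "z j"] B1[OF 1(1)] 1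
        by (auto simp: r2 bump_same_def split: if_splits)
      have fb: "B (Suc j) \<notin> R (Suc j)" using bump_fresh[of "Suc j"] 1 by simp
      have "card_from (R2 (Suc j)) (z j) = card_from (R (Suc j)) (z j)"
      proof (cases "Suc j < a")
        case True
        have "B (Suc (Suc j)) < z j \<longleftrightarrow> B (Suc j) < z j"
          using bump_after_same[OF j True t(2) 1(2)] B1[OF True] by auto
        then have "z j \<le> B (Suc (Suc j)) \<longleftrightarrow> z j \<le> B (Suc j)" by linarith
        then show ?thesis using card_from_swap[OF fin B1(1)[OF True] fb, of "z j"] by (simp add: r2 True)
      next
        case False
        then have a: "Suc j = a" using 1 by simp
        then show ?thesis using stop_after_same[OF j a t(2) 1(2)] card_from_insert[OF fin fb, of "z j"] r2a by simp
      qed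
      then show ?thesis using g tight t by simp
    next
      case 2
      then have t: "z' j = B (Suc j)" "j < a'" "B (Suc j) < z j" "z j < B j"
        using ch[OF j] by (auto simp: z'_def bump_swap_def)
      have fb: "B (Suc j) \<notin> R (Suc j)" using bump_fresh[of "Suc j"] 2 by simp
      have "card_above (R j) (B (Suc j)) = card_above (R j) (z j)"
      proof (rule card_above_eqI)
        fix r assume r: "r \<in> R j" "B (Suc j) < r"
        then have "\<not> r < B j" using bump_max[OF 2(1), of r] by auto
        then show "z j < r" using t by simp
      qed (use t in simp)
      then have g: "card_above (R2 j) (B (Suc j)) = card_above (R j) (z j) + 1"
        using card_above_swap[OF fin B1(1)[OF 2(1)] bump_fresh, of "B (Suc j)"] B1[OF 2(1)] 2 by (simp add: r2)
      have e: "card_from (R (Suc j)) (B (Suc j)) = card_from (R (Suc j)) (z j)"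
      proof (rule card_from_eqI)
        fix r assume r: "r \<in> R (Suc j)" "B (Suc j) \<le> r"
        then show "z j \<le> r" using no_entry_below_swap'[OF j 2, of r] by force
      qed (use t in simp)
      have "card_from (R2 (Suc j)) (B (Suc j)) = card_from (R (Suc j)) (B (Suc j)) + 1"
      proof (cases "Suc j < a")
        case True
        then show ?thesis using card_from_swap[OF fin B1(1)[OF True] fb, of "B (Suc j)"] B1[OF True]
          by (simp add: r2 True)
      next
        case False
        then have a: "Suc j = a" using 2 by simp
        then show ?thesis using card_from_insert[OF fin fb, of "B (Suc j)"] r2a by simp
      qed
      then show ?thesis using g e tight t by simp
    next
      case 3
      then show ?thesis
        using za tight card_above_insert[OF fin bump_fresh[of a], of "z a"] by (simp add: r2a r2h z'_def)
    next
      case 4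
      then show ?thesis using tight by (simp add: r2h z'_def)
    qed
  qed
  have "left_inserted R2 R2' p z'" unfolding left_inserted_def
  proof (intro conjI allI impI)
    fix j assume "j < p" then show "R2' j = R2 j"
      using Beq[of j] Beq[of "Suc j"] row_below[of j] pa by (simp add: r2)
  next
    have pp: "p < a'" using ch[of p] pa by simp
    note b = B1[OF pa]
    from ch[of p] pa have "bump_same p \<or> bump_swap p" by simp
    then show "R2' p = insert (z' p) (R2 p)"
    proof
      assume n: "bump_same p"
      then have "z' p = z p" "B' (Suc p) = B (Suc p)" "z p \<noteq> B (Suc p)"
        using nssw b by (auto simp: z'_def bump_same_def)
      then show ?thesis using Beq[of p] by (auto simp: r2[OF pa] row_p)
    next
      assume n: "bump_swap p"
      then have "z' p = B (Suc p)" "B' (Suc p) = z p" using pa by (auto simp: z'_def bump_swap_def)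
      then show ?thesis using Beq[of p] b z_notin[of p] by (auto simp: r2[OF pa] row_p)
    qed
  qed (use notin row tg in auto)
  then show ?thesis using aa by (auto simp: z'_def)
qed

text \<open>If both paths end in row p, the new boxes lie in adjacent columns and the extra cell
  moves one column to the right. In the last alternative it rises by one row, and the equality of
  row sizes says that it stays in its column.\<close>

lemma insert_both_step:
  "\<exists>p' z'. left_inserted R2 R2' p' z' \<and> (\<forall>j\<ge>a. z' j = z j) \<and>
    (a' = a \<and> p' = p \<or> a = p \<and> a' = Suc p \<and> p' = Suc p \<and> card (R p) = card (R (Suc p)))"
proof -
  consider "a < p" | "a = p" | "p < a" by linarith
  then show ?thesis
  proof cases
    case 1
    then show ?thesis using low_case by blast
  next
    case 2
    then show ?thesis using top_case by blast
  next
    case 3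
    then show ?thesis using high_case by blast
  qed
qed

end

section \<open>Recording tableaux and their columns\<close>

definition row_sets :: "tab \<Rightarrow> nat \<Rightarrow> nat set" where
  "row_sets P j = (if j < length P then set (P ! j) else {})"

definition row_len :: "tab \<Rightarrow> nat \<Rightarrow> nat" where
  "row_len Q j = (if j < length Q then length (Q ! j) else 0)"

lemma row_sets_Cons: "row_sets (r # P) j = (case j of 0 \<Rightarrow> set r | Suc k \<Rightarrow> row_sets P k)"
  by (auto simp: row_sets_def split: nat.split)

lemma row_sets_Nil [simp]: "row_sets [] j = {}"
  by (simp add: row_sets_def)

lemma set_list_update_distinct:
  "distinct xs \<Longrightarrow> k < length xs \<Longrightarrow> set (xs[k := y]) = insert y (set xs - {xs ! k})"
  by (induction xs arbitrary: k) (auto split: nat.splits)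

lemma row_len_card:
  assumes "\<forall>row\<in>set P. sorted_wrt (>) row"
  shows "row_len P j = card (row_sets P j)"
proof -
  have "distinct xs" if "sorted_wrt (>) xs" for xs :: "nat list"
    using that by (induction xs) auto
  then show ?thesis using assms by (auto simp: row_len_def row_sets_def distinct_card)
qed

lemma sorted_wrt_update:
  assumes "sorted_wrt (>) (row :: nat list)" "k < length row" "row ! k < y" "\<forall>l<k. y < row ! l"
  shows "sorted_wrt (>) (row[k := y])"
  using assms unfolding sorted_wrt_iff_nth_less
  by (auto simp: nth_list_update) (metis less_trans)

text \<open>Rows decrease strictly, so the leftmost entry below y, where \<open>takeWhile\<close>
  stops, is the greatest such entry. The path of the whole tableau is y followed by the path of the
  bumped entry, shifted up by one row.\<close>

lemma rs_ins_bump_path: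
  assumes "rs_ins P y = (P2, a)" "\<forall>row\<in>set P. sorted_wrt (>) row \<and> row \<noteq> []"
    "\<forall>j. y \<notin> row_sets P j" "\<forall>k l. k \<noteq> l \<longrightarrow> row_sets P k \<inter> row_sets P l = {}"
  shows "\<exists>B. B 0 = y \<and> bump_path (row_sets P) B a (row_sets P2)"
    and "\<forall>row\<in>set P2. sorted_wrt (>) row \<and> row \<noteq> []"
    and "a \<le> length P" 
proof (atomize (full), use assms in \<open>induction P y arbitrary: P2 a rule: rs_ins.induct\<close>)
  case (1 y)
  then have "P2 = [[y]]" "a = 0" by auto
  moreover have "bump_path (row_sets []) (\<lambda>_. y) 0 (row_sets [[y]])"
    by (auto simp: bump_path_def row_sets_Cons split: nat.split)
  ultimately show ?case by (intro conjI exI[of _ "\<lambda>_. y"]) (simp_all del: row_sets_Nil)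
next
  case (2 row rows y)
  define idx where "idx = length (takeWhile (\<lambda>x. \<not> x < y) row)"
  have so: "sorted_wrt (>) row" using 2(3) by simp
  have yn: "y \<notin> set row" "\<forall>j. y \<notin> row_sets rows j"
    using 2(4)[rule_format, of 0] 2(4)[rule_format, of "Suc j" for j] by (simp_all add: row_sets_Cons)
  have dj: "set row \<inter> row_sets rows l = {}" for l
    using 2(5)[rule_format, of 0 "Suc l"] by (simp add: row_sets_Cons)
  have dj2: "\<forall>k l. k \<noteq> l \<longrightarrow> row_sets rows k \<inter> row_sets rows l = {}"
    using 2(5)[rule_format, of "Suc k" "Suc l" for k l] by (simp add: row_sets_Cons)
  have lt: "l < idx \<Longrightarrow> y < row ! l" for l
  proof -
    assume l: "l < idx"
    then have "l < length row" using length_takeWhile_le[of "\<lambda>x. \<not> x < y" row] by (simp add: idx_def)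
    moreover have "\<not> row ! l < y"
      using l set_takeWhileD[of "row ! l" "\<lambda>x. \<not> x < y" row] takeWhile_nth[of l "\<lambda>x. \<not> x < y" row]
        nth_mem[of l "takeWhile (\<lambda>x. \<not> x < y) row"] by (simp add: idx_def)
    ultimately show "y < row ! l" using yn(1) nth_mem[of l row] by (cases "row ! l = y") auto
  qed
  show ?case
  proof (cases "idx < length row")
    case True
    obtain rows' a' where r: "rs_ins rows (row ! idx) = (rows', a')" by fastforce
    have P2: "P2 = row[idx := y] # rows'" "a = Suc a'"
      using 2(2) True r by (auto simp: idx_def Let_def)
    have b: "row ! idx < y" using True nth_length_takeWhile[of "\<lambda>x. \<not> x < y" row] by (simp add: idx_def)
    have bn: "\<forall>j. row ! idx \<notin> row_sets rows j" using dj True nth_mem by blast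
    have "(\<exists>B. B 0 = row ! idx \<and> bump_path (row_sets rows) B a' (row_sets rows')) \<and>
       (\<forall>row\<in>set rows'. sorted_wrt (>) row \<and> row \<noteq> []) \<and> a' \<le> length rows"
      by (rule 2(1)[OF idx_def True r _ bn dj2]) (use 2(3) in auto)
    then obtain B where B: "B 0 = row ! idx" "bump_path (row_sets rows) B a' (row_sets rows')"
      and rest: "\<forall>row\<in>set rows'. sorted_wrt (>) row \<and> row \<noteq> []" "a' \<le> length rows" by blast
    have bump_max: "r \<le> row ! idx" if r: "r \<in> set row" "r < y" for r
    proof -
      obtain l where l: "l < length row" "r = row ! l" using r(1) by (auto simp: in_set_conv_nth)
      then have "idx \<le> l" using lt[of l] r(2) by force
      then show ?thesis using so l True by (cases "idx = l") (auto simp: sorted_wrt_iff_nth_less le_less)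
    qed
    define B' where "B' = case_nat y B"
    have di: "distinct row" using so by (induction row) auto
    have "bump_path (row_sets (row # rows)) B' (Suc a') (row_sets P2)"
      using B bump_max b True set_list_update_distinct[OF di True, of y]
      by (auto simp: bump_path_def P2 row_sets_Cons B'_def split: nat.splits)
    moreover have "sorted_wrt (>) (row[idx := y])" using sorted_wrt_update[OF so True b] lt by simp
    ultimately show ?thesis using rest P2 True by (auto simp: B'_def intro!: exI[of _ B'])
  next
    case False
    have P2: "P2 = (row @ [y]) # rows" "a = 0" using 2(2) False by (auto simp: idx_def Let_def)
    have all: "\<forall>r\<in>set row. y < r" using lt False by (auto simp: in_set_conv_nth)
    have "bump_path (row_sets (row # rows)) (\<lambda>_. y) 0 (row_sets P2)"
      using all by (auto simp: bump_path_def P2 row_sets_Cons split: nat.splits)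
    then show ?thesis using P2 2(3) all by (auto simp: sorted_wrt_append intro!: exI[of _ "\<lambda>_. y"])
  qed
qed

lemma row_len_add_at:
  "a \<le> length Q \<Longrightarrow> row_len (add_at Q a m) j = row_len Q j + (if j = a then 1 else 0)"
  by (auto simp: row_len_def add_at_def nth_append nth_list_update less_Suc_eq)

section \<open>Straight shapes and their columns\<close>

definition partition_shape :: "tab \<Rightarrow> bool" where
  "partition_shape Q \<longleftrightarrow> (\<forall>row\<in>set Q. row \<noteq> []) \<and> (\<forall>j. row_len Q (Suc j) \<le> row_len Q j)"

lemma row_len_antimono:
  "partition_shape Q \<Longrightarrow> j \<le> k \<Longrightarrow> row_len Q k \<le> row_len Q j"
  unfolding partition_shape_def by (rule lift_Suc_antimono_le) auto

lemma col_eq: "col Q c = map (\<lambda>r. Q ! r ! (c - 1)) (filter (\<lambda>r. c \<le> length (Q ! r)) [0..<length Q])"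
proof -
  have "concat (map (\<lambda>r. if p r then [f r] else []) xs) = map f (filter p xs)" for p xs and f :: "nat \<Rightarrow> nat"
    by (induction xs) auto
  then show ?thesis unfolding col_def by simp
qed

lemma col_prefix:
  assumes "partition_shape Q" "1 \<le> c" "\<forall>j<h. c \<le> row_len Q j" "row_len Q h < c"
  shows "col Q c = map (\<lambda>j. Q ! j ! (c - 1)) [0..<h]"
proof -
  have hl: "h \<le> length Q"
    using assms(2,3) by (cases "h \<le> length Q") (auto simp: row_len_def not_le dest!: spec[of _ "length Q"])
  have e: "[0..<length Q] = [0..<h] @ [h..<length Q]" using hl by (metis le0 upt_add_eq_append le_add_diff_inverse)
  have c: "col Q c = map (\<lambda>r. Q ! r ! (c - 1)) (filter (\<lambda>r. c \<le> length (Q ! r)) [0..<length Q])"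
    by (rule col_eq)
  have f1: "filter (\<lambda>r. c \<le> length (Q ! r)) [0..<h] = [0..<h]"
    using assms(3) hl by (intro filter_True) (auto simp: row_len_def)
  have f2: "filter (\<lambda>r. c \<le> length (Q ! r)) [h..<length Q] = []"
  proof (rule filter_False, rule ballI)
    fix r assume "r \<in> set [h..<length Q]"
    then show "\<not> c \<le> length (Q ! r)"
      using row_len_antimono[OF assms(1), of h r] assms(4) by (auto simp: row_len_def split: if_splits)
  qed
  show ?thesis unfolding c e filter_append f1 f2 by simp
qed

lemma col_height:
  assumes "partition_shape Q" "1 \<le> c"
  shows "\<exists>h. (\<forall>j. j < h \<longleftrightarrow> c \<le> row_len Q j) \<and> length (col Q c) = h"
proof -
  define h where "h = (LEAST j. row_len Q j < c)"
  have "row_len Q (length Q) < c" using assms(2) by (simp add: row_len_def)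
  then have h: "row_len Q h < c" "\<And>j. j < h \<Longrightarrow> c \<le> row_len Q j"
    unfolding h_def by (rule LeastI, meson not_less_Least not_le)
  have "j < h \<longleftrightarrow> c \<le> row_len Q j" for j
    using h row_len_antimono[OF assms(1), of h j] by (meson le_less_trans not_le)
  moreover from this have "length (col Q c) = h" using col_prefix[OF assms, of h] h by simp
  ultimately show ?thesis by blast
qed

text \<open>A recorded label lands on top of its column: both shapes are partitions, so before the
  step exactly the rows below row a reach that column.\<close>

lemma col_add_at:
  assumes "partition_shape Q" "partition_shape (add_at Q a m)" "a \<le> length Q" "1 \<le> c"
  shows "col (add_at Q a m) c = (if c = Suc (row_len Q a) then col Q c @ [m] else col Q c)"
    and "length (col Q (Suc (row_len Q a))) = a"
proof -
  have n: "add_at Q a m ! j ! k = Q ! j ! k" if "k < row_len Q j" for j k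
    using that by (auto simp: add_at_def row_len_def nth_append nth_list_update split: if_splits)
  have n2: "add_at Q a m ! a ! row_len Q a = m"
    using assms(3) by (auto simp: add_at_def row_len_def nth_append)
  note rl = row_len_add_at[OF assms(3)]
  have low: "Suc (row_len Q a) \<le> row_len Q j" if "j < a" for j
    using row_len_antimono[OF assms(2), of j a] that by (simp add: rl)
  show "length (col Q (Suc (row_len Q a))) = a"
    using col_prefix[OF assms(1), of "Suc (row_len Q a)" a] low by simp
  obtain h where h: "\<And>j. j < h \<longleftrightarrow> c \<le> row_len Q j" using col_height[OF assms(1,4)] by auto
  have c1: "col Q c = map (\<lambda>j. Q ! j ! (c - 1)) [0..<h]"
    using h[of h] h by (intro col_prefix[OF assms(1,4)]) auto
  show "col (add_at Q a m) c = (if c = Suc (row_len Q a) then col Q c @ [m] else col Q c)"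
  proof (cases "c = Suc (row_len Q a)")
    case True
    have ha: "h = a" using h[of a] h[of h] low[of h] True by (cases h a rule: linorder_cases) auto
    have "col (add_at Q a m) c = map (\<lambda>j. add_at Q a m ! j ! (c - 1)) [0..<Suc a]"
      using low True row_len_antimono[OF assms(1), of a "Suc a"]
      by (intro col_prefix[OF assms(2,4)]) (auto simp: rl less_Suc_eq)
    also have "\<dots> = map (\<lambda>j. add_at Q a m ! j ! (c - 1)) [0..<a] @ [m]" using n2 True by simp
    also have "map (\<lambda>j. add_at Q a m ! j ! (c - 1)) [0..<a] = map (\<lambda>j. Q ! j ! (c - 1)) [0..<a]"
      using low True by (intro map_cong) (auto intro!: n simp: less_le_trans[OF _ low] Suc_le_eq[symmetric])
    finally show ?thesis using c1 ha True by simp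
  next
    case False
    have h': "j < h \<longleftrightarrow> c \<le> row_len (add_at Q a m) j" for j
      using h[of j] False by (auto simp: rl)
    have "col (add_at Q a m) c = map (\<lambda>j. add_at Q a m ! j ! (c - 1)) [0..<h]"
      using h'[of h] h' by (intro col_prefix[OF assms(2,4)]) auto
    also have "\<dots> = map (\<lambda>j. Q ! j ! (c - 1)) [0..<h]"
      using h assms(4) by (intro map_cong) (auto intro!: n simp: Suc_le_eq[symmetric])
    finally show ?thesis using c1 False by simp
  qed
qed

section \<open>Column sets when one more label is recorded\<close>

definition balanced_min :: "nat set \<Rightarrow> nat set \<Rightarrow> nat \<Rightarrow> bool" where
  "balanced_min A D v \<longleftrightarrow> v \<in> A \<and> card_above A v = card_above D v \<and> (\<forall>u\<in>A. u < v \<longrightarrow> card_above A u \<noteq> card_above D u)"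

lemma balanced_min_unique: "balanced_min A D v \<Longrightarrow> balanced_min A D v' \<Longrightarrow> v = v'"
  unfolding balanced_min_def by (metis linorder_neqE_nat)

definition col_rest :: "(nat \<Rightarrow> nat set) \<Rightarrow> (nat \<Rightarrow> nat) \<Rightarrow> nat \<Rightarrow> nat \<Rightarrow> nat set" where
  "col_rest C e g c = (if c < g then C c - {e c} else C c)"

text \<open>During a pair of runs g is the current column of the extra cell, so the columns c < g
  are the ones it has left, and e is unconstrained from g on. N is the label of the prepended
  letter.\<close>

definition col_shift :: "(nat \<Rightarrow> nat set) \<Rightarrow> (nat \<Rightarrow> nat) \<Rightarrow> nat \<Rightarrow> nat \<Rightarrow> bool" where
  "col_shift C e g N \<longleftrightarrow> e 0 = N \<and> (\<forall>c. 1 \<le> c \<and> c < g \<longrightarrow> balanced_min (C c) (col_rest C e g (Suc c)) (e c))"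

definition shifted :: "(nat \<Rightarrow> nat set) \<Rightarrow> (nat \<Rightarrow> nat) \<Rightarrow> nat \<Rightarrow> nat \<Rightarrow> nat set" where
  "shifted C e g c = (if c \<le> g then insert (e (c - 1)) (col_rest C e g c) else C c)"

lemma card_above_insert_low: "m \<le> u \<Longrightarrow> card_above (insert m A) u = card_above A u"
  unfolding card_above_def by (rule arg_cong[where f=card]) auto

lemma card_above_all: "\<forall>v\<in>A. m < v \<Longrightarrow> card_above A m = card A"
  unfolding card_above_def by (rule arg_cong[where f=card]) auto

text \<open>A label below all entries changes no count at an old entry. The only new candidate is m
  itself, where the counts are the full sizes of A and D; the size assumption excludes it.\<close>

lemma balanced_min_insert:
  assumes "balanced_min A D v" "\<forall>u\<in>A \<union> D. m < u" "c \<Longrightarrow> finite A \<and> finite D \<and> card D < card A"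
  shows "balanced_min (if c then insert m A else A) (if d then insert m D else D) v"
proof -
  have v: "v \<in> A" "card_above A v = card_above D v" "\<And>u. u \<in> A \<Longrightarrow> u < v \<Longrightarrow> card_above A u \<noteq> card_above D u"
    using assms(1) by (auto simp: balanced_min_def)
  have g: "m \<le> u \<Longrightarrow> card_above (if c then insert m A else A) u = card_above A u \<and>
      card_above (if d then insert m D else D) u = card_above D u" for u
    by (simp add: card_above_insert_low)
  have mv: "m < v" using assms(2) v(1) by auto
  have "card_above (if c then insert m A else A) u \<noteq> card_above (if d then insert m D else D) u"
    if u: "u \<in> (if c then insert m A else A)" "u < v" for u
  proof (cases "u = m \<and> c")
    case True
    then show ?thesis using g[of m] assms(2,3) card_above_all[of A m] card_above_all[of D m] by simp
  next
    case False
    then have "u \<in> A" using u by (auto split: if_splits)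
    moreover from this have "m \<le> u" using assms(2) by (auto simp: le_less)
    ultimately show ?thesis using g[of u] v(3)[of u] u(2) by (simp split del: if_split)
  qed
  moreover have "v \<in> (if c then insert m A else A)" using v by simp
  ultimately show ?thesis using v(2) g[of v] mv by (simp add: balanced_min_def split del: if_split)
qed

text \<open>This is a step in which both recording tableaux receive m in the same column. No earlier
  exit is disturbed: to the right of a column k < g, what remains of column k + 1 is strictly
  shorter, either because \<open>e (Suc k)\<close> is removed from it or because the extra cell is
  missing in column g.\<close>

lemma col_shift_same:
  assumes cs: "col_shift C e g N" and fin: "\<And>c. finite (C c)" and low: "\<And>c v. v \<in> C c \<Longrightarrow> m < v"
    and crd: "\<And>c. 1 \<le> c \<Longrightarrow> card (C (Suc c)) \<le> card (C c)"
    and cg: "2 \<le> g \<Longrightarrow> card (C g) < card (C (g - 1))"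
  shows "col_shift (C(c := insert m (C c))) e g N"
    and "1 \<le> d \<Longrightarrow> shifted (C(c := insert m (C c))) e g d =
      (if d = c then insert m (shifted C e g d) else shifted C e g d)"
proof -
  have ei: "e k \<in> C k" if "1 \<le> k" "k < g" for k using cs that by (auto simp: col_shift_def balanced_min_def)
  have d: "col_rest (C(c := insert m (C c))) e g k = (if k = c then insert m (col_rest C e g k) else col_rest C e g k)"
    if "1 \<le> k" for k
    using ei[OF that] low[of "e k" k] by (auto simp: col_rest_def)
  show "col_shift (C(c := insert m (C c))) e g N" unfolding col_shift_def
  proof (intro conjI allI impI)
    show "e 0 = N" using cs by (simp add: col_shift_def)
    fix k assume k: "1 \<le> k \<and> k < g"
    have p: "balanced_min (C k) (col_rest C e g (Suc k)) (e k)" using cs k by (simp add: col_shift_def)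
    have cd: "card (col_rest C e g (Suc k)) < card (C k)"
    proof (cases "Suc k < g")
      case True
      then have "card (col_rest C e g (Suc k)) < card (C (Suc k))"
        using card_Diff1_less[OF fin, of "e (Suc k)" "Suc k"] ei[of "Suc k"] by (simp add: col_rest_def)
      then show ?thesis using crd[of k] k by simp
    next
      case False
      then have "g = Suc k" using k by simp
      then show ?thesis using cg k by (simp add: col_rest_def)
    qed
    have "balanced_min (if k = c then insert m (C k) else C k)
      (if Suc k = c then insert m (col_rest C e g (Suc k)) else col_rest C e g (Suc k)) (e k)"
      by (rule balanced_min_insert[OF p]) (use low cd fin in \<open>auto simp: col_rest_def split: if_splits\<close>)
    then show "balanced_min ((C(c := insert m (C c))) k) (col_rest (C(c := insert m (C c))) e g (Suc k)) (e k)"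
      using d[of "Suc k"] by (auto split: if_splits)
  qed
  show "shifted (C(c := insert m (C c))) e g d =
      (if d = c then insert m (shifted C e g d) else shifted C e g d)" if "1 \<le> d"
    unfolding shifted_def d[OF that(1)] by auto
qed

text \<open>This is the step in which the extra cell leaves column g: one tableau receives m in
  column g, the other in column g + 1. The heights agree, so m is balanced, and it is the smallest
  candidate because it is below every earlier label.\<close>

lemma col_shift_next:
  assumes cs: "col_shift C e g N" and fin: "\<And>c. finite (C c)" and low: "\<And>c v. v \<in> C c \<Longrightarrow> m < v"
    and g: "1 \<le> g" and cg: "card (C g) = card (C (Suc g))"
  shows "col_shift (C(g := insert m (C g))) (e(g := m)) (Suc g) N"
    and "1 \<le> d \<Longrightarrow> shifted (C(g := insert m (C g))) (e(g := m)) (Suc g) d =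
      (if d = Suc g then insert m (shifted C e g d) else shifted C e g d)"
proof -
  have mg: "m \<notin> C g" using low by blast
  have d: "col_rest (C(g := insert m (C g))) (e(g := m)) (Suc g) k = col_rest C e g k" for k
    using mg by (auto simp: col_rest_def less_Suc_eq)
  show "col_shift (C(g := insert m (C g))) (e(g := m)) (Suc g) N" unfolding col_shift_def
  proof (intro conjI allI impI)
    show "(e(g := m)) 0 = N" using cs g by (simp add: col_shift_def)
    fix k assume k: "1 \<le> k \<and> k < Suc g"
    show "balanced_min ((C(g := insert m (C g))) k) (col_rest (C(g := insert m (C g))) (e(g := m)) (Suc g) (Suc k)) ((e(g := m)) k)"
    proof (cases "k = g")
      case True
      have "card_above (insert m (C g)) m = card_above (C (Suc g)) m"
        using card_above_all[of "C g" m] card_above_all[of "C (Suc g)" m] low cg by (auto simp: card_above_insert_low)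
      then show ?thesis using True by (auto simp: d balanced_min_def col_rest_def dest: low)
    next
      case False
      then show ?thesis using cs k by (simp add: d col_shift_def)
    qed
  qed
  show "shifted (C(g := insert m (C g))) (e(g := m)) (Suc g) d =
      (if d = Suc g then insert m (shifted C e g d) else shifted C e g d)" if "1 \<le> d"
  proof -
    have "d - 1 = g \<longleftrightarrow> d = Suc g" using that by auto
    then show ?thesis unfolding shifted_def d using that by (auto simp: col_rest_def)
  qed
qed

definition col_set :: "tab \<Rightarrow> nat \<Rightarrow> nat set" where
  "col_set Q c = (if c = 0 then {} else set (col Q c))"

text \<open>$m$ is the label to be recorded next, so all recorded labels are larger.\<close>

definition rs_state :: "tab \<Rightarrow> tab \<Rightarrow> nat \<Rightarrow> bool" where
  "rs_state P Q m \<longleftrightarrow> std_rows (row_sets P) \<and> (\<forall>row\<in>set P. sorted_wrt (>) row \<and> row \<noteq> []) \<and>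
     (\<forall>row\<in>set Q. row \<noteq> []) \<and> (\<forall>j. row_len Q j = row_len P j) \<and>
     (\<forall>c\<ge>1. sorted_wrt (>) (col Q c) \<and> (\<forall>v\<in>set (col Q c). m < v))"

section \<open>States of one run and of two parallel runs\<close>

lemma bump_path_card:
  assumes "std_rows R" "bump_path R B a R2" "\<forall>j. B 0 \<notin> R j"
  shows "card (R2 j) = card (R j) + (if j = a then 1 else 0)"
proof -
  have f: "finite (R j)" using assms(1) by (simp add: std_rows_def)
  have R2: "R2 j = (if j < a then insert (B j) (R j - {B (Suc j)})
                  else if j = a then insert (B a) (R a) else R j)"
    and b: "j < a \<Longrightarrow> B (Suc j) \<in> R j"
    using assms(2) by (auto simp: bump_path_def)
  show ?thesis
    using R2 b f bump_path_fresh[OF assms, of j] card_Suc_Diff1[OF f, of "B (Suc j)"]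
    by (auto simp: card.insert_remove)
qed

lemma std_rows_card_le: "std_rows R \<Longrightarrow> card (R (Suc j)) \<le> card (R j)"
proof -
  assume st: "std_rows R"
  have "card (R (Suc j)) = card_from (R (Suc j)) 0" by (simp add: card_from_def)
  also have "\<dots> \<le> card_above (R j) 0" using st by (simp add: std_rows_def)
  also have "\<dots> \<le> card (R j)" unfolding card_above_def using st by (intro card_mono) (auto simp: std_rows_def)
  finally show ?thesis .
qed

lemma rs_state_partition_shape:
  assumes "rs_state P Q m"
  shows "partition_shape Q" "row_len Q j = card (row_sets P j)"
proof -
  have r: "row_len Q j = card (row_sets P j)" for j
    using assms row_len_card[of P j] by (auto simp: rs_state_def)
  show "partition_shape Q" "row_len Q j = card (row_sets P j)"
    using assms std_rows_card_le[of "row_sets P"] by (auto simp: partition_shape_def r) (auto simp: rs_state_def)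
qed

lemma sorted_wrt_gt_distinct: "sorted_wrt (>) (xs :: nat list) \<Longrightarrow> distinct xs"
  by (induction xs) auto

lemma rs_state_height:
  assumes "rs_state P Q m" "1 \<le> c"
  shows "j < card (col_set Q c) \<longleftrightarrow> c \<le> row_len Q j" "finite (col_set Q c)" "v \<in> col_set Q c \<Longrightarrow> m < v"
    "card (col_set Q c) = length (col Q c)"
proof -
  show c: "card (col_set Q c) = length (col Q c)"
    using assms by (auto simp: col_set_def rs_state_def intro!: distinct_card sorted_wrt_gt_distinct)
  show "j < card (col_set Q c) \<longleftrightarrow> c \<le> row_len Q j"
    using col_height[OF rs_state_partition_shape(1)[OF assms(1)] assms(2)] c by auto
  show "finite (col_set Q c)" "v \<in> col_set Q c \<Longrightarrow> m < v" using assms by (auto simp: col_set_def rs_state_def)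
qed

lemma rs_state_step:
  assumes r: "rs_state P Q m" and m: "1 \<le> m" and y: "\<forall>j. y \<notin> row_sets P j" and i: "rs_ins P y = (P2, a)"
  obtains B where "B 0 = y" "bump_path (row_sets P) B a (row_sets P2)"
    "rs_state P2 (add_at Q a m) (m - 1)"
    "col_set (add_at Q a m) = (col_set Q)(Suc (row_len Q a) := insert m (col_set Q (Suc (row_len Q a))))"
    "card (col_set Q (Suc (row_len Q a))) = a"
    "\<forall>j. row_len (add_at Q a m) j = row_len Q j + (if j = a then 1 else 0)"
proof -
  have st: "std_rows (row_sets P)" and so: "\<forall>row\<in>set P. sorted_wrt (>) row \<and> row \<noteq> []"
    using r by (auto simp: rs_state_def)
  have dj: "\<forall>k l. k \<noteq> l \<longrightarrow> row_sets P k \<inter> row_sets P l = {}" using st by (simp add: std_rows_def)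
  note x = rs_ins_bump_path[OF i so y dj]
  obtain B where B: "B 0 = y" "bump_path (row_sets P) B a (row_sets P2)" using x(1) by blast
  have f: "\<forall>j. B 0 \<notin> row_sets P j" using y B by simp
  have aP: "a \<le> length Q"
  proof (rule ccontr)
    assume "\<not> a \<le> length Q"
    then have "row_len Q (a - 1) = 0" "row_len P (a - 1) \<noteq> 0"
      using x(3) so by (auto simp: row_len_def)
    then show False using r by (simp add: rs_state_def)
  qed
  have rl: "row_len (add_at Q a m) j = row_len Q j + (if j = a then 1 else 0)" for j
    by (rule row_len_add_at[OF aP])
  have st2: "std_rows (row_sets P2)" using bump_path_std_rows[OF st B(2) f] .
  have c2: "row_len P2 j = row_len (add_at Q a m) j" for j
    using row_len_card[of P2 j] x(2) bump_path_card[OF st B(2) f, of j] rs_state_partition_shape(2)[OF r, of j] by (simp add: rl)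
  have ne: "\<forall>row\<in>set (add_at Q a m). row \<noteq> []"
    using r by (auto simp: add_at_def rs_state_def dest: set_update_subset_insert[THEN subsetD])
  have pt: "partition_shape (add_at Q a m)"
    using ne std_rows_card_le[OF st2] row_len_card[of P2] x(2) by (auto simp: partition_shape_def c2[symmetric])
  note ca = col_add_at[OF rs_state_partition_shape(1)[OF r] pt aP]
  have "rs_state P2 (add_at Q a m) (m - 1)"
    unfolding rs_state_def
  proof (intro conjI allI impI)
    show "std_rows (row_sets P2)" by (rule st2)
    show "\<forall>row\<in>set P2. sorted_wrt (>) row \<and> row \<noteq> []" by (rule x(2))
    show "\<forall>row\<in>set (add_at Q a m). row \<noteq> []" by (rule ne)
    show "row_len (add_at Q a m) j = row_len P2 j" for j by (simp add: c2)
    fix c :: nat assume c: "1 \<le> c"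
    have "sorted_wrt (>) (col Q c)" "\<forall>v\<in>set (col Q c). m < v" using r c by (auto simp: rs_state_def)
    then show "sorted_wrt (>) (col (add_at Q a m) c)" "\<forall>v\<in>set (col (add_at Q a m) c). m - 1 < v"
      using m by (auto simp: ca(1)[OF c] sorted_wrt_append)
  qed
  moreover have "col_set (add_at Q a m) = (col_set Q)(Suc (row_len Q a) := insert m (col_set Q (Suc (row_len Q a))))"
    by (auto simp: col_set_def fun_eq_iff ca(1))
  moreover have "card (col_set Q (Suc (row_len Q a))) = a"
    using rs_state_height(4)[OF r] ca(2)[OF order_refl] by simp
  ultimately show thesis using that B rl by blast
qed

lemma left_inserted_card:
  assumes "left_inserted R R' p z" "\<And>j. finite (R j)"
  shows "card (R' j) = card (R j) + (if j = p then 1 else 0)"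
proof (cases "j \<le> p")
  case True
  then show ?thesis using assms by (cases "j = p") (auto simp: left_inserted_def)
next
  case False
  then obtain k where k: "j = Suc k" "p \<le> k" by (cases j) auto
  have "R' j = insert (z j) (R j) - {z k}" "z j \<notin> R j"
    "z k \<in> R j \<and> z k < z j \<or> z j = z k \<and> z k \<notin> R j"
    using assms(1) k by (auto simp: left_inserted_def)
  moreover have "card (insert (z j) (R j)) = Suc (card (R j))" using assms(2)[of j] calculation(2) by simp
  moreover have "insert (z j) (R j) - {z k} = R j" if "z j = z k" "z k \<notin> R j" using that by auto
  ultimately show ?thesis using k by (elim disjE) (auto simp: card_Diff_singleton)
qed

text \<open>The joint state after both runs have read the same letters; m is their common next label
  and p the row of the extra cell. That z is eventually y remembers which value was inserted from
  the left; this is exploited only at the end of the word.\<close>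

definition rs_pair :: "tab \<Rightarrow> tab \<Rightarrow> tab \<Rightarrow> tab \<Rightarrow> nat \<Rightarrow> nat \<Rightarrow> nat \<Rightarrow> nat \<Rightarrow> bool" where
  "rs_pair P Q P' Q' m y N p \<longleftrightarrow> rs_state P Q m \<and> rs_state P' Q' m \<and>
     (\<exists>z. left_inserted (row_sets P) (row_sets P') p z \<and> (\<exists>k. \<forall>j\<ge>k. z j = y)) \<and>
     (\<exists>e. col_shift (col_set Q) e (Suc (row_len Q p)) N \<and>
       (\<forall>c\<ge>1. col_set Q' c = shifted (col_set Q) e (Suc (row_len Q p)) c))"

lemma rs_pair_step:
  assumes rr: "rs_pair P Q P' Q' m y N p" and m: "1 \<le> m"
    and x: "\<forall>j. x \<notin> row_sets P j" and x': "\<forall>j. x \<notin> row_sets P' j"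
    and i: "rs_ins P x = (P2, a)" and i': "rs_ins P' x = (P2', a')"
  shows "\<exists>p'. rs_pair P2 (add_at Q a m) P2' (add_at Q' a' m) (m - 1) y N p'"
proof -
  have r: "rs_state P Q m" and r': "rs_state P' Q' m" using rr by (auto simp: rs_pair_def)
  obtain z k where z: "left_inserted (row_sets P) (row_sets P') p z" "\<forall>j\<ge>k. z j = y"
    using rr by (auto simp: rs_pair_def)
  define g where "g = Suc (row_len Q p)"
  obtain e where e: "col_shift (col_set Q) e g N" "\<forall>c\<ge>1. col_set Q' c = shifted (col_set Q) e g c"
    using rr by (auto simp: rs_pair_def g_def)
  obtain B where B: "B 0 = x" "bump_path (row_sets P) B a (row_sets P2)"
    "rs_state P2 (add_at Q a m) (m - 1)"
    "col_set (add_at Q a m) = (col_set Q)(Suc (row_len Q a) := insert m (col_set Q (Suc (row_len Q a))))"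
    "card (col_set Q (Suc (row_len Q a))) = a"
    "\<forall>j. row_len (add_at Q a m) j = row_len Q j + (if j = a then 1 else 0)"
    using rs_state_step[OF r m x i] by metis
  obtain B' where B': "B' 0 = x" "bump_path (row_sets P') B' a' (row_sets P2')"
    "rs_state P2' (add_at Q' a' m) (m - 1)"
    "col_set (add_at Q' a' m) = (col_set Q')(Suc (row_len Q' a') := insert m (col_set Q' (Suc (row_len Q' a'))))"
    "card (col_set Q' (Suc (row_len Q' a'))) = a'"
    "\<forall>j. row_len (add_at Q' a' m) j = row_len Q' j + (if j = a' then 1 else 0)"
    using rs_state_step[OF r' m x' i'] by metis
  interpret insert_both "row_sets P" "row_sets P'" p z B B' a a' "row_sets P2" "row_sets P2'"
    by unfold_locales (use r r' z B B' x x' in \<open>auto simp: rs_state_def\<close>)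
  obtain p' z' where s: "left_inserted (row_sets P2) (row_sets P2') p' z'" "\<forall>j\<ge>a. z' j = z j"
    "a' = a \<and> p' = p \<or> a = p \<and> a' = Suc p \<and> p' = Suc p \<and> card (row_sets P p) = card (row_sets P (Suc p))"
    using insert_both_step by auto
  have ev: "\<exists>k. \<forall>j\<ge>k. z' j = y" using s(2) z(2) by (intro exI[of _ "max a k"]) auto
  have rl': "row_len Q' j = row_len Q j + (if j = p then 1 else 0)" for j
    using left_inserted_card[OF z(1) fin, of j] rs_state_partition_shape(2)[OF r] rs_state_partition_shape(2)[OF r'] by simp
  have finC: "finite (col_set Q c)" and lowC: "v \<in> col_set Q c \<Longrightarrow> m < v" for c v
    using rs_state_height(2,3)[OF r, of c] by (cases "c = 0"; force simp: col_set_def)+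
  have h: "1 \<le> c \<Longrightarrow> j < card (col_set Q c) \<longleftrightarrow> c \<le> row_len Q j" for c j
    using rs_state_height(1)[OF r] by simp
  have crd: "card (col_set Q (Suc c)) \<le> card (col_set Q c)" if "1 \<le> c" for c
    using h[OF that, of "card (col_set Q (Suc c)) - 1"] h[of "Suc c" "card (col_set Q (Suc c)) - 1"]
    by (cases "card (col_set Q (Suc c)) = 0") auto
  have cg: "card (col_set Q g) < card (col_set Q (g - 1))" if "2 \<le> g"
    using h[of g p] h[of "g - 1" p] that by (auto simp: g_def)
  have "\<exists>e. col_shift (col_set (add_at Q a m)) e (Suc (row_len (add_at Q a m) p')) N \<and>
       (\<forall>c\<ge>1. col_set (add_at Q' a' m) c = shifted (col_set (add_at Q a m)) e (Suc (row_len (add_at Q a m) p')) c)"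
  proof (cases "a' = p")
    case True
    then have ap: "a = p" "p' = p" using s(3) by auto
    have g': "Suc (row_len (add_at Q a m) p') = Suc g" using ap B(6) by (simp add: g_def)
    \<comment> \<open>The label goes into row p of both tableaux, so column g of Q and column g + 1
      of Q' have height p. Column g + 1 is common to Q and Q', and the equality of heights required
      for an exit follows.\<close>
    have "col_set Q' (Suc g) = col_set Q (Suc g)" using e(2) by (simp add: shifted_def)
    then have "card (col_set Q (Suc g)) = p" using B'(5) rl'[of p] True by (simp add: g_def)
    then have eq: "card (col_set Q g) = card (col_set Q (Suc g))" using B(5) ap by (simp add: g_def)
    have g1: "1 \<le> g" by (simp add: g_def)
    note cn = col_shift_next[OF e(1) finC lowC g1 eq]
    have Ca: "col_set (add_at Q a m) = (col_set Q)(g := insert m (col_set Q g))" using B(4) ap by (simp add: g_def)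
    have Ca': "col_set (add_at Q' a' m) = (col_set Q')(Suc g := insert m (col_set Q' (Suc g)))"
      using B'(4) True rl'[of p] by (simp add: g_def)
    show ?thesis unfolding g' Ca Ca' using cn e(2) by (intro exI[of _ "e(g := m)"]) auto
  next
    case False
    define c where "c = Suc (row_len Q a)"
    \<comment> \<open>If the extra cell rises, rows p and p + 1 have equal length before the step,
      so the two labels fall into the same column and g is preserved.\<close>
    have c': "Suc (row_len Q' a') = c" and g': "Suc (row_len (add_at Q a m) p') = g"
      using s(3) False B(6) rl' rs_state_partition_shape(2)[OF r] by (auto simp: c_def g_def)
    have c1: "1 \<le> c" by (simp add: c_def)
    note cn = col_shift_same[OF e(1) finC lowC crd cg]
    show ?thesis unfolding g' B(4) B'(4) c' using cn c1 e(2) unfolding c_def[symmetric]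
      by (intro exI[of _ e]) auto
  qed
  then show ?thesis unfolding rs_pair_def using B(3) B'(3) s(1) ev by blast
qed

section \<open>Prepending a letter to a reverse lattice word\<close>

definition rs_P :: "nat list \<Rightarrow> tab \<Rightarrow> tab" where
  "rs_P ys P = foldl (\<lambda>P y. fst (rs_ins P y)) P ys"

lemma rs_P_simps [simp]: "rs_P [] P = P" "rs_P (y # ys) P = rs_P ys (fst (rs_ins P y))"
  by (simp_all add: rs_P_def)

lemma bump_path_entries:
  assumes "bump_path R B a R2" "v \<in> R2 j"
  shows "v = B 0 \<or> (\<exists>k. v \<in> R k)"
proof -
  have "B j = B 0 \<or> (\<exists>k. B j \<in> R k)" if "j \<le> a"
    using assms(1) that by (cases j) (auto simp: bump_path_def Suc_le_eq)
  then show ?thesis using bump_path_sub[OF assms] by auto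
qed

lemma rs_pair_loop:
  assumes "rs_pair P Q P' Q' m y N p" "length ys \<le> m" "distinct ys"
    "\<forall>x\<in>set ys. \<forall>j. x \<notin> row_sets P j" "\<forall>x\<in>set ys. \<forall>j. x \<notin> row_sets P' j"
  shows "\<exists>p. rs_pair (rs_P ys P) (rs_loop ys m P Q) (rs_P ys P') (rs_loop ys m P' Q') (m - length ys) y N p"
  using assms
proof (induction ys arbitrary: P Q P' Q' m p)
  case Nil
  then show ?case by auto
next
  case (Cons x ys)
  obtain P2 a where i: "rs_ins P x = (P2, a)" by fastforce
  obtain P2' a' where i': "rs_ins P' x = (P2', a')" by fastforce
  have m: "1 \<le> m" using Cons.prems by simp
  have x: "\<forall>j. x \<notin> row_sets P j" "\<forall>j. x \<notin> row_sets P' j" using Cons.prems by auto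
  obtain p' where p': "rs_pair P2 (add_at Q a m) P2' (add_at Q' a' m) (m - 1) y N p'"
    using rs_pair_step[OF Cons.prems(1) m x i i'] by blast
  have r: "rs_state P Q m" "rs_state P' Q' m" using Cons.prems(1) by (auto simp: rs_pair_def)
  obtain B where B: "B 0 = x" "bump_path (row_sets P) B a (row_sets P2)" using rs_state_step[OF r(1) m x(1) i] by metis
  obtain B' where B': "B' 0 = x" "bump_path (row_sets P') B' a' (row_sets P2')" using rs_state_step[OF r(2) m x(2) i'] by metis
  have "\<forall>u\<in>set ys. \<forall>j. u \<notin> row_sets P2 j" "\<forall>u\<in>set ys. \<forall>j. u \<notin> row_sets P2' j"
    using bump_path_entries[OF B(2)] bump_path_entries[OF B'(2)] B(1) B'(1) Cons.prems(3-5) by (auto, metis+)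
  moreover have "length ys \<le> m - 1" "distinct ys" using Cons.prems by auto
  ultimately have "\<exists>p. rs_pair (rs_P ys P2) (rs_loop ys (m - 1) P2 (add_at Q a m)) (rs_P ys P2')
      (rs_loop ys (m - 1) P2' (add_at Q' a' m)) (m - 1 - length ys) y N p"
    using Cons.IH[OF p'] by blast
  then show ?case using i i' by simp
qed

lemma std_rows_single: "std_rows (row_sets [[y]])"
  by (auto simp: std_rows_def row_sets_Cons card_from_def split: nat.splits)

text \<open>The prepended letter takes the label n + 1, after which both runs continue with label n.
  The extra cell starts in column g = 1, so of e only \<open>e 0\<close> matters.\<close>

lemma rs_pair_init: "rs_pair [] [] [[y]] [[Suc n]] n y (Suc n) 0"
proof -
  have c: "1 \<le> c \<Longrightarrow> col [[Suc n]] c = (if c = 1 then [Suc n] else [])" for c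
    by (auto simp: col_def)
  have "rs_state [] [] n" by (auto simp: rs_state_def std_rows_def row_len_def col_def card_from_def)
  moreover have "rs_state [[y]] [[Suc n]] n"
    using std_rows_single[of y] by (auto simp: rs_state_def row_len_def c)
  moreover have "left_inserted (row_sets []) (row_sets [[y]]) 0 (\<lambda>_. y)"
    by (auto simp: left_inserted_def row_sets_Cons card_above_def card_from_def)
  moreover have "col_shift (col_set []) (\<lambda>_. Suc n) (Suc (row_len [] 0)) (Suc n)"
    by (auto simp: col_shift_def row_len_def)
  moreover have "col_set [[Suc n]] c = shifted (col_set []) (\<lambda>_. Suc n) (Suc (row_len [] 0)) c" if "1 \<le> c" for c
    using that c by (auto simp: col_set_def shifted_def row_len_def col_rest_def col_def)
  ultimately show ?thesis unfolding rs_pair_def by blast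
qed

text \<open>Order isomorphism with the word is all that is needed of the standardization, and unlike
  equality with the standardization it is inherited by suffixes.\<close>

fun standardizes :: "nat list \<Rightarrow> nat list \<Rightarrow> bool" where
  "standardizes [] [] \<longleftrightarrow> True"
| "standardizes (i # w) (y # s) \<longleftrightarrow> standardizes w s \<and> (\<forall>(a, v)\<in>set (zip w s). v \<noteq> y \<and> (y < v \<longleftrightarrow> i \<le> a))"
| "standardizes _ _ \<longleftrightarrow> False"

text \<open>The expected row j of the insertion tableau, counted from 0. Each value keeps its
  letter, since the lattice condition speaks of letters and not of values.\<close>

fun superstd :: "nat list \<Rightarrow> nat list \<Rightarrow> nat \<Rightarrow> (nat \<times> nat) set" where
  "superstd (i # w) (y # s) j = (if j = count_list w i then {(i, y)} else {}) \<union> superstd w s j"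
| "superstd _ _ j = {}"

section \<open>Values grouped by the number of equal letters to their right\<close>

lemma standardizes_length: "standardizes w s \<Longrightarrow> length w = length s"
  by (induction w s rule: standardizes.induct) auto

lemma standardizes_distinct: "standardizes w s \<Longrightarrow> distinct s"
proof (induction w s rule: standardizes.induct)
  case (2 i w y s)
  then have "length w = length s" by (auto dest: standardizes_length)
  then have "y \<notin> set s" using 2 by (fastforce simp: in_set_conv_nth set_zip)
  then show ?case using 2 by simp
qed auto

lemma superstd_sub: "(a, v) \<in> superstd w s j \<Longrightarrow> (a, v) \<in> set (zip w s)"
  by (induction w s j rule: superstd.induct) (auto split: if_splits)

lemma superstd_count: "(a, v) \<in> superstd w s j \<Longrightarrow> j < count_list w a"
  by (induction w s j rule: superstd.induct) (auto split: if_splits)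

lemma superstd_fun: "(a, v) \<in> superstd w s j \<Longrightarrow> (a, v') \<in> superstd w s j \<Longrightarrow> v = v'"
  by (induction w s j rule: superstd.induct) (auto split: if_splits dest: superstd_count)

lemma superstd_ex: "standardizes w s \<Longrightarrow> j < count_list w a \<Longrightarrow> \<exists>v. (a, v) \<in> superstd w s j"
  by (induction w s rule: standardizes.induct) (auto simp: less_Suc_eq split: if_splits)

lemma superstd_anti: "standardizes w s \<Longrightarrow> (a, v) \<in> superstd w s j \<Longrightarrow> (a, v') \<in> superstd w s j' \<Longrightarrow> j' < j \<Longrightarrow> v < v'"
  by (induction w s rule: standardizes.induct) (fastforce split: if_splits dest: superstd_sub superstd_count)+

lemma zip_mono: "standardizes w s \<Longrightarrow> (a, v) \<in> set (zip w s) \<Longrightarrow> (b, u) \<in> set (zip w s) \<Longrightarrow> a < b \<Longrightarrow> v < u"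
  by (induction w s rule: standardizes.induct) (fastforce simp: not_le)+

lemma lattice_tl: "reverse_lattice (i # w) \<Longrightarrow> reverse_lattice w"
  unfolding reverse_lattice_def by (auto, metis drop_Suc_Cons)

lemma lattice_count:
  assumes "reverse_lattice w" "1 \<le> a" "a \<le> b"
  shows "count_list w b \<le> count_list w a"
  using assms(3,2)
proof (induction b rule: dec_induct)
  case (step n)
  then have "count_list w (Suc n) \<le> count_list w n"
    using assms(1)[unfolded reverse_lattice_def, THEN conjunct2, rule_format, of n 0] by simp
  then show ?case using step by simp
qed simp

text \<open>The value y settles in row p, the number of letters i in w, and passes all higher rows
  without an exchange. Entries above y belong to letters at least i, and none of these occurs in w
  more often than i; so row p consists of one entry for each of the letters 1, ..., i - 1. This
  places the extra cell in column i.\<close>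

lemma superstandard:
  assumes lat: "reverse_lattice (i # w)" and sz: "standardizes (i # w) (y # s)"
    and R: "\<forall>j. R j = snd ` superstd w s j"
    and st: "std_rows R" and st': "std_rows R'" and left_inserted: "left_inserted R R' p z" and ev: "\<forall>j\<ge>k. z j = y"
  shows "\<forall>j. R' j = snd ` superstd (i # w) (y # s) j" and "card (R p) = i - 1"
proof -
  have lw: "reverse_lattice w" using lattice_tl[OF lat] .
  have szw: "standardizes w s" using sz by simp
  have yi: "v \<noteq> y \<and> (y < v \<longleftrightarrow> i \<le> a)" if "(a, v) \<in> superstd w s j" for a v j
    using sz superstd_sub[OF that] by auto
  have pos: "1 \<le> a" if "(a, v) \<in> superstd w s j" for a v j
    using lw superstd_sub[OF that] by (auto simp: reverse_lattice_def dest: set_zip_leftD)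
  have i1: "1 \<le> i" using lat by (simp add: reverse_lattice_def)
  have yR: "y \<notin> R j" for j using yi R by force
  have z_notin: "p \<le> j \<Longrightarrow> z j \<notin> R j"
    and row_Suc: "p \<le> j \<Longrightarrow> R' (Suc j) = insert (z (Suc j)) (R (Suc j)) - {z j}"
    and z_cases: "p \<le> j \<Longrightarrow> z j \<in> R (Suc j) \<and> z j < z (Suc j) \<or> z (Suc j) = z j \<and> z j \<notin> R (Suc j)"
    and tight: "p \<le> j \<Longrightarrow> card_above (R j) (z j) = card_from (R (Suc j)) (z j)"
    and low: "j < p \<Longrightarrow> R' j = R j" and row_p: "R' p = insert (z p) (R p)" for j
    using left_inserted by (auto simp: left_inserted_def)
  have fin: "finite (R j)" "finite (R' j)" for j using st st' by (auto simp: std_rows_def)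
  have cs': "card_from (R' (Suc j)) d \<le> card_above (R' j) d" for j d using st' by (auto simp: std_rows_def)
  \<comment> \<open>From row q upwards y is merely handed through; it remains to show that q is
    already the row p in which the left insertion settles.\<close>
  define q where "q = (LEAST q. p \<le> q \<and> (\<forall>j\<ge>q. z j = y))"
  have "p \<le> max p k \<and> (\<forall>j\<ge>max p k. z j = y)" using ev by simp
  then have "p \<le> q \<and> (\<forall>j\<ge>q. z j = y)"
    unfolding q_def by (rule LeastI[where P = "\<lambda>q. p \<le> q \<and> (\<forall>j\<ge>q. z j = y)"])
  then have q: "p \<le> q" "\<And>j. q \<le> j \<Longrightarrow> z j = y" by auto
  have q_least: "p = q \<or> z (q - 1) \<noteq> y"
  proof (rule ccontr)
    assume c: "\<not> ?thesis"
    have "z j = y" if "q - 1 \<le> j" for j using c q(2)[of j] that by (cases "j = q - 1") auto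
    moreover have pq': "p < q" using c q(1) le_neq_implies_less by blast
    then have "p \<le> q - 1" by simp
    ultimately have "p \<le> q - 1 \<and> (\<forall>j\<ge>q - 1. z j = y)" by blast
    then have "q \<le> q - 1" unfolding q_def by (rule Least_le)
    then show False using pq' by simp
  qed
  have geq: "card_from (R j) y = card_above (R j) y" for j
    unfolding card_from_def card_above_def using yR[of j] by (intro arg_cong[where f=card]) (auto simp: le_less)
  \<comment> \<open>Where z equals y, the balance condition gives consecutive rows the same number
    of entries above y. Rows beyond the length of w are empty, so this number is 0.\<close>
  have "card_above (R (q + l)) y = card_above (R q) y" for l
  proof (induction l)
    case (Suc l)
    then show ?case using tight[of "q + l"] q geq[of "Suc (q + l)"] by simp
  qed simp
  moreover have "(a, v) \<notin> superstd w s (q + length w)" for a v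
    using superstd_count[of a v w s "q + length w"] count_le_length[of w a] by auto
  then have "R (q + length w) = {}" using R by auto
  then have "card_above (R (q + length w)) y = 0" by (simp add: card_above_def)
  ultimately have g0: "card_above (R q) y = 0" by metis
  then have Rq: "\<not> y < v" if "v \<in> R q" for v using that fin(1)[of q] by (auto simp: card_above_def)
  have cq: "count_list w i \<le> q"
  proof (rule ccontr)
    assume "\<not> ?thesis"
    then obtain v where "(i, v) \<in> superstd w s q" using superstd_ex[OF szw, of q i] by auto
    then show False using yi[of i v q] Rq[of v] R by force
  qed
  have big: "count_list w i \<ge> Suc j" if vj: "v \<in> R j" "y < v" for v j
  proof -
    obtain a where a: "(a, v) \<in> superstd w s j" using vj R by auto
    then have "i \<le> a" using yi vj by blast
    then show ?thesis using lattice_count[OF lw i1, of a] superstd_count[OF a] by simp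
  qed
  have pq: "p = q"
  proof (rule ccontr)
    assume n: "p \<noteq> q"
    then obtain r where r: "q = Suc r" "p \<le> r" using q(1) by (cases q) auto
    have zr: "z r \<in> R q" "z r < y" using q_least n r q(2)[of q] z_cases[OF r(2)] by auto
    have "y \<in> R' q" using row_Suc[OF r(2)] zr r q by auto
    then have "0 < card_from (R' q) y" using fin by (auto simp: card_from_def card_gt_0_iff)
    then have "0 < card_above (R' r) y" using cs'[of r y] r by simp
    then obtain u where u: "u \<in> R' r" "y < u" using fin by (auto simp: card_above_def card_gt_0_iff)
    have "R' r \<subseteq> insert (z r) (R r)"
    proof (cases "r = p")
      case True
      then show ?thesis using row_p by simp
    next
      case False
      then have "r = Suc (r - 1)" "p \<le> r - 1" using r by auto
      then show ?thesis using row_Suc[of "r - 1"] by auto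
    qed
    then have uR: "u \<in> R r" using u zr by auto
    obtain b where b: "(b, u) \<in> superstd w s r" using uR R by auto
    have bi: "i \<le> b" using yi[OF b] u by simp
    have cr: "Suc r \<le> count_list w i" using big[OF uR u(2)] .
    \<comment> \<open>f sends an entry of row q to the entry of row r with the same letter. It
      misses u: entries of row q are below y and so have letters smaller than i, while u belongs to
      a letter at least i. Row r then has too many entries above \<open>z r\<close> for the
      balance.\<close>
    define f where "f v = (SOME v'. \<exists>a. (a, v) \<in> superstd w s q \<and> (a, v') \<in> superstd w s r)" for v
    have inj_l: "a = a'" if "(a, v) \<in> superstd w s j" "(a', v) \<in> superstd w s j'" for a a' v j j'
      using zip_mono[OF szw superstd_sub[OF that(1)] superstd_sub[OF that(2)]]
        zip_mono[OF szw superstd_sub[OF that(2)] superstd_sub[OF that(1)]] by (metis less_irrefl linorder_neqE_nat)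
    have f: "\<exists>a. (a, v) \<in> superstd w s q \<and> (a, f v) \<in> superstd w s r" if v: "v \<in> R q" for v
    proof -
      obtain a where a: "(a, v) \<in> superstd w s q" using v R by auto
      then have "r < count_list w a" using superstd_count[OF a] r by simp
      then obtain v' where "(a, v') \<in> superstd w s r" using superstd_ex[OF szw] by blast
      then have "\<exists>a. (a, v) \<in> superstd w s q \<and> (a, v') \<in> superstd w s r" using a by blast
      then show ?thesis unfolding f_def by (rule someI)
    qed
    have inj: "inj_on f (R q)"
    proof (rule inj_onI)
      fix v v' assume h: "v \<in> R q" "v' \<in> R q" "f v = f v'"
      then show "v = v'" using f[OF h(1)] f[OF h(2)] inj_l superstd_fun by metis
    qed
    have sub: "insert u (f ` {v\<in>R q. z r \<le> v}) \<subseteq> {v\<in>R r. z r < v}"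
    proof -
      have "f v \<in> R r \<and> z r < f v" if v: "v \<in> R q" "z r \<le> v" for v
        using f[OF v(1)] superstd_anti[OF szw, of _ v q "f v" r] v(2) r R by force
      then show ?thesis using uR u(2) zr by auto
    qed
    have un: "u \<notin> f ` {v\<in>R q. z r \<le> v}"
    proof
      assume "u \<in> f ` {v\<in>R q. z r \<le> v}"
      then obtain v where v: "v \<in> R q" "u = f v" by auto
      obtain a where a: "(a, v) \<in> superstd w s q" "(a, u) \<in> superstd w s r" using f[OF v(1)] v(2) by auto
      then show False using inj_l[OF a(2) b] bi yi[OF a(1)] Rq[OF v(1)] by simp
    qed
    have "Suc (card_from (R q) (z r)) = card (insert u (f ` {v\<in>R q. z r \<le> v}))"
      using un fin inj by (simp add: card_from_def card_image inj_on_subset[of f "R q"])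
    also have "\<dots> \<le> card_above (R r) (z r)" unfolding card_above_def using sub fin by (intro card_mono) auto
    finally show False using tight[OF r(2)] r by simp
  qed
  have pc: "p = count_list w i"
  proof (cases p)
    case (Suc r)
    have "y \<in> R' p" using row_p q pq by simp
    then have "0 < card_from (R' p) y" using fin by (auto simp: card_from_def card_gt_0_iff)
    then have "0 < card_above (R' r) y" using cs'[of r y] Suc by simp
    then obtain u where u: "u \<in> R r" "y < u" using fin low[of r] Suc by (auto simp: card_above_def card_gt_0_iff)
    then show ?thesis using big[OF u] cq pq Suc by simp
  qed (use cq pq in simp)
  have zy: "p \<le> j \<Longrightarrow> z j = y" for j using q pq by simp
  show "\<forall>j. R' j = snd ` superstd (i # w) (y # s) j"
  proof
    fix j
    consider "j < p" | "j = p" | r where "j = Suc r" "p \<le> r" by (cases j) (auto, linarith)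
    then show "R' j = snd ` superstd (i # w) (y # s) j"
    proof cases
      case 1
      then show ?thesis using low R pc by simp
    next
      case 2
      then show ?thesis using row_p R pc zy by auto
    next
      case 3
      then show ?thesis using row_Suc[of r] R pc zy yR[of j] by auto
    qed
  qed
  have "bij_betw snd (superstd w s p) (R p)"
  proof -
    have "inj_on snd (superstd w s p)"
    proof (rule inj_onI, clarsimp)
      fix a a' v assume that: "(a, v) \<in> superstd w s p" "(a', v) \<in> superstd w s p"
      show "a = a'" using zip_mono[OF szw superstd_sub[OF that(1)] superstd_sub[OF that(2)]]
        zip_mono[OF szw superstd_sub[OF that(2)] superstd_sub[OF that(1)]] by (metis less_irrefl linorder_neqE_nat)
    qed
    then show ?thesis using R by (simp add: bij_betw_def)
  qed
  moreover have "bij_betw fst (superstd w s p) {1..<i}"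
  proof -
    have "inj_on fst (superstd w s p)" by (rule inj_onI) (use superstd_fun in force)
    moreover have "fst ` superstd w s p = {1..<i}"
    proof (rule equalityI; rule subsetI)
      fix a assume "a \<in> fst ` superstd w s p"
      then obtain v where v: "(a, v) \<in> superstd w s p" by auto
      have "a < i"
      proof (rule ccontr)
        assume "\<not> a < i"
        then have "count_list w a \<le> count_list w i" using lattice_count[OF lw i1] by simp
        then show False using superstd_count[OF v] pc by simp
      qed
      then show "a \<in> {1..<i}" using pos[OF v] by simp
    next
      fix a assume a: "a \<in> {1..<i}"
      \<comment> \<open>The lattice condition for the longer word enters here: the occurrence of i
        at the front makes the inequality strict in w.\<close>
      then have "count_list (i # w) i \<le> count_list (i # w) a" using lattice_count[OF lat, of a i] by simp
      then have "p < count_list w a" using a pc by auto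
      then obtain v where "(a, v) \<in> superstd w s p" using superstd_ex[OF szw] by blast
      then show "a \<in> fst ` superstd w s p" by force
    qed
    ultimately show ?thesis by (simp add: bij_betw_def)
  qed
  ultimately have "card (R p) = card {1..<i}" by (metis bij_betw_same_card)
  then show "card (R p) = i - 1" by simp
qed

lemma rs_run_Cons:
  assumes "reverse_lattice (i # w)" "standardizes (i # w) (y # s)"
    "rs_state (rs_P s []) (rs_Q s) 0" "\<forall>j. row_sets (rs_P s []) j = snd ` superstd w s j"
  shows "rs_state (rs_P (y # s) []) (rs_Q (y # s)) 0 \<and>
     (\<forall>j. row_sets (rs_P (y # s) []) j = snd ` superstd (i # w) (y # s) j) \<and>
     (\<exists>e. col_shift (col_set (rs_Q s)) e i (Suc (length w)) \<and>
       (\<forall>c\<ge>1. col_set (rs_Q (y # s)) c = shifted (col_set (rs_Q s)) e i c))"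
proof -
  have lw: "reverse_lattice w" using lattice_tl[OF assms(1)] .
  have sz: "standardizes w s" using assms(2) by simp
  have d: "distinct s" "y \<notin> set s" using standardizes_distinct[OF assms(2)] by auto
  have ln: "length w = length s" using standardizes_length[OF sz] .
  have "\<exists>p. rs_pair (rs_P s []) (rs_loop s (length s) [] []) (rs_P s [[y]])
      (rs_loop s (length s) [[y]] [[Suc (length s)]]) (length s - length s) y (Suc (length s)) p"
    by (rule rs_pair_loop[OF rs_pair_init]) (use d in \<open>auto simp: row_sets_Cons split: nat.splits\<close>)
  moreover have "rs_P (y # s) [] = rs_P s [[y]]" "rs_Q (y # s) = rs_loop s (length s) [[y]] [[Suc (length s)]]"
    by (simp_all add: rs_Q_def add_at_def)
  ultimately obtain p where rr: "rs_pair (rs_P s []) (rs_Q s) (rs_P (y # s) []) (rs_Q (y # s)) 0 y (Suc (length s)) p"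
    by (auto simp: rs_Q_def)
  then have r: "rs_state (rs_P s []) (rs_Q s) 0" "rs_state (rs_P (y # s) []) (rs_Q (y # s)) 0" by (auto simp: rs_pair_def)
  obtain z k where z: "left_inserted (row_sets (rs_P s [])) (row_sets (rs_P (y # s) [])) p z" "\<forall>j\<ge>k. z j = y"
    using rr by (auto simp: rs_pair_def)
  note su = superstandard[OF assms(1,2) assms(4) _ _ z]
  have "std_rows (row_sets (rs_P s []))" "std_rows (row_sets (rs_P (y # s) []))" using r by (auto simp: rs_state_def)
  note su = su[OF this]
  have "1 \<le> i" using assms(1) by (simp add: reverse_lattice_def)
  then have "Suc (row_len (rs_Q s) p) = i" using su(2) rs_state_partition_shape(2)[OF r(1), of p] by simp
  then have "\<exists>e. col_shift (col_set (rs_Q s)) e i (Suc (length s)) \<and>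
       (\<forall>c\<ge>1. col_set (rs_Q (y # s)) c = shifted (col_set (rs_Q s)) e i c)"
    using rr by (auto simp: rs_pair_def)
  then show ?thesis using r(2) su(1) ln by auto
qed

lemma rs_run:
  "reverse_lattice w \<Longrightarrow> standardizes w s \<Longrightarrow>
    rs_state (rs_P s []) (rs_Q s) 0 \<and> (\<forall>j. row_sets (rs_P s []) j = snd ` superstd w s j)"
proof (induction w s rule: standardizes.induct)
  case 1
  then show ?case by (auto simp: rs_state_def std_rows_def row_len_def col_def card_from_def rs_Q_def)
next
  case (2 i w y s)
  then show ?case using rs_run_Cons[of i w y s] lattice_tl[of i w] by simp
qed auto

lemma rs_cols:
  assumes "reverse_lattice (i # w)" "standardizes (i # w) (y # s)"
  shows "\<exists>e. col_shift (col_set (rs_Q s)) e i (Suc (length w)) \<and>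
       (\<forall>c\<ge>1. col_set (rs_Q (y # s)) c = shifted (col_set (rs_Q s)) e i c)"
  using rs_run_Cons[OF assms] rs_run[of w s] lattice_tl[OF assms(1)] assms(2) by simp

text \<open>Row j has one box for each letter occurring more than j times, and by the lattice
  condition these letters form an initial segment. On the composition side this supplies the part
  needed by the first slide.\<close>

lemma rs_count:
  assumes "reverse_lattice w" "standardizes w s" "1 \<le> c"
  shows "card (col_set (rs_Q s) c) = count_list w c"
proof -
  have r: "rs_state (rs_P s []) (rs_Q s) 0" "\<forall>j. row_sets (rs_P s []) j = snd ` superstd w s j"
    using rs_run[OF assms(1,2)] by auto
  have "j < card (col_set (rs_Q s) c) \<longleftrightarrow> j < count_list w c" for j
  proof -
    let ?L = "{a. 1 \<le> a \<and> j < count_list w a}"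
    have f: "fst ` superstd w s j = ?L"
    proof (rule equalityI; rule subsetI)
      fix a assume "a \<in> fst ` superstd w s j"
      then obtain v where v: "(a, v) \<in> superstd w s j" by auto
      then show "a \<in> ?L" using superstd_count[OF v] assms(1) superstd_sub[OF v]
        by (auto simp: reverse_lattice_def dest: set_zip_leftD)
    qed (use superstd_ex[OF assms(2)] in force)
    have "inj_on fst (superstd w s j)" by (rule inj_onI) (use superstd_fun in force)
    then have c1: "card (superstd w s j) = card ?L" using f by (metis card_image)
    have "inj_on snd (superstd w s j)"
    proof (rule inj_onI, clarsimp)
      fix a a' v assume that: "(a, v) \<in> superstd w s j" "(a', v) \<in> superstd w s j"
      show "a = a'" using zip_mono[OF assms(2) superstd_sub[OF that(1)] superstd_sub[OF that(2)]]
        zip_mono[OF assms(2) superstd_sub[OF that(2)] superstd_sub[OF that(1)]] by (metis less_irrefl linorder_neqE_nat)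
    qed
    then have rl: "row_len (rs_Q s) j = card ?L"
      using rs_state_partition_shape(2)[OF r(1), of j] r(2) c1 by (simp add: card_image)
    have fin: "finite ?L"
      by (rule finite_subset[of _ "set w"]) (auto simp: count_list_0_iff intro: ccontr)
    have "c \<le> card ?L \<longleftrightarrow> j < count_list w c"
    proof
      assume "j < count_list w c"
      then have "{1..c} \<subseteq> ?L" using lattice_count[OF assms(1), of _ c] by force
      then have "card {1..c} \<le> card ?L" by (rule card_mono[OF fin])
      then show "c \<le> card ?L" by simp
    next
      assume c: "c \<le> card ?L"
      show "j < count_list w c"
      proof (rule ccontr)
        assume n: "\<not> j < count_list w c"
        have "a < c" if "a \<in> ?L" for a using lattice_count[OF assms(1,3), of a] that n by force
        then have "?L \<subseteq> {1..<c}" by auto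
        then have "card ?L \<le> card {1..<c}" by (intro card_mono) auto
        then show False using c assms(3) by simp
      qed
    qed
    then show ?thesis using rs_state_height(1)[OF r(1) assms(3), of j] rl by simp
  qed
  then show ?thesis by (meson linorder_neqE_nat less_irrefl)
qed

section \<open>Slides on composition tableaux\<close>

text \<open>The triple condition for adjacent columns f and g, as functions of the row index with
  value 0 outside the shape. With this convention all membership conditions except that for
  \<open>g s\<close> are contained in the inequalities.\<close>

definition triple_rule :: "(nat \<Rightarrow> nat) \<Rightarrow> (nat \<Rightarrow> nat) \<Rightarrow> bool" where
  "triple_rule f g \<longleftrightarrow> (\<forall>r s. r < s \<longrightarrow> g s \<noteq> 0 \<longrightarrow> g s \<le> f r \<longrightarrow> g s < g r)"

definition inj_nonzero :: "(nat \<Rightarrow> nat) \<Rightarrow> bool" where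
  "inj_nonzero f \<longleftrightarrow> (\<forall>r s. f r \<noteq> 0 \<longrightarrow> f r = f s \<longrightarrow> r = s)"

definition pos_rows :: "tab \<Rightarrow> bool" where
  "pos_rows \<tau> \<longleftrightarrow> (\<forall>r. 1 \<le> r \<and> r \<le> length \<tau> \<longrightarrow> ent \<tau> r 1 \<noteq> 0) \<and>
     (\<forall>r c. inshape \<tau> r c \<longrightarrow> ent \<tau> r c \<noteq> 0)"

lemma inshape_ent: "pos_rows \<tau> \<Longrightarrow> inshape \<tau> r c \<longleftrightarrow> ent \<tau> r c \<noteq> 0"
  by (auto simp: pos_rows_def) (auto simp: ent_def inshape_def split: if_splits)

lemma pos_rows_iff:
  "pos_rows \<tau> \<longleftrightarrow> (\<forall>row\<in>set \<tau>. row \<noteq> [] \<and> (\<forall>x\<in>set row. 1 \<le> x))" (is "?L = ?R")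
proof
  assume L: ?L
  show ?R
  proof
    fix row assume "row \<in> set \<tau>"
    then obtain r where r: "r < length \<tau>" "row = \<tau> ! r" by (auto simp: in_set_conv_nth)
    have ne: "row \<noteq> []"
      using L[unfolded pos_rows_def, THEN conjunct1, rule_format, of "Suc r"] r by (auto simp: ent_def)
    have "1 \<le> x" if "x \<in> set row" for x
    proof -
      from that have "\<exists>k<length row. row ! k = x" by (simp add: in_set_conv_nth)
      then obtain k where k: "k < length row" "x = row ! k" by blast
      then show ?thesis
        using L[unfolded pos_rows_def, THEN conjunct2, rule_format, of "Suc r" "Suc k"] r
        by (auto simp: ent_def inshape_def)
    qed
    then show "row \<noteq> [] \<and> (\<forall>x\<in>set row. 1 \<le> x)" using ne by blast
  qed
next
  assume R: ?R
  have "ent \<tau> r c \<noteq> 0" if "inshape \<tau> r c" for r c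
  proof -
    have "\<tau> ! (r - 1) \<in> set \<tau>" "\<tau> ! (r - 1) ! (c - 1) \<in> set (\<tau> ! (r - 1))"
      using that by (auto simp: inshape_def intro!: nth_mem)
    then show ?thesis using R that by (force simp: ent_def inshape_def)
  qed
  moreover have "inshape \<tau> r 1" if "1 \<le> r \<and> r \<le> length \<tau>" for r
  proof -
    have "\<tau> ! (r - 1) \<in> set \<tau>" using that by (auto intro!: nth_mem)
    then have "\<tau> ! (r - 1) \<noteq> []" using R by blast
    then show ?thesis using that by (simp add: inshape_def Suc_le_eq)
  qed
  ultimately show ?L unfolding pos_rows_def by blast
qed

lemma sorted_wrt_ge_ent:
  assumes "pos_rows \<tau>"
  shows "(\<forall>row\<in>set \<tau>. sorted_wrt (\<ge>) row) \<longleftrightarrow> (\<forall>r. \<forall>c\<ge>1. ent \<tau> r (Suc c) \<le> ent \<tau> r c)" (is "?L = ?R")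
proof
  assume L: ?L
  show ?R
  proof (intro allI impI)
    fix r c :: nat assume c: "1 \<le> c"
    show "ent \<tau> r (Suc c) \<le> ent \<tau> r c"
    proof (cases "inshape \<tau> r (Suc c)")
      case True
      then have "sorted_wrt (\<ge>) (\<tau> ! (r - 1))" using L by (auto simp: inshape_def)
      then have "\<tau> ! (r - 1) ! c \<le> \<tau> ! (r - 1) ! (c - 1)"
        using True c unfolding sorted_wrt_iff_nth_less by (auto simp: inshape_def)
      then show ?thesis using True c by (auto simp: ent_def inshape_def)
    next
      case False
      then show ?thesis by (auto simp: ent_def inshape_def)
    qed
  qed
next
  assume R: ?R
  show ?L
  proof
    fix row assume "row \<in> set \<tau>"
    then obtain r where r: "r < length \<tau>" "row = \<tau> ! r" by (auto simp: in_set_conv_nth)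
    have "row ! Suc k \<le> row ! k" if "Suc k < length row" for k
      using R[rule_format, of "Suc k" "Suc r"] r that by (simp add: ent_def)
    then show "sorted_wrt (\<ge>) row"
      by (subst sorted_wrt_iff_nth_Suc_transp) (auto intro: transpI)
  qed
qed

lemma SSRCT_ent:
  "SSRCT \<tau> \<longleftrightarrow> pos_rows \<tau> \<and>
     (\<forall>c\<ge>1. (\<forall>r. ent \<tau> r (Suc c) \<le> ent \<tau> r c) \<and> triple_rule (\<lambda>r. ent \<tau> r c) (\<lambda>r. ent \<tau> r (Suc c))) \<and>
     (\<forall>r s. 1 \<le> r \<longrightarrow> r < s \<longrightarrow> s \<le> length \<tau> \<longrightarrow> ent \<tau> r 1 < ent \<tau> s 1)"
proof (cases "pos_rows \<tau>")
  case True
  note i = inshape_ent[OF True]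
  have e0: "ent \<tau> 0 c = 0" for c by (simp add: ent_def)
  have t: "(\<forall>r s c. 1 \<le> r \<longrightarrow> r < s \<longrightarrow> 1 \<le> c \<longrightarrow> inshape \<tau> s (Suc c) \<longrightarrow>
        inshape \<tau> r c \<longrightarrow> ent \<tau> s (Suc c) \<le> ent \<tau> r c \<longrightarrow>
        inshape \<tau> r (Suc c) \<and> ent \<tau> s (Suc c) < ent \<tau> r (Suc c)) \<longleftrightarrow>
      (\<forall>c\<ge>1. triple_rule (\<lambda>r. ent \<tau> r c) (\<lambda>r. ent \<tau> r (Suc c)))" (is "?L = ?R")
  proof
    assume L: ?L
    show ?R unfolding triple_rule_def
    proof (intro allI impI)
      fix c r s assume h: "(1::nat) \<le> c" "r < s" "ent \<tau> s (Suc c) \<noteq> 0" "ent \<tau> s (Suc c) \<le> ent \<tau> r c"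
      then have "ent \<tau> r c \<noteq> 0" by simp
      moreover from this have "1 \<le> r" by (cases r) (auto simp: e0)
      ultimately show "ent \<tau> s (Suc c) < ent \<tau> r (Suc c)" using L h i by blast
    qed
  next
    assume R: ?R
    show ?L
    proof (intro allI impI)
      fix r s c :: nat
      assume h: "1 \<le> r" "r < s" "1 \<le> c" "inshape \<tau> s (Suc c)" "inshape \<tau> r c" "ent \<tau> s (Suc c) \<le> ent \<tau> r c"
      then have "ent \<tau> s (Suc c) < ent \<tau> r (Suc c)" using R i by (auto simp: triple_rule_def)
      then show "inshape \<tau> r (Suc c) \<and> ent \<tau> s (Suc c) < ent \<tau> r (Suc c)" using i by simp
    qed
  qed
  have "(\<forall>row\<in>set \<tau>. row \<noteq> [] \<and> (\<forall>x\<in>set row. 1 \<le> x) \<and> sorted_wrt (\<ge>) row) \<longleftrightarrow>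
     (\<forall>r. \<forall>c\<ge>1. ent \<tau> r (Suc c) \<le> ent \<tau> r c)"
    using True[unfolded pos_rows_iff] sorted_wrt_ge_ent[OF True] by blast
  then show ?thesis unfolding SSRCT_def t using True by auto
next
  case False
  then show ?thesis unfolding SSRCT_def pos_rows_iff by blast
qed

text \<open>Beyond the first column, the upper of two equal entries is at most its left neighbour,
  so the triple condition would make it strictly larger than the lower one.\<close>

lemma SSRCT_inj_nonzero:
  assumes "SSRCT \<tau>" "1 \<le> c"
  shows "inj_nonzero (\<lambda>r. ent \<tau> r c)"
proof -
  have "r = s" if "ent \<tau> r c \<noteq> 0" "ent \<tau> r c = ent \<tau> s c" "r < s" for r s
  proof (cases "c = 1")
    case True
    have "1 \<le> r" "s \<le> length \<tau>" using that by (auto simp: ent_def split: if_splits)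
    then show ?thesis using assms(1) that True by (force simp: SSRCT_ent)
  next
    case False
    then obtain d where d: "c = Suc d" "1 \<le> d" using assms(2) by (cases c) auto
    have "ent \<tau> r c \<le> ent \<tau> r d" "triple_rule (\<lambda>r. ent \<tau> r d) (\<lambda>r. ent \<tau> r c)"
      using assms(1) d by (auto simp: SSRCT_ent)
    then show ?thesis using that unfolding triple_rule_def by force
  qed
  then show ?thesis unfolding inj_nonzero_def by (metis linorder_neqE_nat)
qed

section \<open>One slide along a column\<close>

lemma find_prev_None: "find_prev P r = None \<Longrightarrow> 1 \<le> k \<Longrightarrow> k < r \<Longrightarrow> \<not> P k"
  by (induction P r rule: find_prev.induct) (auto simp: less_Suc_eq split: if_splits)

lemma find_prev_Some:
  "find_prev P r = Some r' \<Longrightarrow> 1 \<le> r' \<and> r' < r \<and> P r' \<and> (\<forall>k. r' < k \<and> k < r \<longrightarrow> \<not> P k)"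
  by (induction P r rule: find_prev.induct) (auto simp: less_Suc_eq split: if_splits)

lemma ent_upd:
  assumes "inshape \<tau> r c"
  shows "ent (upd \<tau> r c v) s d = (if s = r \<and> d = c then v else ent \<tau> s d)"
  using assms by (cases "s - 1 = r - 1") (auto simp: ent_def upd_def inshape_def nth_list_update split: if_splits)

lemma length_upd: "map length (upd \<tau> r c v) = map length \<tau>"
  by (cases "r - 1 < length \<tau>") (auto simp: upd_def map_update list_update_same_conv list_update_beyond)

lemma inshape_cong:
  assumes "map length \<tau> = map length \<tau>'"
  shows "inshape \<tau> r c \<longleftrightarrow> inshape \<tau>' r c"
proof -
  have l: "length \<tau> = length \<tau>'" using assms by (metis length_map)
  have "length (\<tau> ! k) = length (\<tau>' ! k)" if "k < length \<tau>" for k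
    using assms l that by (metis nth_map)
  then show ?thesis using l by (auto simp: inshape_def)
qed

text \<open>State of a slide in column $t$: $f$ is the current column $t$ without the value $h$ in hand, which
  was picked up in row $r$; $x$ and $b$ are the columns $t-1$ and $t+1$ (for $t = 1$ there is no column
  to the left and $x = 0$ makes the conditions on it vacuous). Entries outside the shape are $0$. The
  last two conditions say that no row from $r$ on can still receive $h$, and that $h$, wherever it is put
  above row $r$, keeps the triple condition with the rows above it.\<close>

definition slide_inv :: "(nat \<Rightarrow> nat) \<Rightarrow> (nat \<Rightarrow> nat) \<Rightarrow> (nat \<Rightarrow> nat) \<Rightarrow> nat \<Rightarrow> nat \<Rightarrow> bool" where
  "slide_inv x f b h r \<longleftrightarrow> triple_rule x f \<and> triple_rule f b \<and> (\<forall>s. b s \<le> f s) \<and> inj_nonzero f \<and> h \<notin> range f \<and> h \<noteq> 0 \<and>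
     (\<forall>s\<ge>r. h < f s \<longrightarrow> h < b s) \<and> (\<forall>s<r. h \<le> x s \<longrightarrow> h < f s)"

text \<open>Every row s below r' with \<open>f s\<close> above h also has \<open>b s\<close> above
  h: from r on by the invariant, before r because r' is the nearest admissible row. If such a
  \<open>b s\<close> were at most \<open>f r'\<close>, the triple condition would give
  \<open>b s\<close> < \<open>b r'\<close> \<le> h. Both the new triple condition with the column to
  the left and the new invariant reduce to this contradiction.\<close>

lemma slide_inv_step:
  assumes ho: "slide_inv x f b h r" and r': "r' < r" "h < f r'" "b r' \<le> h"
    and bump_max: "\<forall>k. r' < k \<and> k < r \<longrightarrow> \<not> (h < f k \<and> b k \<le> h)"
  shows "slide_inv x (f(r' := h)) b (f r') r'"
proof -
  have t1: "triple_rule x f" and t2: "triple_rule f b" and bf: "\<And>s. b s \<le> f s" and inj: "inj_nonzero f"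
    and hn: "\<And>s. f s \<noteq> h" and h0: "h \<noteq> 0" and up: "\<And>s. r \<le> s \<Longrightarrow> h < f s \<Longrightarrow> h < b s"
    and dn: "\<And>s. s < r \<Longrightarrow> h \<le> x s \<Longrightarrow> h < f s"
    using ho unfolding slide_inv_def by auto
  have t1': "f s < f k" if "k < s" "f s \<noteq> 0" "f s \<le> x k" for k s using t1 that by (simp add: triple_rule_def)
  have t2': "b s < b k" if "k < s" "b s \<noteq> 0" "b s \<le> f k" for k s using t2 that by (simp add: triple_rule_def)
  have above_h: "h < b s" if "r' < s" "h < f s" for s
    using up[of s] bump_max[rule_format, of s] that by (cases "s < r") auto
  have above_fr: "f r' < b s" if "r' < s" "f r' < f s" for s
  proof (rule ccontr)
    assume n: "\<not> f r' < b s"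
    have "h < b s" using above_h[OF that(1)] that(2) r' by simp
    then have "b s < b r'" using t2'[OF that(1)] n by simp
    then show False using \<open>h < b s\<close> r' by simp
  qed
  have "triple_rule x (f(r' := h))" unfolding triple_rule_def
  proof (intro allI impI)
    fix k s assume a: "k < s" "(f(r' := h)) s \<noteq> 0" "(f(r' := h)) s \<le> x k"
    show "(f(r' := h)) s < (f(r' := h)) k"
    proof (cases "s = r'")
      case True
      then show ?thesis using dn[of k] a r' by simp
    next
      case False
      then have fs: "f s < f k" using t1'[OF a(1)] a by simp
      show ?thesis
      proof (cases "k = r'")
        case True
        have "f s < h"
        proof (rule ccontr)
          assume "\<not> f s < h"
          then have hs: "h < f s" using hn[of s] by simp
          then have "h < b s" using above_h[of s] a True by simp
          moreover have "b s < b r'" using t2'[of r' s] calculation bf[of s] fs True a by simp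
          ultimately show False using r' by simp
        qed
        then show ?thesis using True False by simp
      qed (use False fs in simp)
    qed
  qed
  moreover have "triple_rule (f(r' := h)) b" unfolding triple_rule_def
    using t2' r' by (auto split: if_splits)
  moreover have "inj_nonzero (f(r' := h))" using inj hn hn[symmetric] by (auto simp: inj_nonzero_def)
  moreover have "f r' \<notin> range (f(r' := h))" using inj r' by (auto simp: inj_nonzero_def split: if_splits)
  moreover have "f r' < b s" if "r' \<le> s" "f r' < (f(r' := h)) s" for s
    using above_fr[of s] that r' by (auto split: if_splits)
  moreover have "f r' < (f(r' := h)) s" if "s < r'" "f r' \<le> x s" for s
    using t1'[OF that(1)] that r' by simp
  ultimately show ?thesis using bf r' unfolding slide_inv_def by simp
qed

text \<open>A call of \<open>slide\<close> updates only rows above r; row r and those below it are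
  left to its callers, and f holds what they write. Hence g combines the two. The last conjunct is
  what the failed search leaves behind: it gives the balance of e and, later, the triple condition
  for the appended row.\<close>

lemma slide_properties:
  assumes "slide \<tau> t r = (\<tau>', e)" "pos_rows \<tau>" "1 \<le> t"
    "slide_inv x f (\<lambda>s. ent \<tau> s (Suc t)) (ent \<tau> r t) r" "\<forall>s<r. f s = ent \<tau> s t"
  defines "g \<equiv> \<lambda>s. if s < r then ent \<tau>' s t else f s"
  shows "map length \<tau>' = map length \<tau> \<and> (\<forall>s c. c \<noteq> t \<or> r \<le> s \<longrightarrow> ent \<tau>' s c = ent \<tau> s c) \<and>
    triple_rule x g \<and> triple_rule g (\<lambda>s. ent \<tau> s (Suc t)) \<and> (\<forall>s. ent \<tau> s (Suc t) \<le> g s) \<and> (\<forall>s. g s \<le> f s) \<and>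
    (\<forall>s. f s \<noteq> 0 \<longrightarrow> g s \<noteq> 0) \<and> inj_nonzero g \<and> e \<noteq> 0 \<and> e \<notin> range g \<and>
    insert e (range g) = insert (ent \<tau> r t) (range f) \<and> (\<forall>s. e \<le> g s \<longrightarrow> e < ent \<tau> s (Suc t))"
  using assms(1-5) unfolding g_def
proof (induction \<tau> t r arbitrary: \<tau>' e f rule: slide.induct)
  case (1 \<tau> t r)
  define h where "h = ent \<tau> r t"
  define b where "b = (\<lambda>s. ent \<tau> s (Suc t))"
  let ?P = "\<lambda>r'. h < ent \<tau> r' t \<and> ent \<tau> r' (Suc t) \<le> h"
  have ho: "slide_inv x f b h r" using 1(5) by (simp add: h_def b_def)
  have fe: "\<And>s. s < r \<Longrightarrow> f s = ent \<tau> s t" using 1(6) by simp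
  show ?case
  proof (cases "find_prev ?P r")
    case None
    then have "slide \<tau> t r = (\<tau>, h)" by (subst slide.simps) (simp add: Let_def h_def)
    then have eq: "\<tau>' = \<tau>" "e = h" using 1(2) by auto
    have g': "(if s < r then ent \<tau> s t else f s) = f s" for s using fe by auto
    have "h < b s" if "h \<le> f s" for s
    proof -
      have fs: "h < f s" using that ho unfolding slide_inv_def by (metis le_neq_implies_less rangeI)
      show ?thesis
      proof (cases "r \<le> s")
        case True
        then show ?thesis using ho fs by (auto simp: slide_inv_def)
      next
        case False
        moreover have "1 \<le> s" using fs fe[of s] False by (cases s) (auto simp: ent_def)
        ultimately show ?thesis using find_prev_None[OF None, of s] fs fe[of s] by (simp add: b_def)
      qed
    qed
    then show ?thesis unfolding eq g' using ho unfolding slide_inv_def b_def h_def by auto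
  next
    case (Some r')
    note fp = find_prev_Some[OF Some]
    obtain \<tau>2 e2 where s2: "slide \<tau> t r' = (\<tau>2, e2)" by fastforce
    then have "slide \<tau> t r = (upd \<tau>2 r' t h, e2)"
      using Some by (subst slide.simps) (simp add: Let_def h_def)
    then have eq: "\<tau>' = upd \<tau>2 r' t h" "e = e2" using 1(2) by auto
    have bump_fresh': "f r' = ent \<tau> r' t" using fe fp by simp
    have ho': "slide_inv x (f(r' := h)) b (f r') r'"
      using slide_inv_step[OF ho, of r'] fp fe by (auto simp: b_def)
    have ho2: "slide_inv x (f(r' := h)) (\<lambda>s. ent \<tau> s (Suc t)) (ent \<tau> r' t) r'"
      using ho' unfolding b_def bump_fresh' .
    have fe2: "\<forall>s<r'. (f(r' := h)) s = ent \<tau> s t" using fe fp by auto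
    define G where "G = (\<lambda>s. if s < r' then ent \<tau>2 s t else (f(r' := h)) s)"
    have IH: "map length \<tau>2 = map length \<tau> \<and> (\<forall>s c. c \<noteq> t \<or> r' \<le> s \<longrightarrow> ent \<tau>2 s c = ent \<tau> s c) \<and>
    triple_rule x G \<and> triple_rule G (\<lambda>s. ent \<tau> s (Suc t)) \<and>
    (\<forall>s. ent \<tau> s (Suc t) \<le> G s) \<and>
    (\<forall>s. G s \<le> (f(r' := h)) s) \<and>
    (\<forall>s. (f(r' := h)) s \<noteq> 0 \<longrightarrow> G s \<noteq> 0) \<and>
    inj_nonzero G \<and> e2 \<noteq> 0 \<and>
    e2 \<notin> range G \<and>
    insert e2 (range G) = insert (ent \<tau> r' t) (range (f(r' := h))) \<and>
    (\<forall>s. e2 \<le> G s \<longrightarrow> e2 < ent \<tau> s (Suc t))"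
      unfolding G_def by (rule 1(1)[OF h_def Some s2 1(3,4) ho2 fe2])
    have ish: "inshape \<tau>2 r' t"
      using inshape_cong[of \<tau>2 \<tau>] IH inshape_ent[OF 1(3), of r' t] fp by auto
    have eu: "ent \<tau>' s d = (if s = r' \<and> d = t then h else ent \<tau>2 s d)" for s d
      unfolding eq by (rule ent_upd[OF ish])
    have g: "(\<lambda>s. if s < r then ent \<tau>' s t else f s) = G"
      using fp IH fe by (auto simp: eu G_def fun_eq_iff)
    have rg: "insert (ent \<tau> r' t) (range (f(r' := h))) = insert h (range f)"
      unfolding bump_fresh'[symmetric] by (auto simp: image_iff split: if_splits)
    have h0: "h \<noteq> 0" "h \<le> f r'" using ho fp bump_fresh' by (auto simp: slide_inv_def)
    have le: "G s \<le> (f(r' := h)) s" and nz: "(f(r' := h)) s \<noteq> 0 \<longrightarrow> G s \<noteq> 0" for s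
      using IH by blast+
    have "G s \<le> f s" for s using le[of s] h0(2) by (cases "s = r'") simp_all
    moreover have "f s \<noteq> 0 \<longrightarrow> G s \<noteq> 0" for s using nz[of s] h0(1) by (cases "s = r'") simp_all
    moreover have "map length \<tau>' = map length \<tau>" using IH length_upd eq by metis
    moreover have "\<forall>s c. c \<noteq> t \<or> r \<le> s \<longrightarrow> ent \<tau>' s c = ent \<tau> s c" using IH fp by (auto simp: eu)
    moreover have "(if s < r then ent \<tau>' s t else f s) = G s" for s using fun_cong[OF g, of s] by simp
    ultimately show ?thesis unfolding g eq(2) h_def[symmetric] rg[symmetric] using IH by simp
  qed
qed

section \<open>Removal of the last box of a row, and columns as sets\<close>

lemma ent_del_box:
  assumes "1 \<le> r" "r \<le> length \<tau>" "length (\<tau> ! (r - 1)) = t" "1 \<le> t"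
  shows "2 \<le> t \<Longrightarrow> ent (del_box \<tau> r) s c = (if s = r \<and> c = t then 0 else ent \<tau> s c)"
    and "2 \<le> t \<Longrightarrow> length (del_box \<tau> r) = length \<tau>"
    and "t = 1 \<Longrightarrow> ent (del_box \<tau> r) s c = ent \<tau> (if s < r then s else Suc s) c"
    and "t = 1 \<Longrightarrow> Suc (length (del_box \<tau> r)) = length \<tau>"
proof -
  have l: "length (butlast (\<tau> ! (r - 1))) = t - 1" using assms by simp
  { assume t: "2 \<le> t"
    then have "0 < length (butlast (\<tau> ! (r - 1)))" using l by simp
    then have "butlast (\<tau> ! (r - 1)) \<noteq> []" by (metis length_greater_0_conv)
    then have d: "del_box \<tau> r = \<tau>[r - 1 := butlast (\<tau> ! (r - 1))]" by (simp add: del_box_def)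
    show "length (del_box \<tau> r) = length \<tau>" by (simp add: d)
    show "ent (del_box \<tau> r) s c = (if s = r \<and> c = t then 0 else ent \<tau> s c)"
    proof (cases "s = r")
      case True
      have "r - 1 < length \<tau>" using assms by simp
      then show ?thesis using True assms unfolding d ent_def by (auto intro!: nth_butlast, arith)
    next
      case False
      then have "s = 0 \<or> s - 1 \<noteq> r - 1" using assms by auto
      then show ?thesis using False unfolding d ent_def by auto
    qed }
  { assume t: "t = 1"
    then have "length (butlast (\<tau> ! (r - 1))) = 0" using l by simp
    then have "butlast (\<tau> ! (r - 1)) = []" by (metis length_0_conv)
    then have d: "del_box \<tau> r = take (r - 1) \<tau> @ drop r \<tau>" by (simp add: del_box_def)
    show "Suc (length (del_box \<tau> r)) = length \<tau>" using assms by (simp add: d)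
    show "ent (del_box \<tau> r) s c = ent \<tau> (if s < r then s else Suc s) c"
    proof (cases "s < r")
      case True
      then have "s = 0 \<or> s - 1 < r - 1" by auto
      then show ?thesis using True assms unfolding d ent_def by (auto simp: nth_append)
    next
      case False
      then have "drop r \<tau> ! (s - 1 - (r - 1)) = \<tau> ! s" if "s < length \<tau>"
        using that assms by (auto simp: add.commute)
      then show ?thesis using False assms unfolding d ent_def by (auto simp: nth_append)
    qed }
qed

lemma pos_rows_del_box: "pos_rows \<tau> \<Longrightarrow> pos_rows (del_box \<tau> r)"
  unfolding pos_rows_iff
proof
  fix row
  assume p: "\<forall>row\<in>set \<tau>. row \<noteq> [] \<and> (\<forall>x\<in>set row. 1 \<le> x)" and m: "row \<in> set (del_box \<tau> r)"
  show "row \<noteq> [] \<and> (\<forall>x\<in>set row. 1 \<le> x)"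
  proof (cases "row \<in> set \<tau>")
    case False
    have b: "butlast (\<tau> ! (r - 1)) \<noteq> []" and d: "row \<in> set (\<tau>[r - 1 := butlast (\<tau> ! (r - 1))])"
      using m False by (auto simp: del_box_def split: if_splits dest: in_set_takeD in_set_dropD)
    then have r: "row = butlast (\<tau> ! (r - 1))" "r - 1 < length \<tau>"
      using False set_update_subset_insert[of \<tau> "r - 1"] by (auto simp: list_update_beyond not_less[symmetric])
        (metis list_update_beyond not_less)
    then have "\<tau> ! (r - 1) \<in> set \<tau>" by simp
    from bspec[OF p this] show ?thesis using b unfolding r(1) by (auto dest: in_set_butlastD)
  qed (use p in blast)
qed

lemma col_set_ent:
  assumes "pos_rows \<tau>" "1 \<le> c"
  shows "col_set \<tau> c = range (\<lambda>r. ent \<tau> r c) - {0}"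
proof -
  have "col_set \<tau> c = (\<lambda>r. \<tau> ! r ! (c - 1)) ` {r. r < length \<tau> \<and> c \<le> length (\<tau> ! r)}"
    using assms(2) by (simp add: col_set_def col_eq)
  also have "\<dots> = (\<lambda>r. ent \<tau> (Suc r) c) ` {r. inshape \<tau> (Suc r) c}"
    by (rule image_cong) (use assms(2) in \<open>auto simp: ent_def inshape_def\<close>)
  also have "\<dots> = range (\<lambda>r. ent \<tau> r c) - {0}"
  proof (rule equalityI; rule subsetI)
    fix v assume "v \<in> range (\<lambda>r. ent \<tau> r c) - {0}"
    then obtain r where r: "v = ent \<tau> r c" "ent \<tau> r c \<noteq> 0" by auto
    moreover from r(2) have "r = Suc (r - 1)" by (cases r) (auto simp: ent_def)
    ultimately show "v \<in> (\<lambda>r. ent \<tau> (Suc r) c) ` {r. inshape \<tau> (Suc r) c}"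
      using inshape_ent[OF assms(1), of r c] by (intro image_eqI[of _ _ "r - 1"]) auto
  qed (use inshape_ent[OF assms(1)] in auto)
  finally show ?thesis .
qed

lemma card_above_range: "inj_nonzero f \<Longrightarrow> card_above (range f - {0}) u = card {s. u < f s}"
proof -
  assume i: "inj_nonzero f"
  have "{r \<in> range f - {0}. u < r} = f ` {s. u < f s}" by auto
  moreover have "inj_on f {s. u < f s}" using i by (auto simp: inj_on_def inj_nonzero_def)
  ultimately show ?thesis by (simp add: card_above_def card_image)
qed

lemma finite_ent: "finite {s. u < ent \<tau> s c}"
  by (rule finite_subset[of _ "{..length \<tau>}"]) (auto simp: ent_def split: if_splits)

lemma col_set_card_above_mono:
  assumes "SSRCT \<tau>" "1 \<le> c"
  shows "card_above (col_set \<tau> (Suc c)) u \<le> card_above (col_set \<tau> c) u"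
proof -
  have p: "pos_rows \<tau>" and le: "\<And>r. ent \<tau> r (Suc c) \<le> ent \<tau> r c" using assms by (auto simp: SSRCT_ent)
  show ?thesis
    using card_above_range[OF SSRCT_inj_nonzero[OF assms(1), of c]] card_above_range[OF SSRCT_inj_nonzero[OF assms(1), of "Suc c"]]
      assms(2) finite_ent[of u \<tau> c] le
    by (auto simp: col_set_ent[OF p] intro!: card_mono intro: less_le_trans)
qed

lemma col_set_pos: "pos_rows \<tau> \<Longrightarrow> 1 \<le> c \<Longrightarrow> card (col_set \<tau> c) = card_above (col_set \<tau> c) 0"
  unfolding card_above_def by (rule arg_cong[where f=card]) (auto simp: col_set_ent)

lemma finite_col_set: "finite (col_set \<tau> c)"
  by (simp add: col_set_def)

lemma row_exists:
  assumes "SSRCT \<tau>" "1 \<le> t" "card (col_set \<tau> (Suc t)) < card (col_set \<tau> t)"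
  shows "\<exists>r. 1 \<le> r \<and> r \<le> length \<tau> \<and> length (\<tau> ! (r - 1)) = t"
proof -
  have p: "pos_rows \<tau>" using assms by (simp add: SSRCT_ent)
  have "card {s. 0 < ent \<tau> s (Suc t)} < card {s. 0 < ent \<tau> s t}"
    using card_above_range[OF SSRCT_inj_nonzero[OF assms(1), of t], of 0] card_above_range[OF SSRCT_inj_nonzero[OF assms(1), of "Suc t"], of 0]
      col_set_pos[OF p, of t] col_set_pos[OF p, of "Suc t"] assms(2,3) by (simp add: col_set_ent[OF p])
  then have "\<not> {s. 0 < ent \<tau> s t} \<subseteq> {s. 0 < ent \<tau> s (Suc t)}"
    using card_mono[OF finite_ent[of 0 \<tau> "Suc t"]] by (meson not_le)
  then obtain s where "0 < ent \<tau> s t" "\<not> 0 < ent \<tau> s (Suc t)" by auto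
  then have "inshape \<tau> s t" "\<not> inshape \<tau> s (Suc t)" using inshape_ent[OF p] by auto
  then show ?thesis by (intro exI[of _ s]) (auto simp: inshape_def)
qed

lemma exchange_set:
  assumes "insert e G = insert h F" "e \<notin> G" "\<And>v. v \<noteq> 0 \<Longrightarrow> v \<in> F \<or> v = h \<longleftrightarrow> v \<in> A"
  shows "G - {0} = (A - {0}) - {e :: nat}"
proof (rule set_eqI)
  fix v
  have "v \<in> insert e G \<longleftrightarrow> v \<in> insert h F" by (simp only: assms(1))
  then show "v \<in> G - {0} \<longleftrightarrow> v \<in> (A - {0}) - {e}" using assms(2) assms(3)[of v] by auto
qed

text \<open>After e has left, column t still dominates column t + 1 row by row. So above any u < e
  the full column t has at least one entry more, namely e, while above e itself the final condition
  of the slide gives equality. The last two conclusions serve to carry that condition through the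
  later slides.\<close>

lemma phi_main:
  assumes ss: "SSRCT \<tau>" and t: "1 \<le> t"
    and ex: "\<exists>r. 1 \<le> r \<and> r \<le> length \<tau> \<and> length (\<tau> ! (r - 1)) = t"
    and ph: "phi_succ t \<tau> = (\<tau>1, e)"
  shows "SSRCT \<tau>1" "e \<noteq> 0" "balanced_min (col_set \<tau> t) (col_set \<tau> (Suc t)) e"
    "\<And>c. 1 \<le> c \<Longrightarrow> col_set \<tau>1 c = (if c = t then col_set \<tau> t - {e} else col_set \<tau> c)"
    "\<And>r. \<exists>r'. \<forall>c>t. ent \<tau>1 r c = ent \<tau> r' c"
    "\<And>r. e \<le> ent \<tau>1 r t \<Longrightarrow> e < ent \<tau>1 r (Suc t)"
proof -
  have pos: "pos_rows \<tau>" and dec: "\<And>c r. 1 \<le> c \<Longrightarrow> ent \<tau> r (Suc c) \<le> ent \<tau> r c"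
    and tr: "\<And>c. 1 \<le> c \<Longrightarrow> triple_rule (\<lambda>r. ent \<tau> r c) (\<lambda>r. ent \<tau> r (Suc c))"
    and fc: "\<And>r s. 1 \<le> r \<Longrightarrow> r < s \<Longrightarrow> s \<le> length \<tau> \<Longrightarrow> ent \<tau> r 1 < ent \<tau> s 1"
    using ss by (auto simp: SSRCT_ent)
  note ish = inshape_ent[OF pos]
  define r where "r = Max {r. 1 \<le> r \<and> r \<le> length \<tau> \<and> length (\<tau> ! (r - 1)) = t}"
  have finr: "finite {r. 1 \<le> r \<and> r \<le> length \<tau> \<and> length (\<tau> ! (r - 1)) = t}" by simp
  have "r \<in> {r. 1 \<le> r \<and> r \<le> length \<tau> \<and> length (\<tau> ! (r - 1)) = t}"
    unfolding r_def by (rule Max_in[OF finr]) (use ex in blast)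
  then have r: "1 \<le> r" "r \<le> length \<tau>" "length (\<tau> ! (r - 1)) = t" by auto
  have rmax: "s \<le> r" if "1 \<le> s" "s \<le> length \<tau>" "length (\<tau> ! (s - 1)) = t" for s
    unfolding r_def using that by (intro Max_ge[OF finr]) simp
  obtain \<tau>' where sl: "slide \<tau> t r = (\<tau>', e)" and \<tau>1: "\<tau>1 = del_box \<tau>' r"
    using ph by (auto simp: phi_succ_def r_def Let_def split: prod.splits)
  define x where "x s = (if t = 1 then 0 else ent \<tau> s (t - 1))" for s
  define a where "a = (\<lambda>s. ent \<tau> s t)"
  define b where "b = (\<lambda>s. ent \<tau> s (Suc t))"
  \<comment> \<open>The box of row r will be deleted, hence the value 0.\<close>
  define f where "f = a(r := 0)"
  have ar: "a r \<noteq> 0" "b r = 0" using ish[of r t] ish[of r "Suc t"] r t by (auto simp: a_def b_def inshape_def)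
  have ba: "b s \<le> a s" for s using dec[OF t] by (simp add: a_def b_def)
  have ia: "inj_nonzero a" using SSRCT_inj_nonzero[OF ss t] by (simp add: a_def)
  have ib: "inj_nonzero b" using SSRCT_inj_nonzero[OF ss, of "Suc t"] by (simp add: b_def)
  have tab: "b s < b k" if "k < s" "b s \<noteq> 0" "b s \<le> a k" for k s
    using tr[OF t] that by (simp add: triple_rule_def a_def b_def)
  have txa: "a s < a k" if "k < s" "a s \<noteq> 0" "a s \<le> x k" for k s
  proof (cases "t = 1")
    case False
    then have "triple_rule (\<lambda>r. ent \<tau> r (t - 1)) a" using tr[of "t - 1"] t by (simp add: a_def)
    then show ?thesis using that False by (simp add: triple_rule_def x_def)
  qed (use that in \<open>simp add: x_def\<close>)
  \<comment> \<open>As r is the last row of length t, later rows reaching column t go on to column t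
    + 1. Since \<open>b r\<close> = 0, the triple condition then makes their entries there exceed
    \<open>a r\<close>, which starts the invariant.\<close>
  have below: "b s \<noteq> 0" if "r < s" "a s \<noteq> 0" for s
    using that ish[of s t] ish[of s "Suc t"] rmax[of s] by (auto simp: a_def b_def inshape_def)
  have below2: "a r < b s" if "r < s" "a s \<noteq> 0" for s
    using below[OF that] tab[of r s] ar that by (metis leI not_less_zero)
  have ho: "slide_inv x f b (a r) r" unfolding slide_inv_def
  proof (intro conjI allI impI)
    show "triple_rule x f" unfolding triple_rule_def
    proof (intro allI impI)
      fix k s assume h: "k < s" "f s \<noteq> 0" "f s \<le> x k"
      then have s: "s \<noteq> r" "f s = a s" by (auto simp: f_def split: if_splits)
      then have l: "a s < a k" using txa[of k s] h by simp
      have "k \<noteq> r" using below2[of s] ba[of s] l h s by force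
      then show "f s < f k" using l s by (simp add: f_def)
    qed
    show "triple_rule f b" unfolding triple_rule_def using tab by (auto simp: f_def split: if_splits)
    show "b s \<le> f s" for s using ba ar by (simp add: f_def)
    show "inj_nonzero f" using ia by (auto simp: inj_nonzero_def f_def)
    show "a r \<notin> range f" using ia ar by (auto simp: inj_nonzero_def f_def split: if_splits)
    show "a r \<noteq> 0" by (rule ar)
    fix s
    show "a r < b s" if "r \<le> s" "a r < f s" using that below2[of s] by (cases "s = r") (auto simp: f_def)
    show "a r < f s" if "s < r" "a r \<le> x s" using txa[of s r] that ar by (simp add: f_def)
  qed
  define g where "g = (\<lambda>s. if s < r then ent \<tau>' s t else f s)"
  have SL: "map length \<tau>' = map length \<tau>" "\<And>s c. c \<noteq> t \<or> r \<le> s \<Longrightarrow> ent \<tau>' s c = ent \<tau> s c"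
    "triple_rule x g" "triple_rule g b" "\<And>s. b s \<le> g s" "\<And>s. g s \<le> f s" "\<And>s. f s \<noteq> 0 \<Longrightarrow> g s \<noteq> 0" "inj_nonzero g"
    "e \<noteq> 0" "e \<notin> range g" "insert e (range g) = insert (a r) (range f)" "\<And>s. e \<le> g s \<Longrightarrow> e < b s"
    using slide_properties[OF sl pos t, of x f] ho by (auto simp: a_def b_def f_def g_def)
  have lt: "length \<tau>' = length \<tau>" using SL(1) by (metis length_map)
  have r': "r \<le> length \<tau>'" "length (\<tau>' ! (r - 1)) = t"
  proof -
    show "r \<le> length \<tau>'" using lt r by simp
    have "r - 1 < length \<tau>" using r by simp
    then show "length (\<tau>' ! (r - 1)) = t" using SL(1) lt r(3) by (metis nth_map)
  qed
  define al where "al c s = (if c = t then g s else ent \<tau> s c)" for c s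
  \<comment> \<open>For t = 1 row r disappears and later rows move up; q translates row indices of
    the result back into those before the deletion.\<close>
  define q where "q s = (if t = 1 \<and> r \<le> s then Suc s else s)" for s
  have q: "strict_mono q" by (rule strict_monoI) (auto simp: q_def)
  have e1: "ent \<tau>1 s c = al c (q s)" if "1 \<le> c" for s c
  proof (cases "t = 1")
    case True
    then show ?thesis using ent_del_box(3)[OF r(1) r' t True, of s c] SL(2) that
      by (auto simp: \<tau>1 al_def q_def g_def f_def a_def)
  next
    case False
    then show ?thesis using ent_del_box(1)[OF r(1) r' t, of s c] SL(2) t that
      by (auto simp: \<tau>1 al_def q_def g_def f_def a_def)
  qed
  have rq: "s \<in> range q" if "al c s \<noteq> 0" "1 \<le> c" for s c
  proof (cases "t = 1 \<and> r \<le> s")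
    case True
    have "s \<noteq> r"
    proof
      assume "s = r"
      then show False using that True ish[of r c] r SL(6)[of r] by (auto simp: al_def inshape_def f_def split: if_splits)
    qed
    then have "s = q (s - 1)" using True r by (auto simp: q_def)
    then show ?thesis by (rule range_eqI)
  next
    case False
    then have "s = q s" by (auto simp: q_def)
    then show ?thesis by (rule range_eqI)
  qed
  have pos': "pos_rows \<tau>'" unfolding pos_rows_def
  proof (intro conjI allI impI)
    have nz: "ent \<tau>' s c \<noteq> 0" if "ent \<tau> s c \<noteq> 0" for s c
    proof (cases "c = t \<and> s < r")
      case True
      then have "f s \<noteq> 0" using that by (simp add: f_def a_def)
      then show ?thesis using SL(7)[of s] True by (simp add: g_def)
    next
      case False
      then show ?thesis using SL(2)[of c s] that by auto
    qed
    show "ent \<tau>' s c \<noteq> 0" if "inshape \<tau>' s c" for s c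
      using nz[of s c] ish[of s c] that inshape_cong[OF SL(1)] by simp
    show "ent \<tau>' s 1 \<noteq> 0" if "1 \<le> s \<and> s \<le> length \<tau>'" for s
      using nz[of s 1] that pos SL(1) by (metis length_map pos_rows_def)
  qed
  have pos1: "pos_rows \<tau>1" using pos_rows_del_box[OF pos'] \<tau>1 by simp
  have ga: "g s \<le> a s" for s using SL(6)[of s] by (auto simp: f_def split: if_splits)
  have adec: "al (Suc c) s \<le> al c s" if "1 \<le> c" for c s
  proof -
    show ?thesis using ga[of s] dec[OF that, of s] SL(5)[of s] by (auto simp: al_def a_def b_def)
  qed
  have atr: "triple_rule (al c) (al (Suc c))" if c: "1 \<le> c" for c
  proof -
    consider "c = t" | "Suc c = t" | "c \<noteq> t" "Suc c \<noteq> t" by blast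
    then show ?thesis
    proof cases
      case 1
      then have "al c = g" "al (Suc c) = b" by (auto simp: al_def b_def)
      then show ?thesis using SL(4) by simp
    next
      case 2
      then have "al c = x" "al (Suc c) = g" using c by (auto simp: al_def x_def)
      then show ?thesis using SL(3) by simp
    next
      case 3
      then show ?thesis using tr[OF c] by (simp add: al_def[abs_def])
    qed
  qed
  show ss1: "SSRCT \<tau>1" unfolding SSRCT_ent
  proof (intro conjI allI impI)
    show "pos_rows \<tau>1" by (rule pos1)
    fix c :: nat assume c: "1 \<le> c"
    show "ent \<tau>1 s (Suc c) \<le> ent \<tau>1 s c" for s using adec[OF c] c by (simp add: e1)
    show "triple_rule (\<lambda>r. ent \<tau>1 r c) (\<lambda>r. ent \<tau>1 r (Suc c))"
      using atr[OF c] c q by (auto simp: e1 triple_rule_def strict_mono_less)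
  next
    fix k s assume ks: "1 \<le> k" "k < s" "s \<le> length \<tau>1"
    show "ent \<tau>1 k 1 < ent \<tau>1 s 1"
    proof (cases "t = 1")
      case False
      then show ?thesis using fc[of k s] ks ent_del_box(2)[OF r(1) r' t] lt t
        unfolding e1[OF order_refl] by (simp add: al_def q_def \<tau>1)
    next
      case True
      \<comment> \<open>The first column increases downwards, so for t = 1 no row above r has a
        larger entry and nothing is moved.\<close>
      have "find_prev (\<lambda>r'. ent \<tau> r t < ent \<tau> r' t \<and> ent \<tau> r' (Suc t) \<le> ent \<tau> r t) r = None"
      proof (rule ccontr)
        assume "\<not> ?thesis"
        then obtain r' where "find_prev (\<lambda>r'. ent \<tau> r t < ent \<tau> r' t \<and> ent \<tau> r' (Suc t) \<le> ent \<tau> r t) r = Some r'" by auto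
        then show False using find_prev_Some fc[of r' r] r True by fastforce
      qed
      then have "slide \<tau> t r = (\<tau>, ent \<tau> r t)" by (subst slide.simps) (simp add: Let_def)
      then have "\<tau>' = \<tau>" using sl by simp
      then have "ent \<tau>1 j 1 = ent \<tau> (q j) 1" for j
        using ent_del_box(3)[OF r(1) r' t True, of j 1] True by (auto simp: \<tau>1 q_def)
      moreover have "1 \<le> q k" "q k < q s" "q s \<le> length \<tau>"
        using ks q ent_del_box(4)[OF r(1) r' t True] lt by (auto simp: strict_mono_less \<tau>1 q_def)
      ultimately show ?thesis using fc by simp
    qed
  qed
  show "e \<noteq> 0" by (rule SL)
  have C1: "col_set \<tau>1 c = range (al c) - {0}" if c: "1 \<le> c" for c
    unfolding col_set_ent[OF pos1 c] using rq[OF _ c] by (auto simp: e1[OF c])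
  have gset: "range g - {0} = (range a - {0}) - {e}"
    by (rule exchange_set[OF SL(11,10)]) (auto simp: f_def image_iff)
  have Ct: "col_set \<tau> t = range a - {0}" and CS: "col_set \<tau> (Suc t) = range b - {0}"
    using col_set_ent[OF pos] t by (auto simp: a_def b_def)
  show C: "col_set \<tau>1 c = (if c = t then col_set \<tau> t - {e} else col_set \<tau> c)" if c: "1 \<le> c" for c
    using C1[OF c] gset Ct col_set_ent[OF pos c] by (auto simp: al_def[abs_def])
  show "\<exists>r'. \<forall>c>t. ent \<tau>1 s c = ent \<tau> r' c" for s
    using e1 t by (intro exI[of _ "q s"]) (auto simp: al_def)
  show "e < ent \<tau>1 s (Suc t)" if "e \<le> ent \<tau>1 s t" for s
    using that SL(12)[of "q s"] t by (simp add: e1 al_def b_def)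
  have eA: "e \<in> col_set \<tau> t"
  proof -
    have "e \<in> insert (a r) (range f)" using SL(11) by blast
    then show ?thesis using SL(9) by (auto simp: Ct f_def split: if_splits)
  qed
  have gA: "card_above (col_set \<tau> t) u = card {s. u < g s} + (if u < e then 1 else 0)" for u
    using card_above_remove[OF finite_col_set eA, of u] card_above_range[OF SL(8), of u] gset Ct by simp
  have gB: "card_above (col_set \<tau> (Suc t)) u = card {s. u < b s}" for u
    using card_above_range[OF ib] CS by simp
  have "{s. e < g s} = {s. e < b s}" using SL(5,12) by (auto intro: less_le_trans less_imp_le)
  then have "card_above (col_set \<tau> t) e = card_above (col_set \<tau> (Suc t)) e" by (simp add: gA gB)
  moreover have "card_above (col_set \<tau> t) u \<noteq> card_above (col_set \<tau> (Suc t)) u" if "u < e" for u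
  proof -
    have "finite {s. u < g s}"
    proof (rule finite_subset)
      show "{s. u < g s} \<subseteq> {s. u < ent \<tau> s t}"
        using less_le_trans[OF _ ga] by (auto simp: a_def)
    qed (rule finite_ent)
    then have "card {s. u < b s} \<le> card {s. u < g s}"
      using SL(5) by (intro card_mono) (auto intro: less_le_trans)
    then show ?thesis using that by (simp add: gA gB)
  qed
  ultimately show "balanced_min (col_set \<tau> t) (col_set \<tau> (Suc t)) e" using eA by (simp add: balanced_min_def)
qed

text \<open>The slides run from column i - 1 to column 1, so \<open>e (Suc c)\<close> has already
  left when \<open>e c\<close> is found; this is the origin of \<open>col_rest\<close>. A later
  slide leaves the columns further right alone up to a renumbering of rows, which is why the final
  condition of each slide survives and why r' is existential.\<close>

lemma phis_main:
  assumes "1 \<le> i" "SSRCT \<tau>" "2 \<le> i \<longrightarrow> card (col_set \<tau> i) < card (col_set \<tau> (i - 1))" "phis i \<tau> = (\<tau>', H)"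
  shows "\<exists>e. SSRCT \<tau>' \<and> H = map e (rev [1..<i]) \<and>
    (\<forall>c. 1 \<le> c \<and> c < i \<longrightarrow> balanced_min (col_set \<tau> c) (col_rest (col_set \<tau>) e i (Suc c)) (e c) \<and> e c \<noteq> 0) \<and>
    (\<forall>c\<ge>1. col_set \<tau>' c = col_rest (col_set \<tau>) e i c) \<and>
    (\<forall>c. 1 \<le> c \<and> Suc c < i \<longrightarrow> e (Suc c) \<le> e c) \<and>
    (\<forall>r. \<exists>r'. \<forall>c\<ge>i. ent \<tau>' r c = ent \<tau> r' c) \<and>
    (\<forall>r c. 1 \<le> c \<and> c < i \<longrightarrow> e c \<le> ent \<tau>' r c \<longrightarrow> e c < ent \<tau>' r (Suc c))"
  using assms
proof (induction i \<tau> arbitrary: \<tau>' H rule: phis.induct)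
  case (1 \<tau>)
  then show ?case by simp
next
  case (2 \<tau>)
  then show ?case by (auto simp: col_rest_def)
next
  case (3 j \<tau>)
  define t where "t = Suc j"
  have t: "1 \<le> t" by (simp add: t_def)
  have ss: "SSRCT \<tau>" using 3 by simp
  have cd: "card (col_set \<tau> (Suc t)) < card (col_set \<tau> t)" using 3(4) by (simp add: t_def)
  obtain \<tau>1 e1 where ph: "phi_succ t \<tau> = (\<tau>1, e1)" by fastforce
  obtain \<tau>2 H2 where ps: "phis t \<tau>1 = (\<tau>2, H2)" by fastforce
  have eq: "\<tau>' = \<tau>2" "H = e1 # H2" using 3(5) ph ps by (auto simp: t_def)
  note pm = phi_main[OF ss t row_exists[OF ss t cd] ph]
  have eA: "e1 \<in> col_set \<tau> t" using pm(3) by (simp add: balanced_min_def)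
  have C1: "col_set \<tau>1 c = col_set \<tau> c" if "1 \<le> c" "c \<noteq> t" for c using pm(4)[OF that(1)] that by simp
  have C1t: "col_set \<tau>1 t = col_set \<tau> t - {e1}" using pm(4)[OF t] by simp
  have cd1: "2 \<le> t \<longrightarrow> card (col_set \<tau>1 t) < card (col_set \<tau>1 (t - 1))"
  proof
    assume that: "2 \<le> t"
    have "card (col_set \<tau>1 t) < card (col_set \<tau> t)" using C1t eA finite_col_set by (metis card_Diff1_less)
    also have "\<dots> \<le> card (col_set \<tau> (t - 1))"
      using col_set_card_above_mono[OF ss, of "t - 1" 0] col_set_pos[of \<tau> t] col_set_pos[of \<tau> "t - 1"] ss that
      by (simp add: SSRCT_ent)
    also have "\<dots> = card (col_set \<tau>1 (t - 1))" using C1[of "t - 1"] that by simp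
    finally show "card (col_set \<tau>1 t) < card (col_set \<tau>1 (t - 1))" .
  qed
  obtain e' where E: "SSRCT \<tau>2" "H2 = map e' (rev [1..<t])"
    "\<And>c. 1 \<le> c \<and> c < t \<Longrightarrow> balanced_min (col_set \<tau>1 c) (col_rest (col_set \<tau>1) e' t (Suc c)) (e' c) \<and> e' c \<noteq> 0"
    "\<And>c. 1 \<le> c \<Longrightarrow> col_set \<tau>2 c = col_rest (col_set \<tau>1) e' t c"
    "\<And>c. 1 \<le> c \<and> Suc c < t \<Longrightarrow> e' (Suc c) \<le> e' c"
    "\<And>r. \<exists>r'. \<forall>c\<ge>t. ent \<tau>2 r c = ent \<tau>1 r' c"
    "\<And>r c. 1 \<le> c \<and> c < t \<Longrightarrow> e' c \<le> ent \<tau>2 r c \<Longrightarrow> e' c < ent \<tau>2 r (Suc c)"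
    using 3(1)[of "(\<tau>1, e1)" \<tau>1 e1 \<tau>2 H2, folded t_def, OF _ _ t pm(1) cd1 ps] ph by (auto simp: t_def)
  define e where "e = e'(t := e1)"
  have dr: "col_rest (col_set \<tau>1) e' t c = col_rest (col_set \<tau>) e (Suc t) c" if "1 \<le> c" for c
    using C1[OF that] C1t by (auto simp: col_rest_def e_def less_Suc_eq)
  have pk: "balanced_min (col_set \<tau> c) (col_rest (col_set \<tau>) e (Suc t) (Suc c)) (e c) \<and> e c \<noteq> 0" if c: "1 \<le> c \<and> c < Suc t" for c
  proof (cases "c = t")
    case True
    then show ?thesis using pm(2,3) by (simp add: col_rest_def e_def)
  next
    case False
    then show ?thesis using E(3)[of c] dr[of "Suc c"] C1[of c] c by (simp add: e_def)
  qed
  \<comment> \<open>If \<open>e c\<close> were smaller, its balance with the reduced column c + 1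
    would give the full column c + 1 one entry more above \<open>e c\<close> than column c has,
    contrary to weakly decreasing rows.\<close>
  have mono: "e (Suc c) \<le> e c" if c: "1 \<le> c \<and> Suc c < Suc t" for c
  proof (cases "Suc c = t")
    case True
    show ?thesis
    proof (rule ccontr)
      assume n: "\<not> e (Suc c) \<le> e c"
      have et: "e (Suc c) = e1" using True by (simp add: e_def)
      have "balanced_min (col_set \<tau> c) (col_set \<tau> t - {e1}) (e c)" using pk[of c] c True et by (simp add: col_rest_def)
      then have "card_above (col_set \<tau> c) (e c) = card_above (col_set \<tau> t - {e1}) (e c)" by (simp add: balanced_min_def)
      moreover have "card_above (col_set \<tau> t - {e1}) (e c) + 1 = card_above (col_set \<tau> t) (e c)"
        using card_above_remove[OF finite_col_set eA, of "e c"] n et by simp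
      moreover have "card_above (col_set \<tau> t) (e c) \<le> card_above (col_set \<tau> c) (e c)" using col_set_card_above_mono[OF ss, of c] c True by simp
      ultimately show False by simp
    qed
  next
    case False
    then show ?thesis using E(5)[of c] c by (simp add: e_def)
  qed
  have pers: "\<exists>r'. \<forall>c\<ge>Suc t. ent \<tau>2 r c = ent \<tau> r' c" for r
  proof -
    obtain r1 where r1: "\<forall>c\<ge>t. ent \<tau>2 r c = ent \<tau>1 r1 c" using E(6) by blast
    obtain r2 where "\<forall>c>t. ent \<tau>1 r1 c = ent \<tau> r2 c" using pm(5) by blast
    then show ?thesis using r1 by (intro exI[of _ r2]) auto
  qed
  have lst: "e c < ent \<tau>2 r (Suc c)" if c: "1 \<le> c \<and> c < Suc t" "e c \<le> ent \<tau>2 r c" for r c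
  proof (cases "c = t")
    case True
    obtain r1 where r1: "\<forall>c\<ge>t. ent \<tau>2 r c = ent \<tau>1 r1 c" using E(6) by blast
    then show ?thesis using pm(6)[of r1] c True by (simp add: e_def)
  next
    case False
    then show ?thesis using E(7)[of c r] c by (simp add: e_def)
  qed
  have H: "H = map e (rev [1..<Suc t])" using E(2) eq t by (simp add: e_def)
  have CC: "col_set \<tau>2 c = col_rest (col_set \<tau>) e (Suc t) c" if "1 \<le> c" for c using E(4)[OF that] dr[OF that] by simp
  show ?case unfolding t_def[symmetric] eq(1) using E(1) H pk CC mono pers lst by blast
qed

section \<open>The new last row and the maximum\<close>

lemma foldr_max_eq_Max: "foldr max xs 0 = Max (insert 0 (set xs))" for xs :: "nat list"
  by (induction xs) (auto simp: insert_commute)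

lemma set_concat_col_set: "set (concat \<tau>) = (\<Union>c\<in>{1..}. col_set \<tau> c)"
proof (rule set_eqI)
  fix v
  have "v \<in> set (concat \<tau>) \<longleftrightarrow> (\<exists>r<length \<tau>. \<exists>k<length (\<tau> ! r). v = \<tau> ! r ! k)"
    unfolding set_concat by (metis (no_types, lifting) UN_iff in_set_conv_nth)
  also have "\<dots> \<longleftrightarrow> (\<exists>c\<ge>1. v \<in> col_set \<tau> c)"
  proof
    assume "\<exists>r<length \<tau>. \<exists>k<length (\<tau> ! r). v = \<tau> ! r ! k"
    then obtain r k where "r < length \<tau>" "k < length (\<tau> ! r)" "v = \<tau> ! r ! k" by blast
    then show "\<exists>c\<ge>1. v \<in> col_set \<tau> c" by (intro exI[of _ "Suc k"]) (auto simp: col_set_def col_eq)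
  next
    assume "\<exists>c\<ge>1. v \<in> col_set \<tau> c"
    then obtain c r where "1 \<le> c" "r < length \<tau>" "c \<le> length (\<tau> ! r)" "v = \<tau> ! r ! (c - 1)"
      by (auto simp: col_set_def col_eq)
    then show "\<exists>r<length \<tau>. \<exists>k<length (\<tau> ! r). v = \<tau> ! r ! k"
      by (intro exI[of _ r] conjI exI[of _ "c - 1"]) auto
  qed
  finally show "v \<in> set (concat \<tau>) \<longleftrightarrow> v \<in> (\<Union>c\<in>{1..}. col_set \<tau> c)" by auto
qed

lemma col_set_le_tmax: "1 \<le> c \<Longrightarrow> v \<in> col_set \<tau> c \<Longrightarrow> v \<le> tmax \<tau>"
  unfolding tmax_def foldr_max_eq_Max
  by (rule Max_ge, simp, unfold set_concat_col_set) auto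

lemma tmaxI:
  assumes "v \<in> col_set \<tau> c" "1 \<le> c" "\<And>c u. 1 \<le> c \<Longrightarrow> u \<in> col_set \<tau> c \<Longrightarrow> u \<le> v"
  shows "tmax \<tau> = v"
  unfolding tmax_def foldr_max_eq_Max
  by (rule Max_eqI, simp, unfold set_concat_col_set) (use assms in auto)

lemma ent_snoc:
  "ent (\<tau> @ [row]) r c = (if r = Suc (length \<tau>) then (if 1 \<le> c \<and> c \<le> length row then row ! (c - 1) else 0) else ent \<tau> r c)"
  by (auto simp: ent_def nth_append)

text \<open>With N as \<open>e 0\<close>, the appended row has \<open>e (c - 1)\<close> in column c,
  so what leaves one column reappears in the next. The triple condition between this row and those
  above it is exactly the final condition of the slides.\<close>

lemma mu_main:
  assumes i: "1 \<le> i" and ss: "SSRCT \<tau>" and cd: "2 \<le> i \<longrightarrow> card (col_set \<tau> i) < card (col_set \<tau> (i - 1))"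
  shows "SSRCT (mu i \<tau>)" "tmax (mu i \<tau>) = Suc (tmax \<tau>)"
    "\<exists>e. col_shift (col_set \<tau>) e i (Suc (tmax \<tau>)) \<and> (\<forall>c\<ge>1. col_set (mu i \<tau>) c = shifted (col_set \<tau>) e i c)"
proof -
  define N where "N = Suc (tmax \<tau>)"
  obtain \<tau>' H where ps: "phis i \<tau> = (\<tau>', H)" by fastforce
  obtain e' where E: "SSRCT \<tau>'" "H = map e' (rev [1..<i])"
    "\<forall>c. 1 \<le> c \<and> c < i \<longrightarrow> balanced_min (col_set \<tau> c) (col_rest (col_set \<tau>) e' i (Suc c)) (e' c) \<and> e' c \<noteq> 0"
    "\<forall>c\<ge>1. col_set \<tau>' c = col_rest (col_set \<tau>) e' i c"
    "\<forall>c. 1 \<le> c \<and> Suc c < i \<longrightarrow> e' (Suc c) \<le> e' c"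
    "\<forall>r c. 1 \<le> c \<and> c < i \<longrightarrow> e' c \<le> ent \<tau>' r c \<longrightarrow> e' c < ent \<tau>' r (Suc c)"
    using phis_main[OF i ss cd ps] by (elim exE conjE, intro that)
  note E = E[rule_format]
  define e where "e = e'(0 := N)"
  have srt: "sorted H"
  proof -
    have "H ! k \<le> H ! Suc k" if "Suc k < length H" for k
    proof -
      have "H ! k = e' (i - 1 - k)" "H ! Suc k = e' (i - 2 - k)"
        using that by (auto simp: E(2) rev_nth Suc_diff_Suc)
      then show ?thesis using E(5)[of "i - 2 - k"] that E(2) by (auto simp: Suc_diff_Suc numeral_2_eq_2)
    qed
    then show ?thesis by (simp add: sorted_iff_nth_Suc)
  qed
  have row: "Suc (tmax \<tau>) # rev (sort H) = map e [0..<i]"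
  proof -
    have "rev (sort H) = map e' [1..<i]" using srt by (simp add: sorted_sort_id E(2) rev_map)
    also have "\<dots> = map e [1..<i]" by (auto simp: e_def)
    also have "Suc (tmax \<tau>) # \<dots> = map e [0..<i]" using i by (simp add: upt_conv_Cons e_def N_def)
    finally show ?thesis .
  qed
  have mu: "mu i \<tau> = \<tau>' @ [map e [0..<i]]" unfolding mu_def ps using row by simp
  define L where "L = length \<tau>'"
  have ent: "ent (mu i \<tau>) r c = (if r = Suc L then (if 1 \<le> c \<and> c \<le> i then e (c - 1) else 0) else ent \<tau>' r c)" for r c
    by (auto simp: mu ent_snoc L_def)
  have e0: "ent \<tau>' r c = 0" if "L < r" for r c using that by (simp add: ent_def L_def)
  have pos': "pos_rows \<tau>'" using E(1) by (simp add: SSRCT_ent)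
  have enz: "e c \<noteq> 0" if "c < i" for c using E(3)[of c] that by (auto simp: e_def N_def)
  have em: "e c \<in> col_set \<tau> c" if "1 \<le> c" "c < i" for c using E(3)[of c] that by (auto simp: e_def balanced_min_def)
  have pos: "pos_rows (mu i \<tau>)"
    using pos' enz i unfolding pos_rows_iff mu by (auto simp: Suc_le_eq)
  have edec: "e c \<le> e (c - 1)" if c: "1 \<le> c" "c < i" for c
  proof (cases "c = 1")
    case True
    then show ?thesis using col_set_le_tmax[OF _ em[OF c]] c by (simp add: e_def N_def)
  next
    case False
    then show ?thesis using E(5)[of "c - 1"] c by (simp add: e_def)
  qed
  have sub: "col_set \<tau>' c \<subseteq> col_set \<tau> c" if "1 \<le> c" for c using E(4)[OF that] by (auto simp: col_rest_def)
  show "SSRCT (mu i \<tau>)" unfolding SSRCT_ent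
  proof (intro conjI allI impI)
    show "pos_rows (mu i \<tau>)" by (rule pos)
    fix c :: nat assume c: "1 \<le> c"
    show "ent (mu i \<tau>) r (Suc c) \<le> ent (mu i \<tau>) r c" for r
      using E(1) c edec[OF c] by (auto simp: ent SSRCT_ent)
    have tr: "triple_rule (\<lambda>r. ent \<tau>' r c) (\<lambda>r. ent \<tau>' r (Suc c))" using E(1) c by (simp add: SSRCT_ent)
    show "triple_rule (\<lambda>r. ent (mu i \<tau>) r c) (\<lambda>r. ent (mu i \<tau>) r (Suc c))" unfolding triple_rule_def
    proof (intro allI impI)
      fix r s assume h: "r < s" "ent (mu i \<tau>) s (Suc c) \<noteq> 0" "ent (mu i \<tau>) s (Suc c) \<le> ent (mu i \<tau>) r c"
      have sL: "s \<le> Suc L" using h(2) e0[of s "Suc c"] by (force simp: ent split: if_splits)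
      then have rL: "r \<noteq> Suc L" using h(1) by simp
      show "ent (mu i \<tau>) s (Suc c) < ent (mu i \<tau>) r (Suc c)"
      proof (cases "s = Suc L")
        case True
        then have "c < i" using h(2) by (auto simp: ent split: if_splits)
        then show ?thesis using E(6)[of c r] h True rL c by (simp add: ent e_def)
      next
        case False
        then show ?thesis using tr h rL by (simp add: ent triple_rule_def)
      qed
    qed
  next
    fix r s assume h: "1 \<le> r" "r < s" "s \<le> length (mu i \<tau>)"
    then have rL: "r \<le> L" "r \<noteq> Suc L" and sL: "s \<le> Suc L" by (auto simp: mu L_def)
    have "ent \<tau>' r 1 \<noteq> 0" using pos' h(1) rL by (simp add: pos_rows_def L_def)
    then have "ent \<tau>' r 1 \<in> col_set \<tau> 1" using sub[of 1] col_set_ent[OF pos', of 1] by auto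
    then have "ent \<tau>' r 1 < N" using col_set_le_tmax[of 1] by (simp add: N_def less_Suc_eq_le)
    then show "ent (mu i \<tau>) r 1 < ent (mu i \<tau>) s 1"
      using h(1,2) sL rL E(1) i by (cases "s = Suc L") (auto simp: ent e_def SSRCT_ent L_def[symmetric])
  qed
  have cs: "col_set (mu i \<tau>) c = shifted (col_set \<tau>) e i c" if c: "1 \<le> c" for c
  proof -
    let ?x = "ent (mu i \<tau>) (Suc L) c"
    have "v \<in> range (\<lambda>r. ent (mu i \<tau>) r c) \<longleftrightarrow> v = ?x \<or> v \<in> range (\<lambda>r. ent \<tau>' r c)" if "v \<noteq> 0" for v
    proof
      assume "v \<in> range (\<lambda>r. ent (mu i \<tau>) r c)"
      then obtain r where "v = ent (mu i \<tau>) r c" by blast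
      then show "v = ?x \<or> v \<in> range (\<lambda>r. ent \<tau>' r c)" by (cases "r = Suc L") (simp_all add: ent)
    next
      assume "v = ?x \<or> v \<in> range (\<lambda>r. ent \<tau>' r c)"
      then show "v \<in> range (\<lambda>r. ent (mu i \<tau>) r c)"
      proof
        assume "v \<in> range (\<lambda>r. ent \<tau>' r c)"
        then obtain r where r: "v = ent \<tau>' r c" by blast
        then have "r \<noteq> Suc L" using e0[of "Suc L" c] that by auto
        then have "v = ent (mu i \<tau>) r c" using r by (simp add: ent)
        then show ?thesis by (rule range_eqI)
      qed blast
    qed
    then have r1: "range (\<lambda>r. ent (mu i \<tau>) r c) - {0} = insert ?x (range (\<lambda>r. ent \<tau>' r c)) - {0}"
      by (intro set_eqI) (simp only: Diff_iff insert_iff singleton_iff, blast)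
    have "range (\<lambda>r. ent (mu i \<tau>) r c) - {0} =
        (if c \<le> i then {e (c - 1)} else {}) \<union> (range (\<lambda>r. ent \<tau>' r c) - {0})"
    proof (cases "c \<le> i")
      case True
      then have "?x = e (c - 1)" "e (c - 1) \<noteq> 0" using c enz[of "c - 1"] by (simp_all add: ent)
      then show ?thesis unfolding r1 using True by (simp add: insert_Diff_if)
    next
      case False
      then have "?x = 0" by (simp add: ent)
      then show ?thesis unfolding r1 using False by simp
    qed
    moreover have "range (\<lambda>r. ent \<tau>' r c) - {0} = col_rest (col_set \<tau>) e i c"
      using col_set_ent[OF pos' c] E(4)[OF c] c by (cases "c < i") (simp_all add: col_rest_def e_def)
    ultimately show ?thesis
      unfolding col_set_ent[OF pos c] by (simp add: shifted_def col_rest_def)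
  qed
  show "\<exists>e. col_shift (col_set \<tau>) e i (Suc (tmax \<tau>)) \<and> (\<forall>c\<ge>1. col_set (mu i \<tau>) c = shifted (col_set \<tau>) e i c)"
  proof (intro exI conjI)
    have "col_rest (col_set \<tau>) e i (Suc k) = col_rest (col_set \<tau>) e' i (Suc k)" for k
      by (simp add: col_rest_def e_def)
    moreover have "1 \<le> k \<Longrightarrow> e k = e' k" "e 0 = Suc (tmax \<tau>)" for k by (simp_all add: e_def N_def)
    ultimately show "col_shift (col_set \<tau>) e i (Suc (tmax \<tau>))"
      using E(3) by (simp add: col_shift_def)
    show "\<forall>c\<ge>1. col_set (mu i \<tau>) c = shifted (col_set \<tau>) e i c" using cs by blast
  qed
  have eN: "e c \<le> N" if "c < i" for c
    using col_set_le_tmax[OF _ em[OF _ that]] by (cases "c = 0") (auto simp: e_def N_def le_Suc_eq)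
  have "tmax (mu i \<tau>) = N"
  proof (rule tmaxI)
    show "N \<in> col_set (mu i \<tau>) 1" using i by (simp add: cs shifted_def e_def)
    fix c u assume c: "1 \<le> c" "u \<in> col_set (mu i \<tau>) c"
    have "u \<in> col_set \<tau> c \<or> c \<le> i \<and> u = e (c - 1)"
      using c by (auto simp: cs shifted_def col_rest_def split: if_splits)
    then show "u \<le> N" using col_set_le_tmax[OF c(1), of u \<tau>] eN[of "c - 1"] c by (auto simp: N_def)
  qed simp
  then show "tmax (mu i \<tau>) = Suc (tmax \<tau>)" by (simp add: N_def)
qed

section \<open>Comparison of the two sides\<close>

lemma col_shift_unique:
  assumes "col_shift C e g N" "col_shift C e' g N"
  shows "c < g \<Longrightarrow> e c = e' c"
proof (induction "g - c" arbitrary: c rule: less_induct)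
  case less
  show ?case
  proof (cases "c = 0")
    case True
    then show ?thesis using assms by (simp add: col_shift_def)
  next
    case False
    have "col_rest C e g (Suc c) = col_rest C e' g (Suc c)" using less.hyps[of "Suc c"] less.prems by (auto simp: col_rest_def)
    moreover have "balanced_min (C c) (col_rest C e g (Suc c)) (e c)" "balanced_min (C c) (col_rest C e' g (Suc c)) (e' c)"
      using assms less.prems False by (simp_all add: col_shift_def)
    ultimately show ?thesis using balanced_min_unique by simp
  qed
qed

lemma shifted_unique:
  assumes "col_shift C e g N" "col_shift C e' g N" "1 \<le> c"
  shows "shifted C e g c = shifted C e' g c"
proof -
  have "e k = e' k" if "k < g" for k using col_shift_unique[OF assms(1,2) that] .
  then show ?thesis using assms(3) by (auto simp: shifted_def col_rest_def)
qed

section \<open>Columns determine the image under rho\<close>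

lemma rho_cong:
  assumes "\<And>c. 1 \<le> c \<Longrightarrow> sort (col \<tau> c) = sort (col Q c)"
  shows "rho \<tau> = rho Q"
proof -
  have l: "length (col \<tau> c) = length (col Q c)" if "1 \<le> c" for c
    using assms[OF that] by (metis length_sort)
  have ncols_iff: "c \<le> ncols T \<longleftrightarrow> col T c \<noteq> []" if "1 \<le> c" for T c
  proof -
    have "c \<le> ncols T \<longleftrightarrow> (\<exists>row\<in>set T. c \<le> length row)"
      unfolding ncols_def foldr_max_eq_Max using that by (subst Max_ge_iff) auto
    also have "\<dots> \<longleftrightarrow> (\<exists>i<length T. c \<le> length (T ! i))" by (metis in_set_conv_nth)
    also have "\<dots> \<longleftrightarrow> col T c \<noteq> []" by (auto simp: col_eq filter_empty_conv)
    finally show ?thesis .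
  qed
  have "1 \<le> c \<Longrightarrow> c \<le> ncols \<tau> \<longleftrightarrow> c \<le> ncols Q" for c using ncols_iff l by (metis length_0_conv)
  then have n: "ncols \<tau> = ncols Q"
    by (metis One_nat_def Suc_leI le_antisym linorder_not_less order_refl zero_le not_gr_zero)
  show ?thesis unfolding rho_def n l[OF order_refl]
    using assms l by (intro map_cong refl filter_cong) auto
qed

text \<open>The columns of a recording tableau decrease upwards because labels are written in
  decreasing order, so sorting does nothing, and the straight shape makes the reassembled rows the
  old ones.\<close>

lemma rho_run:
  assumes r: "rs_state P Q m"
  shows "rho Q = Q"
proof -
  note pt = rs_state_partition_shape(1)[OF r]
  have h: "j < length (col Q c) \<longleftrightarrow> c \<le> row_len Q j" if "1 \<le> c" for c j
    using rs_state_height(1,4)[OF r that] by simp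
  have ne: "row_len Q j > 0" if "j < length Q" for j
    using r that by (auto simp: row_len_def rs_state_def)
  have l1: "length (col Q 1) = length Q"
  proof -
    have "j < length (col Q 1) \<longleftrightarrow> j < length Q" for j
      using h[of 1 j] ne[of j] by (auto simp: row_len_def Suc_le_eq)
    then show ?thesis by (meson less_irrefl linorder_neqE_nat)
  qed
  have srt: "rev (sort (col Q c)) = col Q c" if "1 \<le> c" for c
  proof -
    have d: "sorted_wrt (>) (col Q c)" using r that by (simp add: rs_state_def)
    then have "sorted (rev (col Q c))"
      by (auto simp: sorted_wrt_rev intro: sorted_wrt_mono_rel[of _ "(>)"])
    then have "sort (col Q c) = rev (col Q c)"
      using sorted_wrt_gt_distinct[OF d] by (intro sorted_distinct_set_unique) auto
    then show ?thesis by simp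
  qed
  have nc: "row_len Q j \<le> ncols Q" for j
    unfolding ncols_def foldr_max_eq_Max row_len_def by (auto intro!: Max_ge)
  have row: "map (\<lambda>c. rev (sort (col Q c)) ! j) (filter (\<lambda>c. j < length (col Q c)) [1..<Suc (ncols Q)]) = Q ! j"
    if j: "j < length Q" for j
  proof -
    have "filter (\<lambda>c. j < length (col Q c)) [1..<Suc (ncols Q)] = filter (\<lambda>c. c \<le> row_len Q j) [1..<Suc (ncols Q)]"
      by (intro filter_cong refl) (use h in auto)
    also have "\<dots> = [1..<Suc (row_len Q j)]"
    proof -
      have "[1..<Suc (ncols Q)] = [1..<Suc (row_len Q j)] @ [Suc (row_len Q j)..<Suc (ncols Q)]"
        using nc[of j] by (metis Suc_le_mono le_add_diff_inverse le_add1 plus_1_eq_Suc upt_add_eq_append)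
      moreover have "filter (\<lambda>c. c \<le> row_len Q j) [1..<Suc (row_len Q j)] = [1..<Suc (row_len Q j)]"
        by (rule filter_True) auto
      moreover have "filter (\<lambda>c. c \<le> row_len Q j) [Suc (row_len Q j)..<Suc (ncols Q)] = []"
        by (rule filter_False) auto
      ultimately show ?thesis by simp
    qed
    finally have f: "filter (\<lambda>c. j < length (col Q c)) [1..<Suc (ncols Q)] = [1..<Suc (row_len Q j)]" .
    show ?thesis unfolding f
    proof (rule nth_equalityI)
      show "length (map (\<lambda>c. rev (sort (col Q c)) ! j) [1..<Suc (row_len Q j)]) = length (Q ! j)"
        using j by (simp add: row_len_def del: upt_Suc)
      fix k assume "k < length (map (\<lambda>c. rev (sort (col Q c)) ! j) [1..<Suc (row_len Q j)])"
      then have k: "k < row_len Q j" by (simp del: upt_Suc)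
      obtain n where n: "\<forall>i. i < n \<longleftrightarrow> Suc k \<le> row_len Q i" using col_height[OF pt, of "Suc k"] by auto
      have "col Q (Suc k) = map (\<lambda>i. Q ! i ! k) [0..<n]"
        using col_prefix[OF pt, of "Suc k" n] n spec[OF n, of n] by simp
      moreover have "j < n" using n k by simp
      ultimately show "map (\<lambda>c. rev (sort (col Q c)) ! j) [1..<Suc (row_len Q j)] ! k = Q ! j ! k"
        using k srt[of "Suc k"] by (simp del: upt_Suc)
    qed
  qed
  show ?thesis unfolding rho_def l1 by (rule nth_equalityI) (use row in auto)
qed

lemma SSRCT_col_distinct:
  assumes "SSRCT \<tau>" "1 \<le> c"
  shows "distinct (col \<tau> c)"
proof -
  have pos: "pos_rows \<tau>" using assms by (simp add: SSRCT_ent)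
  have "inj_on (\<lambda>r. \<tau> ! r ! (c - 1)) {r. r < length \<tau> \<and> c \<le> length (\<tau> ! r)}"
  proof (rule inj_onI, clarsimp)
    fix r s assume h: "r < length \<tau>" "c \<le> length (\<tau> ! r)" "s < length \<tau>" "c \<le> length (\<tau> ! s)"
      "\<tau> ! r ! (c - Suc 0) = \<tau> ! s ! (c - Suc 0)"
    then have "ent \<tau> (Suc r) c = ent \<tau> (Suc s) c" "inshape \<tau> (Suc r) c"
      using assms(2) by (auto simp: ent_def inshape_def)
    then have "Suc r = Suc s" using SSRCT_inj_nonzero[OF assms] inshape_ent[OF pos] unfolding inj_nonzero_def by blast
    then show "r = s" by simp
  qed
  then show ?thesis by (simp add: col_eq distinct_map)
qed

section \<open>The standardization, and the induction over the word\<close>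

lemma standardizesI:
  assumes "length s = length w"
    "\<And>p q. p < length w \<Longrightarrow> q < length w \<Longrightarrow> s ! p < s ! q \<longleftrightarrow> w ! p < w ! q \<or> (w ! p = w ! q \<and> p < q)"
  shows "standardizes w s"
  using assms
proof (induction w s rule: standardizes.induct)
  case (2 i w y s)
  have "standardizes w s"
  proof (rule 2(1))
    show "length s = length w" using 2(2) by simp
    show "s ! p < s ! q \<longleftrightarrow> w ! p < w ! q \<or> (w ! p = w ! q \<and> p < q)" if "p < length w" "q < length w" for p q
      using 2(3)[of "Suc p" "Suc q"] that by simp
  qed
  moreover have "v \<noteq> y \<and> (y < v \<longleftrightarrow> i \<le> a)" if "(a, v) \<in> set (zip w s)" for a v
  proof -
    have "\<exists>q. q < length w \<and> a = w ! q \<and> v = s ! q" using that 2(2) by (auto simp: set_zip)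
    then obtain q where q: "q < length w" "a = w ! q" "v = s ! q" by blast
    have "y < v \<longleftrightarrow> i \<le> a" using 2(3)[of 0 "Suc q"] q by auto
    moreover have "v < y \<longleftrightarrow> a < i" using 2(3)[of "Suc q" 0] q by auto
    ultimately show ?thesis by auto
  qed
  ultimately show ?case by auto
qed auto

lemma standardizes_std: "standardizes w (std w)"
proof (rule standardizesI)
  show "length (std w) = length w" by (simp add: std_def)
  fix p q assume pq: "p < length w" "q < length w"
  define lt where "lt p q \<longleftrightarrow> w ! p < w ! q \<or> (w ! p = w ! q \<and> p < q)" for p q
  define S where "S p = {q. q < length w \<and> lt q p}" for p
  have fin: "finite (S p)" for p by (simp add: S_def)
  have n: "std w ! p = Suc (card (S p))" if "p < length w" for p
    using that by (simp add: std_def S_def lt_def)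
  have less: "card (S p) < card (S q)" if "lt p q" "p < length w" for p q
  proof (rule psubset_card_mono[OF fin])
    have "S p \<subseteq> S q" using that(1) by (auto simp: S_def lt_def)
    moreover have "p \<in> S q" "p \<notin> S p" using that by (auto simp: S_def lt_def)
    ultimately show "S p \<subset> S q" by blast
  qed
  have "lt p q \<or> p = q \<or> lt q p" by (auto simp: lt_def)
  then have "card (S p) < card (S q) \<longleftrightarrow> lt p q"
    using less[of p q] less[of q p] pq by auto
  then show "std w ! p < std w ! q \<longleftrightarrow> w ! p < w ! q \<or> (w ! p = w ! q \<and> p < q)"
    using n pq by (simp add: lt_def)
qed

text \<open>The maximum is part of the induction because it makes the new first entry of the
  composition tableau equal to the label of the prepended letter. The lattice condition makes column
  i - 1 strictly taller than column i before the slides begin.\<close>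

lemma mu_rs:
  "standardizes w s \<Longrightarrow> reverse_lattice w \<Longrightarrow>
    SSRCT (foldr mu w []) \<and> tmax (foldr mu w []) = length w \<and> col_set (foldr mu w []) = col_set (rs_Q s)"
proof (induction w s rule: standardizes.induct)
  case 1
  show ?case by (simp add: SSRCT_def inshape_def tmax_def rs_Q_def)
next
  case (2 i w y s)
  have lw: "reverse_lattice w" and sz: "standardizes w s" using lattice_tl[OF 2(3)] 2(2) by auto
  define \<tau> where "\<tau> = foldr mu w []"
  have IH: "SSRCT \<tau>" "tmax \<tau> = length w" "col_set \<tau> = col_set (rs_Q s)"
    using 2(1)[OF sz lw] by (auto simp: \<tau>_def)
  have i1: "1 \<le> i" using 2(3) by (simp add: reverse_lattice_def)
  have cd: "2 \<le> i \<longrightarrow> card (col_set \<tau> i) < card (col_set \<tau> (i - 1))"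
  proof
    assume i2: "2 \<le> i"
    have "count_list (i # w) i \<le> count_list (i # w) (i - 1)" using lattice_count[OF 2(3), of "i - 1" i] i2 by simp
    then show "card (col_set \<tau> i) < card (col_set \<tau> (i - 1))"
      using rs_count[OF lw sz, of i] rs_count[OF lw sz, of "i - 1"] i2 IH(3) by (auto split: if_splits)
  qed
  note m = mu_main[OF i1 IH(1) cd]
  obtain e where e: "col_shift (col_set \<tau>) e i (Suc (tmax \<tau>))" "\<forall>c\<ge>1. col_set (mu i \<tau>) c = shifted (col_set \<tau>) e i c"
    using m(3) by blast
  obtain e' where e': "col_shift (col_set (rs_Q s)) e' i (Suc (length w))"
    "\<forall>c\<ge>1. col_set (rs_Q (y # s)) c = shifted (col_set (rs_Q s)) e' i c"
    using rs_cols[OF 2(3,2)] by blast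
  have "col_set (mu i \<tau>) c = col_set (rs_Q (y # s)) c" for c
  proof (cases "c = 0")
    case False
    then show ?thesis using shifted_unique[of "col_set \<tau>" e i "Suc (length w)" e' c] e e' IH by simp
  qed (simp add: col_set_def)
  then show ?case using m(1,2) IH(2) by (simp add: \<tau>_def[symmetric] fun_eq_iff)
qed auto

text \<open>As rho is a bijection from SSRCTs onto tableaux of straight shape, an SSRCT with image
  \<open>rs_Q (std w)\<close> is the preimage of that tableau, as the equation asserts.\<close>

theorem theorem8p7:
  fixes w :: "nat list"
  assumes "reverse_lattice w"
  shows "SSRCT (foldr mu w []) \<and> rho (foldr mu w []) = rs_Q (std w)"
proof
  note m = mu_rs[OF standardizes_std assms]
  show ss: "SSRCT (foldr mu w [])" using m by blast
  have r: "rs_state (rs_P (std w) []) (rs_Q (std w)) 0" using rs_run[OF assms standardizes_std] by blast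
  have "rho (foldr mu w []) = rho (rs_Q (std w))"
  proof (rule rho_cong)
    fix c :: nat assume c: "1 \<le> c"
    have "col_set (foldr mu w []) = col_set (rs_Q (std w))" using m by blast
    from fun_cong[OF this, of c] have "set (col (foldr mu w []) c) = set (col (rs_Q (std w)) c)"
      using c by (simp add: col_set_def)
    moreover have "distinct (col (rs_Q (std w)) c)" using r c by (auto simp: rs_state_def intro: sorted_wrt_gt_distinct)
    ultimately show "sort (col (foldr mu w []) c) = sort (col (rs_Q (std w)) c)"
      using SSRCT_col_distinct[OF ss c] by (intro sorted_distinct_set_unique) auto
  qed
  then show "rho (foldr mu w []) = rs_Q (std w)" using rho_run[OF r] by simp
qed

end
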